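(* Let $d,n\ge1$, $A=A(d,1,n)$, $G=G(d,1,n)=A\rtimes S_n$ acting on $B=\mathbb C[x_1,\dots,x_n]$. (1) The simple $\mathcal D_B^A$-submodules of $B$ are of the form $N_\alpha=B^Ax^\alpha$, where $\alpha:\{1,\dots,n\}\to\{0,\dots,d-1\}$. If $N_\beta=B^Ax^\beta$, $\beta:\{1,\dots,n\}\to\{0,\dots,d-1\}$, is another such module, then $N_\beta\cong N_\alpha\iff\alpha=\beta$. (2) Let $\alpha:\{1,\dots,n\}\to\{0,\dots,d-1\}$, let $P$ be an $\alpha$-partition and define $s_P^\alpha=s_Px^\alpha$, where $s_P$ is the Jacobian of the map $B^{G_P^\alpha}\to B^A$. Then $N_P^\alpha=\mathcal D_B^{G_P^\alpha}s_P^\alpha=B^{G_P^\alpha}s_P^\alpha$ is a simple $\mathcal D_B^{G_P^\alpha}$-module. (3) The module $M_P^\alpha=J_{G_P^\alpha}^G(N_P^\alpha)=\mathcal D_B^Gs_P^\alpha$ is a simple $\mathcal D_B^G$-submodule of $B$. (4) Let $\beta:\{1,\dots,n\}\to\{0,\dots,d-1\}$ be another multi-index and $Q$ a $\beta$-partition. Then $M_P^\alpha\cong M_Q^\beta$ if and only if $\lambda^P=\lambda^Q$ and $\beta\in S_n\cdot\alpha$. (5) Let $M$ be a simple $\mathcal D_B^G$-submodule of $B$. Then there exist a multi-index $\alpha:\{1,\dots,n\}\to\{0,\dots,d-1\}$ and an $\alpha$-partition $P$ such that $M\cong M_P^\alpha$.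
   Context: $A(d,1,n)$ is the group of diagonal $n\times n$ matrices with entries $d$-th roots of unity, $S_n$ the permutation matrices; so $B^A=\mathbb C[x_1^d,\dots,x_n^d]$. $\mathcal D_B$ is the Weyl algebra, graded by $\deg x_i=1$, $\deg\partial_i=-1$; for a group $K$ acting, $\mathcal D_B^K$ is the ring of invariants and $(\mathcal D_B^K)^-$ the sum of its parts of negative degree. For a subgroup $H\subset G$ and a $\mathcal D_B^H$-submodule $N\subset B$, $J_H^G(N)=\mathcal D_B^G\cdot\{y\in N:(\mathcal D_B^H)^-y=0\}$. $x^\alpha=\prod_ix_i^{\alpha(i)}$. $S_n$ acts on multi-indices by $\sigma\cdot\alpha=\alpha\circ\sigma^{-1}$. Put $P_\alpha(i)=\{j:\alpha(j)=i\}$. An $\alpha$-partition is a set partition $P=\{P_{ij}\}$ of $\{1,\dots,n\}$ with $\bigcup_jP_{ij}=P_\alpha(i)$ for each $i$. $\lambda^P$ denotes the sequence, indexed by $i\in\{0,\dots,d-1\}$, of the integer partitions $\{|P_{ij}|\}_j\vdash|P_\alpha(i)|$ (a sequence of Young diagrams). $S(\Omega)$ is the symmetric group of a subset $\Omega\subset\{1,\dots,n\}$, and $G_P^\alpha=A\rtimes\prod_{ij}S(P_{ij})$. The Jacobian $s_P$ is the determinant of the partial derivatives of homogeneous algebra generators of the polynomial ring $B^{G_P^\alpha}$ with respect to the generators $x_1^d,\dots,x_n^d$ of $B^A$; it is defined up to a nonzero constant and may be taken as $s_P=\prod_{ij}\prod_{k<l,\ k,l\in P_{ij}}(x_k^d-x_l^d)$.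 *)

theory Defs
  imports
    "HOL-Analysis.Analysis"
    "HOL-Library.Poly_Mapping"
    "HOL-Library.Multiset"
    "HOL-Library.Disjoint_Sets"
    "HOL-Combinatorics.Permutations"
begin

text \<open>
  The index set \<open>{1,\<dots>,n}\<close> is a finite type \<open>'n\<close>, so \<open>n = CARD('n) \<ge> 1\<close>, and
  \<open>B = \<complex>[x\<^sub>1,\<dots>,x\<^sub>n]\<close> is the whole type \<open>'n cpoly\<close>.  Rings of differential operators
  are sets of maps \<open>B \<Rightarrow> B\<close>.
\<close>

type_synonym 'n cpoly = "('n \<Rightarrow>\<^sub>0 nat) \<Rightarrow>\<^sub>0 complex"
type_synonym 'n oper = "'n cpoly \<Rightarrow> 'n cpoly"

section \<open>Polynomials\<close>

definition Cst :: "complex \<Rightarrow> 'n cpoly" where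
  "Cst c = Poly_Mapping.single 0 c"

definition X :: "'n \<Rightarrow> 'n cpoly" where
  "X i = Poly_Mapping.single (Poly_Mapping.single i 1) 1"

text \<open>The exponent subtraction is truncated at 0, but then the coefficient vanishes.\<close>

definition pdiff :: "'n \<Rightarrow> 'n oper" where
  "pdiff i p = (\<Sum>m\<in>Poly_Mapping.keys p.
     Poly_Mapping.single (m - Poly_Mapping.single i 1)
       (of_nat (Poly_Mapping.lookup m i) * Poly_Mapping.lookup p m))"

definition poly_subst :: "('n::finite \<Rightarrow> 'n cpoly) \<Rightarrow> 'n oper" where
  "poly_subst f p = (\<Sum>m\<in>Poly_Mapping.keys p.
     Cst (Poly_Mapping.lookup p m) * (\<Prod>i\<in>UNIV. f i ^ Poly_Mapping.lookup m i))"

definition homogeneous :: "'n::finite cpoly \<Rightarrow> bool" where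
  "homogeneous p \<longleftrightarrow>
     (\<exists>k. \<forall>m\<in>Poly_Mapping.keys p. (\<Sum>i\<in>UNIV. Poly_Mapping.lookup m i) = k)"

definition xpow :: "('n::finite \<Rightarrow> nat) \<Rightarrow> 'n cpoly" where
  "xpow \<alpha> = (\<Prod>i\<in>UNIV. X i ^ \<alpha> i)"

section \<open>Submodules of an abelian group over a set of operators\<close>

text \<open>Here \<open>R\<close> is meant to be a ring of additive endomorphisms of \<open>'b\<close>.\<close>

definition op_submodule :: "('b::ab_group_add \<Rightarrow> 'b) set \<Rightarrow> 'b set \<Rightarrow> bool" where
  "op_submodule R N \<longleftrightarrow> 0 \<in> N \<and> (\<forall>x\<in>N. \<forall>y\<in>N. x - y \<in> N) \<and> (\<forall>D\<in>R. \<forall>x\<in>N. D x \<in> N)"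

definition op_simple :: "('b::ab_group_add \<Rightarrow> 'b) set \<Rightarrow> 'b set \<Rightarrow> bool" where
  "op_simple R N \<longleftrightarrow> op_submodule R N \<and> N \<noteq> {0} \<and>
     (\<forall>N'. op_submodule R N' \<longrightarrow> N' \<subseteq> N \<longrightarrow> N' = {0} \<or> N' = N)"

definition op_iso :: "('b::ab_group_add \<Rightarrow> 'b) set \<Rightarrow> 'b set \<Rightarrow> 'b set \<Rightarrow> bool" where
  "op_iso R N N' \<longleftrightarrow> (\<exists>\<phi>. bij_betw \<phi> N N' \<and>
     (\<forall>x\<in>N. \<forall>y\<in>N. \<phi> (x + y) = \<phi> x + \<phi> y) \<and> (\<forall>D\<in>R. \<forall>x\<in>N. \<phi> (D x) = D (\<phi> x)))"

text \<open>\<open>R \<cdot> S\<close>: all finite sums of elements \<open>D y\<close> with \<open>D \<in> R\<close> and \<open>y \<in> S\<close>.\<close>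

definition op_gen :: "('b::ab_group_add \<Rightarrow> 'b) set \<Rightarrow> 'b set \<Rightarrow> 'b set" where
  "op_gen R S = {\<Sum>y\<in>F. D y y | F D. finite F \<and> F \<subseteq> S \<and> (\<forall>y\<in>F. D y \<in> R)}"

section \<open>The Weyl algebra, its grading and its invariants\<close>

inductive_set weyl :: "'n oper set" where
  const: "(\<lambda>p. Cst c * p) \<in> weyl"
| mult: "(\<lambda>p. X i * p) \<in> weyl"
| pdiff: "pdiff i \<in> weyl"
| add: "D \<in> weyl \<Longrightarrow> E \<in> weyl \<Longrightarrow> (\<lambda>p. D p + E p) \<in> weyl"
| comp: "D \<in> weyl \<Longrightarrow> E \<in> weyl \<Longrightarrow> D \<circ> E \<in> weyl"

text \<open>\<open>weyl_hom k D\<close>: the operator \<open>D\<close> is homogeneous of degree \<open>k\<close>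
  for the grading of the Weyl algebra with \<open>deg x\<^sub>i = 1\<close>, \<open>deg \<partial>\<^sub>i = -1\<close>.\<close>

inductive weyl_hom :: "int \<Rightarrow> 'n oper \<Rightarrow> bool" where
  const: "weyl_hom 0 (\<lambda>p. Cst c * p)"
| mult: "weyl_hom 1 (\<lambda>p. X i * p)"
| pdiff: "weyl_hom (-1) (pdiff i)"
| add: "weyl_hom k D \<Longrightarrow> weyl_hom k E \<Longrightarrow> weyl_hom k (\<lambda>p. D p + E p)"
| comp: "weyl_hom k D \<Longrightarrow> weyl_hom l E \<Longrightarrow> weyl_hom (k + l) (D \<circ> E)"

text \<open>A matrix \<open>g\<close> acts on \<open>B\<close> by the algebra endomorphism
  \<open>x\<^sub>j \<mapsto> \<Sum>\<^sub>i g\<^sub>i\<^sub>j x\<^sub>i\<close>, and on operators by conjugation.  The contragredient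
  convention gives the same set of automorphisms for all groups considered here.\<close>

definition mat_act :: "complex^'n^'n \<Rightarrow> 'n::finite oper" where
  "mat_act g = poly_subst (\<lambda>j. \<Sum>i\<in>UNIV. Cst (g $ i $ j) * X i)"

definition op_act :: "complex^'n^'n \<Rightarrow> 'n::finite oper \<Rightarrow> 'n oper" where
  "op_act g D = mat_act g \<circ> D \<circ> mat_act (matrix_inv g)"

definition poly_inv :: "(complex^'n^'n) set \<Rightarrow> 'n::finite cpoly set" where
  "poly_inv K = {p. \<forall>g\<in>K. mat_act g p = p}"

definition weyl_inv :: "(complex^'n^'n) set \<Rightarrow> 'n::finite oper set" where
  "weyl_inv K = {D \<in> weyl. \<forall>g\<in>K. op_act g D = D}"

definition weyl_inv_neg :: "(complex^'n^'n) set \<Rightarrow> 'n::finite oper set" where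
  "weyl_inv_neg K = {\<lambda>p. \<Sum>k\<in>S. E k p | S E. finite S \<and>
     (\<forall>k\<in>S. k < 0 \<and> E k \<in> weyl_inv K \<and> weyl_hom k (E k))}"

text \<open>\<open>J H G N\<close> is \<open>J\<^sub>H\<^sup>G(N)\<close>.\<close>

definition J :: "(complex^'n^'n) set \<Rightarrow> (complex^'n^'n) set \<Rightarrow>
    'n::finite cpoly set \<Rightarrow> 'n cpoly set" where
  "J H G N = op_gen (weyl_inv G) {y \<in> N. \<forall>D\<in>weyl_inv_neg H. D y = 0}"

section \<open>The groups\<close>

definition A_mats :: "nat \<Rightarrow> (complex^'n^'n) set" where
  "A_mats d = {\<chi> i j. if i = j then a i else 0 | a. \<forall>i. a i ^ d = 1}"

definition perm_mat :: "('n \<Rightarrow> 'n) \<Rightarrow> complex^'n^'n" where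
  "perm_mat \<sigma> = (\<chi> i j. if i = \<sigma> j then 1 else 0)"

definition G_mats :: "nat \<Rightarrow> (complex^'n^'n) set" where
  "G_mats d = {a ** perm_mat \<sigma> | a \<sigma>. a \<in> A_mats d \<and> \<sigma> permutes UNIV}"

text \<open>For a partition \<open>P\<close> of the index set, the product of the groups \<open>S(\<Omega>)\<close>, \<open>\<Omega> \<in> P\<close>,
  consists of the permutations that preserve every block.\<close>

definition GP_mats :: "nat \<Rightarrow> 'n set set \<Rightarrow> (complex^'n^'n) set" where
  "GP_mats d P = {a ** perm_mat \<sigma> | a \<sigma>. a \<in> A_mats d \<and> \<sigma> permutes UNIV \<and> (\<forall>\<Omega>\<in>P. \<sigma> ` \<Omega> = \<Omega>)}"

section \<open>Multi-indices and their partitions\<close>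

definition multi_index :: "nat \<Rightarrow> ('n \<Rightarrow> nat) \<Rightarrow> bool" where
  "multi_index d \<alpha> \<longleftrightarrow> (\<forall>j. \<alpha> j < d)"

definition level :: "('n \<Rightarrow> nat) \<Rightarrow> nat \<Rightarrow> 'n set" where
  "level \<alpha> i = {j. \<alpha> j = i}"

text \<open>An \<open>\<alpha>\<close>-partition is stored as its set of blocks; \<open>blocks_at \<alpha> P i\<close> is the set
  of the blocks \<open>P\<^sub>i\<^sub>j\<close>, for \<open>j\<close> varying.\<close>

definition blocks_at :: "('n \<Rightarrow> nat) \<Rightarrow> 'n set set \<Rightarrow> nat \<Rightarrow> 'n set set" where
  "blocks_at \<alpha> P i = {\<Omega> \<in> P. \<Omega> \<subseteq> level \<alpha> i}"

definition alpha_partition :: "('n \<Rightarrow> nat) \<Rightarrow> 'n set set \<Rightarrow> bool" where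
  "alpha_partition \<alpha> P \<longleftrightarrow> partition_on UNIV P \<and> (\<forall>i. \<Union>(blocks_at \<alpha> P i) = level \<alpha> i)"

text \<open>The integer partition \<open>{|P\<^sub>i\<^sub>j|}\<^sub>j\<close> is encoded as a multiset of positive integers;
  it is empty for \<open>i\<close> outside the range of \<open>\<alpha>\<close>.\<close>

definition shape :: "('n \<Rightarrow> nat) \<Rightarrow> 'n::finite set set \<Rightarrow> nat \<Rightarrow> nat multiset" where
  "shape \<alpha> P i = image_mset card (mset_set (blocks_at \<alpha> P i))"

section \<open>The Jacobian\<close>

text \<open>\<open>dpow d F = F(x\<^sub>1\<^sup>d,\<dots>,x\<^sub>n\<^sup>d)\<close>.\<close>

definition dpow :: "nat \<Rightarrow> 'n::finite oper" where
  "dpow d = poly_subst (\<lambda>j. X j ^ d)"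

text \<open>\<open>s\<close> is a Jacobian of \<open>P\<close> if there are homogeneous, algebraically independent
  generators \<open>f\<^sub>i = F\<^sub>i(x\<^sub>1\<^sup>d,\<dots>,x\<^sub>n\<^sup>d)\<close> of the algebra of invariants of \<open>GP_mats d P\<close> such that
  \<open>s\<close> is the determinant of their partial derivatives with respect to \<open>x\<^sub>1\<^sup>d,\<dots>,x\<^sub>n\<^sup>d\<close>.
  The choice of generators changes \<open>s\<close> only by a nonzero constant.\<close>

definition is_jacobian :: "nat \<Rightarrow> 'n::finite set set \<Rightarrow> 'n cpoly \<Rightarrow> bool" where
  "is_jacobian d P s \<longleftrightarrow> (\<exists>F :: 'n \<Rightarrow> 'n cpoly.
     (\<forall>i. homogeneous (dpow d (F i))) \<and>
     inj (poly_subst (\<lambda>i. dpow d (F i))) \<and>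
     range (poly_subst (\<lambda>i. dpow d (F i))) = poly_inv (GP_mats d P) \<and>
     s = det (\<chi> i j. dpow d (pdiff j (F i))))"

section \<open>The modules\<close>

definition N_alpha :: "nat \<Rightarrow> ('n::finite \<Rightarrow> nat) \<Rightarrow> 'n cpoly set" where
  "N_alpha d \<alpha> = {f * xpow \<alpha> | f. f \<in> poly_inv (A_mats d)}"

text \<open>In the next two definitions \<open>s\<close> is a Jacobian of \<open>P\<close>.\<close>

definition N_P :: "nat \<Rightarrow> ('n::finite \<Rightarrow> nat) \<Rightarrow> 'n set set \<Rightarrow> 'n cpoly \<Rightarrow> 'n cpoly set" where
  "N_P d \<alpha> P s = op_gen (weyl_inv (GP_mats d P)) {s * xpow \<alpha>}"

definition M_P :: "nat \<Rightarrow> ('n::finite \<Rightarrow> nat) \<Rightarrow> 'n set set \<Rightarrow> 'n cpoly \<Rightarrow> 'n cpoly set" where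
  "M_P d \<alpha> P s = J (GP_mats d P) (G_mats d) (N_P d \<alpha> P s)"

end

theory Submission imports Defs begin

text \<open>
  The idea is to replace the representation theory of \<open>G(d,1,n)\<close> by adjoints.  For the inner product
  that makes multiplication by \<open>x\<^sub>i\<close> adjoint to \<open>\<partial>\<^sub>i\<close> the groups act by unitary maps, and every ring
  of invariant differential operators is closed under adjoints (\<open>weyl_adjoint\<close>, \<open>inv_ops_adjointI\<close>).
  Let \<open>v\<close> be homogeneous, and suppose that it spans the part of its degree in a module that is
  stable under the operators invariant under a subgroup.  If \<open>D v \<noteq> 0\<close>, the component of
  \<open>D\<^sup>* D v\<close> in the degree of \<open>v\<close> is a multiple of \<open>v\<close>, and the inner product of it with \<open>v\<close> is the
  square norm of \<open>D v\<close>, so the multiple is not zero.  Hence \<open>v\<close> generates a simple module, over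
  the invariants of the subgroup as well as of any larger group (\<open>cyclic_simple\<close>).  Components are
  cut out by polynomials in the operators \<open>x\<^sub>i \<partial>\<^sub>i\<close>, which are diagonal on monomials.

  This applies to \<open>v = s\<^sub>P x\<^sup>\<alpha>\<close> in the space of semi-invariants for the character of the group
  of \<open>P\<close> that is \<open>\<alpha>\<close> on diagonal matrices and the sign on permutations, because this space consists
  of the multiples of \<open>v\<close> by invariants (\<open>Semi_structure\<close>).  The reason is the chain rule: the
  generators of the invariants express all other invariants, so their Jacobian divides the Jacobian
  of any family of invariants.  The alternants are, up to constants, Jacobians of families of power
  sums, and they span the antisymmetric polynomials (\<open>is_jacobian_properties\<close>).
  An adjoint of the multiplication by an invariant of positive degree also shows that only the
  multiples of \<open>v\<close> are killed by the invariant operators of negative degree (\<open>killed_by_negative\<close>).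

  In the semi-invariants of lowest degree the exponents in each block are \<open>\<alpha>, \<alpha> + d, \<alpha> + 2d, \<dots>\<close>,
  in some order (\<open>generator_standard\<close>), so the multiset of all exponents determines the shapes of
  the partition.  Symmetric sums of operators that detect one value of one exponent are invariant,
  therefore isomorphic modules have the same multiset of exponents in their generators
  (\<open>iso_content\<close>).  Conversely partitions of equal shapes are matched by a permutation, and it maps
  one module to the other.

  For a simple module \<open>M\<close>, Schur's lemma allows one to replace \<open>M\<close> by its image under any element of
  the group algebra that does not kill it.  Starting with the projection to one character of the
  diagonal group and antisymmetrizing over larger and larger blocks as long as possible, one arrives
  at a copy of \<open>M\<close> that consists of semi-invariants for some \<open>P\<close>, and on which further
  antisymmetrizations vanish.  An element of lowest degree in it is a highest weight vector: it is
  killed by the operators that lower one exponent by a multiple of \<open>d\<close>.  The vanishing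
  antisymmetrizations then force its exponents to be those of the generator
  (\<open>highest_weight_standard\<close>), so that it is a multiple of the generator.
\<close>

section \<open>Polynomials through their coefficients\<close>

text \<open>As the index type is finite, exponents can be handled as plain functions, and a polynomial
  as a finitely supported function on them.\<close>

definition cf :: "'n::finite cpoly \<Rightarrow> ('n \<Rightarrow> nat) \<Rightarrow> complex" where
  "cf p w = Poly_Mapping.lookup p (Abs_poly_mapping w)"

definition supp :: "'n::finite cpoly \<Rightarrow> ('n \<Rightarrow> nat) set" where
  "supp p = {w. cf p w \<noteq> 0}"

definition xmon :: "('n::finite \<Rightarrow> nat) \<Rightarrow> 'n cpoly" where
  "xmon w = Poly_Mapping.single (Abs_poly_mapping w) 1"

lemma lookup_Abs_finite [simp]:
  "Poly_Mapping.lookup (Abs_poly_mapping w) = (w :: 'n::finite \<Rightarrow> 'b::zero)"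
  by simp

lemma Abs_eq_iff: "Abs_poly_mapping w = m \<longleftrightarrow> w = Poly_Mapping.lookup (m :: 'n::finite \<Rightarrow>\<^sub>0 nat)"
  by (metis lookup_Abs_finite poly_mapping.lookup_inverse)

lemma cf_lookup [simp]: "cf p (Poly_Mapping.lookup m) = Poly_Mapping.lookup p m"
  unfolding cf_def by (metis Abs_eq_iff)

lemma cf_eqI: "(\<And>w. cf p w = cf q w) \<Longrightarrow> p = q"
  by (metis cf_lookup poly_mapping_eqI)

lemma supp_eq_image: "supp p = Poly_Mapping.lookup ` Poly_Mapping.keys p"
proof (intro set_eqI iffI)
  fix w assume "w \<in> supp p"
  then have "Abs_poly_mapping w \<in> Poly_Mapping.keys p"
    by (simp add: supp_def cf_def in_keys_iff)
  then show "w \<in> Poly_Mapping.lookup ` Poly_Mapping.keys p"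
    by (metis image_eqI lookup_Abs_finite)
qed (auto simp: supp_def in_keys_iff)

lemma finite_supp [simp]: "finite (supp p)"
  by (simp add: supp_eq_image)

lemma supp_iff: "w \<in> supp p \<longleftrightarrow> cf p w \<noteq> 0"
  by (simp add: supp_def)

lemma supp_eq_empty [simp]: "supp p = {} \<longleftrightarrow> p = 0"
  by (simp add: supp_eq_image)

lemma exists_supp: "p \<noteq> 0 \<Longrightarrow> \<exists>w. w \<in> supp p"
  using supp_eq_empty by blast

lemma cf_add [simp]: "cf (p + q) w = cf p w + cf q w"
  by (simp add: cf_def lookup_add)

lemma cf_minus [simp]: "cf (p - q) w = cf p w - cf q w"
  by (simp add: cf_def lookup_minus)

lemma cf_uminus [simp]: "cf (- p) w = - cf p w"
  by (simp add: cf_def)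

lemma cf_zero [simp]: "cf 0 w = 0"
  by (simp add: cf_def)

lemma cf_sum [simp]: "cf (sum f S) w = (\<Sum>x\<in>S. cf (f x) w)"
  by (induct S rule: infinite_finite_induct) auto

lemma cf_single: "cf (Poly_Mapping.single m c) w = (if Poly_Mapping.lookup m = w then c else 0)"
  by (auto simp: cf_def lookup_single when_def Abs_eq_iff)

lemma cf_xmon: "cf (xmon u) w = (if u = w then 1 else 0)"
  by (simp add: xmon_def cf_single)

lemma supp_xmon [simp]: "supp (xmon u) = {u}"
  by (auto simp: supp_iff cf_xmon split: if_splits)

lemma xmon_nonzero [simp]: "xmon u \<noteq> 0"
  by (metis cf_xmon cf_zero zero_neq_one)

lemma cf_Cst: "cf (Cst c) w = (if w = (\<lambda>_. 0) then c else 0)"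
  by (auto simp: Cst_def cf_single)

lemma cf_Cst_mult [simp]: "cf (Cst c * p) w = c * cf p w"
  by (simp add: Cst_def cf_def flip: mult_map_scale_conv_mult)
     (simp add: Poly_Mapping.map.rep_eq when_def)

lemma Cst_add: "Cst (a + b) = Cst a + Cst b"
  by (simp add: Cst_def single_add)

lemma Cst_mult: "Cst (a * b) = Cst a * Cst b"
  by (simp add: Cst_def mult_single)

lemma Cst_1 [simp]: "Cst 1 = 1"
  by (simp add: Cst_def)

lemma Cst_0 [simp]: "Cst 0 = 0"
  by (simp add: Cst_def)

lemma Cst_prod: "Cst (prod f S) = (\<Prod>i\<in>S. Cst (f i))"
  by (induct S rule: infinite_finite_induct) (auto simp: Cst_mult)

lemma Cst_power: "Cst (a ^ k) = Cst a ^ k"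
  by (induct k) (auto simp: Cst_mult)

lemma Cst_of_int: "Cst (of_int z) = of_int z"
  by (simp add: Cst_def)

lemma Cst_inverse_cancel: "c \<noteq> 0 \<Longrightarrow> Cst (1 / c) * (Cst c * p) = p"
  by (simp add: mult.assoc [symmetric] Cst_mult [symmetric])

lemma xmon_mult: "xmon u * xmon w = xmon (\<lambda>i. u i + w i)"
proof -
  have "Abs_poly_mapping u + Abs_poly_mapping w = Abs_poly_mapping (\<lambda>i. u i + w i)"
    by (rule poly_mapping_eqI) (simp add: lookup_add)
  then show ?thesis by (simp add: xmon_def mult_single)
qed

lemma xmon_0: "xmon (\<lambda>_. 0) = 1"
  by (simp add: xmon_def)

lemma xmon_X: "X i = xmon (\<lambda>j. if j = i then 1 else 0)"
  unfolding X_def xmon_def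
  by (rule arg_cong [where f = "\<lambda>m. Poly_Mapping.single m 1"], rule poly_mapping_eqI)
     (auto simp: lookup_single when_def)

lemma xmon_X_power: "X i ^ k = xmon (\<lambda>j. if j = i then k else 0)"
  by (induct k) (auto simp: xmon_0 xmon_X xmon_mult intro!: arg_cong [where f = xmon])

lemma xpow_eq_xmon: "xpow \<alpha> = xmon \<alpha>"
proof -
  have "(\<Prod>i\<in>S. X i ^ \<alpha> i) = xmon (\<lambda>j. if j \<in> S then \<alpha> j else 0)" if "finite S" for S
    using that
  proof (induct S rule: finite_induct)
    case (insert x S)
    then show ?case
      by (auto simp: xmon_X_power xmon_mult intro!: arg_cong [where f = xmon])
  qed (simp add: xmon_0)
  from this [of UNIV] show ?thesis by (simp add: xpow_def)
qed

lemma poly_expand: "p = (\<Sum>w\<in>supp p. Cst (cf p w) * xmon w)"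
proof (rule cf_eqI)
  fix w
  have "(\<Sum>u\<in>supp p. cf p u * (if u = w then 1 else 0)) = (\<Sum>u\<in>supp p. if u = w then cf p u else 0)"
    by (rule sum.cong) auto
  also have "\<dots> = cf p w" by (simp add: supp_iff)
  finally have "(\<Sum>u\<in>supp p. cf p u * (if u = w then 1 else 0)) = cf p w" .
  then show "cf p w = cf (\<Sum>w\<in>supp p. Cst (cf p w) * xmon w) w"
    by (simp add: cf_xmon)
qed

lemma poly_linear_induct [case_names add scale monom]:
  fixes p :: "'n::finite cpoly"
  assumes "\<And>p q. P p \<Longrightarrow> P q \<Longrightarrow> P (p + q)"
    and "\<And>c p. P p \<Longrightarrow> P (Cst c * p)" and "\<And>w. P (xmon w)"
  shows "P p"
proof -
  have "P 0" using assms(2) [of "xmon undefined" 0] assms(3) by simp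
  then have "P (\<Sum>w\<in>S. Cst (c w) * xmon w)" for S c
    by (induct S rule: infinite_finite_induct) (auto intro: assms)
  then show ?thesis by (metis poly_expand)
qed

lemma poly_ring_induct [case_names const var add mult]:
  fixes p :: "'n::finite cpoly"
  assumes "\<And>c. P (Cst c)" and "\<And>i. P (X i)"
    and "\<And>p q. P p \<Longrightarrow> P q \<Longrightarrow> P (p + q)" and "\<And>p q. P p \<Longrightarrow> P q \<Longrightarrow> P (p * q)"
  shows "P p"
proof (induct p rule: poly_linear_induct)
  case (monom w)
  have 1: "P 1" using assms(1) [of 1] by simp
  then have pow: "P (X i ^ k)" for i k by (induct k) (auto intro: assms)
  have "P (\<Prod>i\<in>S. X i ^ w i)" for S
    using 1 pow by (induct S rule: infinite_finite_induct) (auto intro: assms)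
  then show ?case by (metis xpow_eq_xmon xpow_def)
qed (auto intro: assms)

lemma cf_xmon_mult:
  "cf (xmon u * p) w = (if \<forall>i. u i \<le> w i then cf p (\<lambda>i. w i - u i) else 0)"
proof (induct p rule: poly_linear_induct)
  case (scale c p)
  have "xmon u * (Cst c * p) = Cst c * (xmon u * p)" by (rule mult.left_commute)
  with scale show ?case by (metis cf_Cst_mult mult_zero_right)
next
  case (monom v)
  have "(\<lambda>i. u i + v i) = w \<longleftrightarrow> (\<forall>i. u i \<le> w i) \<and> v = (\<lambda>i. w i - u i)"
  proof
    assume "(\<forall>i. u i \<le> w i) \<and> v = (\<lambda>i. w i - u i)"
    then show "(\<lambda>i. u i + v i) = w" by simp
  qed auto
  then show ?case by (simp add: xmon_mult cf_xmon)
qed (simp add: ring_distribs)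

lemma xmon_mult_cancel: "xmon u * p = xmon u * q \<Longrightarrow> p = q"
proof (rule cf_eqI)
  fix w assume "xmon u * p = xmon u * q"
  then have "cf (xmon u * p) (\<lambda>i. u i + w i) = cf (xmon u * q) (\<lambda>i. u i + w i)" by simp
  then show "cf p w = cf q w" by (simp add: cf_xmon_mult)
qed

lemma cf_X_mult: "cf (X i * p) w = (if w i = 0 then 0 else cf p (w(i := w i - 1)))"
proof -
  have "(\<lambda>j. w j - (if j = i then 1 else 0)) = w(i := w i - 1)" by auto
  then show ?thesis
    by (auto simp: xmon_X cf_xmon_mult not_le)
qed

lemma supp_mult: "w \<in> supp (p * q) \<Longrightarrow> \<exists>u\<in>supp p. \<exists>v\<in>supp q. w = (\<lambda>i. u i + v i)"
proof -
  assume "w \<in> supp (p * q)"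
  then obtain m where m: "m \<in> Poly_Mapping.keys (p * q)" "w = Poly_Mapping.lookup m"
    by (auto simp: supp_eq_image)
  then obtain a b where ab: "a \<in> Poly_Mapping.keys p" "b \<in> Poly_Mapping.keys q" "m = a + b"
    using keys_mult [of p q] by blast
  then show ?thesis using m
    by (auto simp: supp_eq_image lookup_add fun_eq_iff)
qed

section \<open>Partial derivatives\<close>

lemma cf_pdiff: "cf (pdiff i p) w = of_nat (w i + 1) * cf p (w(i := w i + 1))"
proof -
  define v where "v = Abs_poly_mapping (w(i := w i + 1))"
  have v: "Poly_Mapping.lookup v = w(i := w i + 1)" by (simp add: v_def)
  let ?t = "\<lambda>m. if Poly_Mapping.lookup (m - Poly_Mapping.single i 1) = w
      then of_nat (Poly_Mapping.lookup m i) * Poly_Mapping.lookup p m else (0::complex)"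
  have t: "?t m = (if m = v then of_nat (w i + 1) * Poly_Mapping.lookup p v else 0)" for m
  proof (cases "m = v")
    case True
    have "Poly_Mapping.lookup (v - Poly_Mapping.single i 1) = w"
      by (auto simp: lookup_minus v lookup_single when_def fun_eq_iff)
    with True show ?thesis by (simp add: v)
  next
    case False
    have "Poly_Mapping.lookup m i = 0" if "Poly_Mapping.lookup (m - Poly_Mapping.single i 1) = w"
    proof (rule ccontr)
      assume nz: "Poly_Mapping.lookup m i \<noteq> 0"
      have "Poly_Mapping.lookup m j = Poly_Mapping.lookup v j" for j
        using fun_cong [OF that, of j] nz by (auto simp: v lookup_minus lookup_single when_def)
      then have "m = v" by (rule poly_mapping_eqI)
      with False show False ..
    qed
    then show ?thesis using False by simp
  qed
  have "cf (pdiff i p) w = (\<Sum>m\<in>Poly_Mapping.keys p. ?t m)"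
    by (simp add: pdiff_def cf_single)
  also have "\<dots> = (\<Sum>m\<in>Poly_Mapping.keys p. if m = v then of_nat (w i + 1) * Poly_Mapping.lookup p v else 0)"
    by (rule sum.cong [OF refl t])
  also have "\<dots> = of_nat (w i + 1) * Poly_Mapping.lookup p v"
    by (simp add: in_keys_iff)
  also have "\<dots> = of_nat (w i + 1) * cf p (w(i := w i + 1))"
    by (simp add: cf_def v_def)
  finally show ?thesis .
qed

lemma pdiff_add: "pdiff i (p + q :: 'n::finite cpoly) = pdiff i p + pdiff i q"
  by (rule cf_eqI) (simp add: cf_pdiff algebra_simps)

lemma pdiff_scale: "pdiff i (Cst c * p :: 'n::finite cpoly) = Cst c * pdiff i p"
  by (rule cf_eqI) (simp add: cf_pdiff mult.left_commute)

lemma pdiff_Cst [simp]: "pdiff i (Cst c) = (0 :: 'n::finite cpoly)"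
  by (rule cf_eqI) (auto simp: cf_pdiff cf_Cst fun_eq_iff)

lemma pdiff_sum: "pdiff i (sum f S) = (\<Sum>x\<in>S. pdiff i (f x) :: 'n::finite cpoly)"
proof (induct S rule: infinite_finite_induct)
  case empty
  show ?case by (rule cf_eqI) (simp add: cf_pdiff)
next
  case (infinite A)
  show ?case by (rule cf_eqI) (use infinite in \<open>simp add: cf_pdiff\<close>)
qed (simp add: pdiff_add)

lemma pdiff_X_mult: "pdiff j (X i * p :: 'n::finite cpoly) = (if i = j then p else 0) + X i * pdiff j p"
proof (rule cf_eqI)
  fix w
  show "cf (pdiff j (X i * p)) w = cf ((if i = j then p else 0) + X i * pdiff j p) w"
  proof (cases "i = j")
    case True
    then show ?thesis by (auto simp: cf_pdiff cf_X_mult distrib_right)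
  next
    case False
    then show ?thesis by (auto simp: cf_pdiff cf_X_mult fun_upd_twist)
  qed
qed

lemma pdiff_X: "pdiff j (X i :: 'n::finite cpoly) = (if i = j then 1 else 0)"
  using pdiff_X_mult [of j i 1] pdiff_Cst [of j 1] by simp

lemma pdiff_mult: "pdiff j (p * q :: 'n::finite cpoly) = pdiff j p * q + p * pdiff j q"
proof (induct p arbitrary: q rule: poly_ring_induct)
  case (var i)
  show ?case by (simp add: pdiff_X_mult pdiff_X)
next
  case (mult p r)
  show ?case
    using mult(1) [of "r * q"] mult(2) [of q] mult(1) [of r] by (simp add: algebra_simps)
qed (simp_all add: pdiff_scale pdiff_add distrib_right distrib_left add.assoc add.left_commute)

section \<open>Substitution\<close>

lemma poly_subst_supp:
  "poly_subst f p = (\<Sum>w\<in>supp p. Cst (cf p w) * (\<Prod>i\<in>UNIV. f i ^ w i))"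
  unfolding poly_subst_def supp_eq_image
  by (subst sum.reindex) (auto simp: inj_on_def)

lemma poly_subst_superset:
  assumes "finite S" "supp p \<subseteq> S"
  shows "poly_subst f p = (\<Sum>w\<in>S. Cst (cf p w) * (\<Prod>i\<in>UNIV. f i ^ w i))"
  unfolding poly_subst_supp
  by (rule sum.mono_neutral_left) (use assms in \<open>auto simp: supp_iff\<close>)

lemma poly_subst_add: "poly_subst f (p + q) = poly_subst f p + poly_subst f q"
proof -
  have "supp (p + q) \<subseteq> supp p \<union> supp q" by (auto simp: supp_iff)
  then show ?thesis
    by (simp add: poly_subst_superset [of "supp p \<union> supp q"] Cst_add ring_distribs sum.distrib)
qed

lemma poly_subst_scale: "poly_subst f (Cst c * p) = Cst c * poly_subst f p"
proof -
  have "supp (Cst c * p) \<subseteq> supp p" by (auto simp: supp_iff)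
  then show ?thesis
    by (simp add: poly_subst_superset [of "supp p"] Cst_mult mult.assoc sum_distrib_left)
qed

lemma poly_subst_xmon: "poly_subst f (xmon w) = (\<Prod>i\<in>UNIV. f i ^ w i)"
proof -
  have "supp (xmon w) \<subseteq> {w}" by (auto simp: supp_iff cf_xmon split: if_splits)
  then show ?thesis by (simp add: poly_subst_superset [of "{w}"] cf_xmon)
qed

lemma poly_subst_mult: "poly_subst f (p * q) = poly_subst f p * poly_subst f q"
proof (induct p rule: poly_linear_induct)
  case (monom u)
  show ?case
  proof (induct q rule: poly_linear_induct)
    case (scale c p)
    have "xmon u * (Cst c * p) = Cst c * (xmon u * p)" by (rule mult.left_commute)
    with scale show ?case by (metis poly_subst_scale mult.left_commute)
  qed (simp_all add: xmon_mult poly_subst_xmon power_add prod.distrib ring_distribs poly_subst_add)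
qed (simp_all add: ring_distribs poly_subst_add poly_subst_scale mult.assoc)

lemma poly_subst_Cst [simp]: "poly_subst f (Cst c) = Cst c"
  using poly_subst_scale [of f c 1] poly_subst_xmon [of f "\<lambda>_. 0"] by (simp add: xmon_0)

lemma poly_subst_0 [simp]: "poly_subst f 0 = 0"
  using poly_subst_Cst [of f 0] by simp

lemma poly_subst_1 [simp]: "poly_subst f 1 = 1"
  using poly_subst_Cst [of f 1] by simp

lemma poly_subst_X [simp]: "poly_subst f (X i) = f i"
proof -
  have "(\<Prod>j\<in>UNIV. f j ^ (if j = i then 1 else 0)) = (\<Prod>j\<in>UNIV. if j = i then f j else 1)"
    by (rule prod.cong) auto
  then show ?thesis by (simp add: xmon_X poly_subst_xmon)
qed

lemma poly_subst_uminus: "poly_subst f (- p) = - poly_subst f p"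
  using poly_subst_add [of f "- p" p] by (simp add: eq_neg_iff_add_eq_0)

lemma poly_subst_sum: "poly_subst f (sum g S) = (\<Sum>x\<in>S. poly_subst f (g x))"
  by (induct S rule: infinite_finite_induct) (auto simp: poly_subst_add)

lemma poly_subst_prod: "poly_subst f (prod g S) = (\<Prod>x\<in>S. poly_subst f (g x))"
  by (induct S rule: infinite_finite_induct) (auto simp: poly_subst_mult)

lemma poly_subst_power: "poly_subst f (p ^ k) = poly_subst f p ^ k"
  by (induct k) (auto simp: poly_subst_mult)

lemma poly_subst_poly_subst: "poly_subst f (poly_subst g p) = poly_subst (\<lambda>i. poly_subst f (g i)) p"
  by (induct p rule: poly_ring_induct) (simp_all add: poly_subst_add poly_subst_mult)

lemma poly_subst_var [simp]: "poly_subst X p = p"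
  by (induct p rule: poly_ring_induct) (simp_all add: poly_subst_add poly_subst_mult)

lemma poly_subst_det:
  fixes M :: "'m::finite \<Rightarrow> 'm \<Rightarrow> 'n::finite cpoly"
  shows "poly_subst f (det (\<chi> i j. M i j)) = det (\<chi> i j. poly_subst f (M i j))"
proof -
  have int: "poly_subst f (of_int z) = of_int z" for z
    by (metis Cst_of_int poly_subst_Cst)
  show ?thesis
    by (simp add: det_def poly_subst_sum poly_subst_mult poly_subst_prod int)
qed

text \<open>Both sides of the chain rule are derivations along the substitution, so it is enough to
  compare them on constants and variables.\<close>

lemma pdiff_poly_subst:
  "pdiff j (poly_subst F H) = (\<Sum>i\<in>UNIV. poly_subst F (pdiff i H) * pdiff j (F i))"
proof (induct H rule: poly_ring_induct)
  case (var k)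
  show ?case by (simp add: pdiff_X if_distrib [of "poly_subst F"] if_distrib [of "\<lambda>x. x * _"] cong: if_cong)
next
  case (mult p q)
  then show ?case
    by (simp add: poly_subst_mult poly_subst_add pdiff_mult sum.distrib sum_distrib_left
        sum_distrib_right algebra_simps)
qed (simp_all add: poly_subst_add pdiff_add sum.distrib algebra_simps)

section \<open>Diagonal matrices and permutations acting on polynomials\<close>

definition diag_act :: "('n::finite \<Rightarrow> complex) \<Rightarrow> 'n oper" where
  "diag_act a = poly_subst (\<lambda>i. Cst (a i) * X i)"

definition perm_act :: "('n::finite \<Rightarrow> 'n) \<Rightarrow> 'n oper" where
  "perm_act \<sigma> = poly_subst (\<lambda>i. X (\<sigma> i))"

lemma diag_act_xmon: "diag_act a (xmon w) = Cst (\<Prod>i\<in>UNIV. a i ^ w i) * xmon w"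
  unfolding diag_act_def poly_subst_xmon
  by (simp add: power_mult_distrib prod.distrib Cst_prod Cst_power xpow_def flip: xpow_eq_xmon)

lemma cf_diag_act: "cf (diag_act a p) w = (\<Prod>i\<in>UNIV. a i ^ w i) * cf p w"
proof (induct p rule: poly_linear_induct)
  case (monom u)
  then show ?case by (simp add: diag_act_xmon cf_xmon)
qed (simp_all add: diag_act_def poly_subst_add poly_subst_scale distrib_left mult.left_commute)

lemma perm_act_xmon:
  assumes "bij \<sigma>"
  shows "perm_act \<sigma> (xmon w) = xmon (w \<circ> inv \<sigma>)"
proof -
  have "perm_act \<sigma> (xmon w) = (\<Prod>i\<in>UNIV. X (\<sigma> i) ^ w i)"
    by (simp add: perm_act_def poly_subst_xmon)
  also have "\<dots> = (\<Prod>i\<in>UNIV. X (\<sigma> i) ^ (w \<circ> inv \<sigma>) (\<sigma> i))"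
    using assms by (simp add: bij_is_inj)
  also have "\<dots> = (\<Prod>j\<in>UNIV. X j ^ (w \<circ> inv \<sigma>) j)"
    by (rule prod.reindex_bij_betw [OF assms])
  finally show ?thesis by (simp add: xpow_def flip: xpow_eq_xmon)
qed

lemma cf_perm_act:
  assumes "bij \<sigma>"
  shows "cf (perm_act \<sigma> p) w = cf p (w \<circ> \<sigma>)"
proof (induct p rule: poly_linear_induct)
  case (monom u)
  have "u \<circ> inv \<sigma> = w \<longleftrightarrow> u = w \<circ> \<sigma>"
    using assms by (metis bij_is_inj bij_is_surj comp_assoc comp_id inv_o_cancel surj_iff)
  then show ?case unfolding perm_act_xmon [OF assms] cf_xmon by (rule arg_cong)
qed (simp_all add: perm_act_def poly_subst_add poly_subst_scale)

lemma diag_act_add: "diag_act a (p + q) = diag_act a p + diag_act a q"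
  and diag_act_mult: "diag_act a (p * q) = diag_act a p * diag_act a q"
  and diag_act_Cst [simp]: "diag_act a (Cst c) = Cst c"
  and diag_act_0 [simp]: "diag_act a 0 = 0"
  by (simp_all add: diag_act_def poly_subst_add poly_subst_mult)

lemma perm_act_add: "perm_act \<sigma> (p + q) = perm_act \<sigma> p + perm_act \<sigma> q"
  and perm_act_mult: "perm_act \<sigma> (p * q) = perm_act \<sigma> p * perm_act \<sigma> q"
  and perm_act_Cst [simp]: "perm_act \<sigma> (Cst c) = Cst c"
  and perm_act_uminus: "perm_act \<sigma> (- p) = - perm_act \<sigma> p"
  and perm_act_0 [simp]: "perm_act \<sigma> 0 = 0"
  and perm_act_sum: "perm_act \<sigma> (sum g S) = (\<Sum>x\<in>S. perm_act \<sigma> (g x))"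
  by (simp_all add: perm_act_def poly_subst_add poly_subst_mult poly_subst_uminus poly_subst_sum)

lemma perm_act_comp: "perm_act \<sigma> (perm_act \<tau> p) = perm_act (\<sigma> \<circ> \<tau>) p"
  by (simp add: perm_act_def poly_subst_poly_subst)

lemma perm_act_id [simp]: "perm_act id p = p"
  by (simp add: perm_act_def)

lemma diag_act_1 [simp]: "diag_act (\<lambda>_. 1) p = p"
  by (simp add: diag_act_def)

lemma dpow_xmon: "dpow d (xmon u) = xmon (\<lambda>i. d * u i)"
  unfolding dpow_def poly_subst_xmon power_mult [symmetric]
  by (simp add: xpow_def flip: xpow_eq_xmon)

lemma cf_dpow:
  assumes "d \<ge> 1"
  shows "cf (dpow d p) w = (if \<forall>i. d dvd w i then cf p (\<lambda>i. w i div d) else 0)"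
proof (induct p rule: poly_linear_induct)
  case (monom u)
  have "(\<lambda>i. d * u i) = w \<longleftrightarrow> (\<forall>i. d dvd w i) \<and> u = (\<lambda>i. w i div d)"
  proof
    assume "(\<lambda>i. d * u i) = w"
    then have "w i = d * u i" for i by auto
    then show "(\<forall>i. d dvd w i) \<and> u = (\<lambda>i. w i div d)" using assms by auto
  qed auto
  then show ?case by (auto simp: dpow_xmon cf_xmon)
qed (simp_all add: dpow_def poly_subst_add poly_subst_scale)

lemma dpow_inj:
  assumes "d \<ge> 1" "dpow d p = dpow d q"
  shows "p = q"
proof (rule cf_eqI)
  fix w
  have "cf (dpow d p) (\<lambda>i. d * w i) = cf (dpow d q) (\<lambda>i. d * w i)" using assms by simp
  then show "cf p w = cf q w" using assms(1) by (simp add: cf_dpow)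
qed

lemma dpow_mult: "dpow d (p * q) = dpow d p * dpow d q"
  and dpow_poly_subst: "dpow d (poly_subst f p) = poly_subst (\<lambda>i. dpow d (f i)) p"
  and dpow_det: "dpow d (det (\<chi> i j. M i j)) = det (\<chi> i j. dpow d (M i j))"
  and dpow_scale: "dpow d (Cst c * p) = Cst c * dpow d p"
  unfolding dpow_def
  by (rule poly_subst_mult poly_subst_poly_subst poly_subst_det poly_subst_scale)+

lemma perm_act_dpow: "perm_act \<sigma> (dpow d p) = dpow d (perm_act \<sigma> p)"
  by (simp add: dpow_def perm_act_def poly_subst_poly_subst poly_subst_power)

lemma perm_act_pdiff:
  assumes "bij \<sigma>"
  shows "perm_act \<sigma> (pdiff j p) = pdiff (\<sigma> j) (perm_act \<sigma> p)"
proof (rule cf_eqI)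
  fix w
  have "(w \<circ> \<sigma>)(j := Suc (w (\<sigma> j))) = w(\<sigma> j := Suc (w (\<sigma> j))) \<circ> \<sigma>"
    using assms by (auto simp: fun_eq_iff bij_def inj_eq)
  then show "cf (perm_act \<sigma> (pdiff j p)) w = cf (pdiff (\<sigma> j) (perm_act \<sigma> p)) w"
    by (simp add: cf_perm_act [OF assms] cf_pdiff)
qed

section \<open>Operators of the Weyl algebra\<close>

definition wt :: "('n::finite \<Rightarrow> nat) \<Rightarrow> nat" where
  "wt w = (\<Sum>i\<in>UNIV. w i)"

lemma wt_upd: "wt (w(i := k)) + w i = wt w + k"
proof -
  have "wt (w(i := k)) = k + (\<Sum>j\<in>UNIV - {i}. w j)"
    unfolding wt_def by (subst sum.remove [of _ i]) auto
  moreover have "wt w = w i + (\<Sum>j\<in>UNIV - {i}. w j)"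
    unfolding wt_def by (rule sum.remove) auto
  ultimately show ?thesis by simp
qed

lemma wt_comp:
  assumes "bij \<sigma>"
  shows "wt (w \<circ> \<sigma>) = wt w"
  unfolding wt_def comp_def by (rule sum.reindex_bij_betw [OF assms])

lemma weyl_linear:
  assumes "D \<in> (weyl :: 'n::finite oper set)"
  shows "D (p + q) = D p + D q" and "D (Cst c * p) = Cst c * D p"
proof -
  have "(\<forall>p q. D (p + q) = D p + D q) \<and> (\<forall>c p. D (Cst c * p) = Cst c * D p)"
    using assms
    by induct (auto simp: pdiff_add pdiff_scale distrib_left mult.left_commute add.assoc
        add.left_commute)
  then show "D (p + q) = D p + D q" "D (Cst c * p) = Cst c * D p" by auto
qed

lemma weyl_0: "D \<in> weyl \<Longrightarrow> D 0 = (0 :: 'n::finite cpoly)"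
  using weyl_linear(2) [of D 0 0] by simp

lemma weyl_minus: "D \<in> weyl \<Longrightarrow> D (p - q) = D p - (D q :: 'n::finite cpoly)"
  using weyl_linear(1) [of D "p - q" q] by simp

lemma weyl_sum: "D \<in> weyl \<Longrightarrow> D (sum f S) = (\<Sum>x\<in>S. D (f x) :: 'n::finite cpoly)"
  by (induct S rule: infinite_finite_induct) (auto simp: weyl_0 weyl_linear)

lemma weyl_mult_op: "(\<lambda>q. p * q) \<in> (weyl :: 'n::finite oper set)"
proof (induct p rule: poly_ring_induct)
  case (add p r)
  then show ?case using weyl.add by (simp add: distrib_right)
next
  case (mult p r)
  have "(\<lambda>q. p * r * q) = (\<lambda>q. p * q) \<circ> (\<lambda>q. r * q)" by (auto simp: mult.assoc)
  then show ?case using weyl.comp [OF mult] by (simp only:)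
qed (rule weyl.const weyl.mult)+

lemma weyl_sum_op:
  assumes "finite S" "\<And>x. x \<in> S \<Longrightarrow> E x \<in> (weyl :: 'n::finite oper set)"
  shows "(\<lambda>p. \<Sum>x\<in>S. E x p) \<in> weyl"
  using assms
proof (induct S rule: finite_induct)
  case empty
  have "(\<lambda>p. 0) = (\<lambda>p :: 'n cpoly. Cst 0 * p)" by simp
  then show ?case using weyl.const [of 0] by (simp only: sum.empty)
next
  case (insert x S)
  then show ?case using weyl.add [of "E x" "\<lambda>p. \<Sum>x\<in>S. E x p"] by simp
qed

lemma weyl_pow_op: "D \<in> weyl \<Longrightarrow> D ^^ k \<in> (weyl :: 'n::finite oper set)"
proof (induct k)
  case 0
  have "D ^^ 0 = (\<lambda>p. Cst 1 * p)" by (simp add: fun_eq_iff)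
  then show ?case using weyl.const [of 1] by (simp only:)
next
  case (Suc k)
  then show ?case using weyl.comp [of D "D ^^ k"] by (simp only: funpow.simps)
qed

lemma weyl_hom_weyl: "weyl_hom k D \<Longrightarrow> D \<in> weyl"
  by (induct rule: weyl_hom.induct) (blast intro: weyl.intros)+

lemma weyl_hom_wt:
  assumes "weyl_hom k D" "w \<in> supp (D p)"
  shows "\<exists>u\<in>supp p. int (wt w) = int (wt u) + k"
  using assms
proof (induct arbitrary: p w rule: weyl_hom.induct)
  case (mult i)
  then have nz: "w i \<noteq> 0" "cf p (w(i := w i - 1)) \<noteq> 0"
    by (auto simp: supp_iff cf_X_mult split: if_splits)
  have "int (wt w) = int (wt (w(i := w i - 1))) + 1" using wt_upd [of w i "w i - 1"] nz by linarith
  with nz show ?case by (auto simp: supp_iff)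
next
  case (pdiff i)
  then have nz: "cf p (w(i := w i + 1)) \<noteq> 0" by (auto simp: supp_iff cf_pdiff)
  have "int (wt w) = int (wt (w(i := w i + 1))) + (-1)" using wt_upd [of w i "w i + 1"] by linarith
  with nz show ?case unfolding supp_iff [symmetric] by blast
next
  case (add k D E)
  then have "w \<in> supp (D p) \<or> w \<in> supp (E p)" by (auto simp: supp_iff)
  with add show ?case by blast
next
  case (comp k D l E)
  from comp.prems have "w \<in> supp (D (E p))" by simp
  then obtain u where u: "u \<in> supp (E p)" "int (wt w) = int (wt u) + k"
    using comp(2) by blast
  then obtain v where "v \<in> supp p" "int (wt u) = int (wt v) + l"
    using comp(4) by blast
  with u show ?case by (intro bexI [of _ v]) auto
qed (auto simp: supp_iff)

text \<open>The zero operator counts as homogeneous; this is the case of an empty sum below.\<close>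

lemma weyl_hom_zero: "weyl_hom (int k) (\<lambda>p. 0 :: 'n::finite cpoly)"
proof (induct k)
  case 0
  have "(\<lambda>p. 0) = (\<lambda>p :: 'n cpoly. Cst 0 * p)" by simp
  then show ?case using weyl_hom.const [of 0] by (simp only: of_nat_0)
next
  case (Suc k)
  have "weyl_hom (1 + int k) ((\<lambda>p :: 'n cpoly. X undefined * p) \<circ> (\<lambda>p. 0))"
    by (rule weyl_hom.comp [OF weyl_hom.mult Suc])
  then show ?case by (simp add: o_def)
qed

lemma weyl_hom_sum_op:
  assumes "finite S" "\<And>x. x \<in> S \<Longrightarrow> weyl_hom (int k) (E x :: 'n::finite oper)"
  shows "weyl_hom (int k) (\<lambda>p. \<Sum>x\<in>S. E x p)"
  using assms
proof (induct S rule: finite_induct)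
  case (insert x S)
  then show ?case using weyl_hom.add [of "int k" "E x" "\<lambda>p. \<Sum>x\<in>S. E x p"] by simp
qed (simp add: weyl_hom_zero)

lemma weyl_hom_pow: "weyl_hom k D \<Longrightarrow> weyl_hom (int n * k) (D ^^ n :: 'n::finite oper)"
proof (induct n)
  case 0
  have "D ^^ 0 = (\<lambda>p. Cst 1 * p)" by (simp add: fun_eq_iff)
  then show ?case using weyl_hom.const [of 1] by (simp only: of_nat_0 mult_zero_left)
next
  case (Suc n)
  have "int (Suc n) * k = k + int n * k" by (simp add: distrib_right)
  with Suc show ?case
    using weyl_hom.comp [of k D "int n * k" "D ^^ n"] by (simp only: funpow.simps)
qed

lemma weyl_hom_xmon: "weyl_hom (int (wt u)) (\<lambda>p. xmon u * p :: 'n::finite cpoly)"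
proof -
  have pow: "(\<lambda>q. X i * q) ^^ k = (\<lambda>q. X i ^ k * q)" for k i
    by (induct k) (auto simp: id_def o_def mult.assoc)
  have "weyl_hom (int (\<Sum>i\<in>S. u i)) (\<lambda>p. (\<Prod>i\<in>S. X i ^ u i) * p)" if "finite S" for S
    using that
  proof (induct S rule: finite_induct)
    case empty
    show ?case using weyl_hom.const [of 1] by simp
  next
    case (insert i S)
    have "weyl_hom (int (u i) * 1) (\<lambda>q. X i ^ u i * q)"
      using weyl_hom_pow [OF weyl_hom.mult] by (simp only: pow)
    from weyl_hom.comp [OF this insert(3)] insert(1,2) show ?case
      by (simp add: o_def mult.assoc)
  qed
  from this [of UNIV] show ?thesis by (simp add: wt_def xpow_def flip: xpow_eq_xmon)
qed

lemma weyl_hom_mult_op: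
  assumes "\<And>w. w \<in> supp f \<Longrightarrow> wt w = k"
  shows "weyl_hom (int k) (\<lambda>p. f * p :: 'n::finite cpoly)"
proof -
  have "weyl_hom (int k) (\<lambda>p. Cst (cf f w) * (xmon w * p))" if "w \<in> supp f" for w
    using weyl_hom.comp [OF weyl_hom.const weyl_hom_xmon [of w], of "cf f w"] assms [OF that]
    by (simp add: o_def)
  then have "weyl_hom (int k) (\<lambda>p. \<Sum>w\<in>supp f. Cst (cf f w) * (xmon w * p))"
    by (intro weyl_hom_sum_op) auto
  moreover have "(\<lambda>p. \<Sum>w\<in>supp f. Cst (cf f w) * (xmon w * p)) = (\<lambda>p. f * p)"
  proof
    fix p
    show "(\<Sum>w\<in>supp f. Cst (cf f w) * (xmon w * p)) = f * p"
      by (subst (2) poly_expand [of f]) (simp only: sum_distrib_right mult.assoc)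
  qed
  ultimately show ?thesis by simp
qed

section \<open>Operators that are diagonal on monomials\<close>

definition diag :: "(('n::finite \<Rightarrow> nat) \<Rightarrow> complex) \<Rightarrow> 'n oper" where
  "diag q p = (\<Sum>w\<in>supp p. Cst (q w * cf p w) * xmon w)"

lemma cf_diag [simp]: "cf (diag q p) w = q w * cf p w"
proof -
  have "cf (diag q p) w = (\<Sum>u\<in>supp p. if u = w then q u * cf p u else 0)"
    unfolding diag_def cf_sum cf_Cst_mult cf_xmon by (rule sum.cong) auto
  then show ?thesis by (simp add: supp_iff)
qed

text \<open>The operators \<open>X i * pdiff i\<close> act on monomials by the exponents, so the polynomials in them
  are the \<open>diag q\<close> with \<open>q\<close> a polynomial function of the exponents.\<close>

inductive_set polyfun :: "(('n::finite \<Rightarrow> nat) \<Rightarrow> complex) set" where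
  const: "(\<lambda>_. c) \<in> polyfun"
| coord: "(\<lambda>w. of_nat (w i)) \<in> polyfun"
| add: "q \<in> polyfun \<Longrightarrow> r \<in> polyfun \<Longrightarrow> (\<lambda>w. q w + r w) \<in> polyfun"
| mult: "q \<in> polyfun \<Longrightarrow> r \<in> polyfun \<Longrightarrow> (\<lambda>w. q w * r w) \<in> polyfun"

lemma diag_weyl: "q \<in> polyfun \<Longrightarrow> diag q \<in> weyl"
proof (induct rule: polyfun.induct)
  case (const c)
  have eq: "diag (\<lambda>_. c) = (\<lambda>p. Cst c * p)" by (rule ext, rule cf_eqI) simp
  show ?case unfolding eq by (rule weyl.const)
next
  case (coord i)
  have "diag (\<lambda>w. of_nat (w i)) = (\<lambda>p. X i * p) \<circ> pdiff i"
    by (rule ext, rule cf_eqI) (simp add: cf_X_mult cf_pdiff del: of_nat_Suc)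
  then show ?case using weyl.comp [OF weyl.mult weyl.pdiff] by (simp only:)
next
  case (add q r)
  have "diag (\<lambda>w. q w + r w) = (\<lambda>p. diag q p + diag r p)"
    by (rule ext, rule cf_eqI) (simp add: algebra_simps)
  then show ?case using weyl.add add by metis
next
  case (mult q r)
  have "diag (\<lambda>w. q w * r w) = diag q \<circ> diag r"
    by (rule ext, rule cf_eqI) (simp add: algebra_simps)
  then show ?case using weyl.comp mult by metis
qed

lemma polyfun_prod:
  "finite S \<Longrightarrow> (\<And>x. x \<in> S \<Longrightarrow> q x \<in> polyfun) \<Longrightarrow> (\<lambda>w. \<Prod>x\<in>S. q x w) \<in> polyfun"
  by (induct S rule: finite_induct) (auto intro: polyfun.intros)

lemma polyfun_sum:
  "finite S \<Longrightarrow> (\<And>x. x \<in> S \<Longrightarrow> q x \<in> polyfun) \<Longrightarrow> (\<lambda>w. \<Sum>x\<in>S. q x w) \<in> polyfun"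
  by (induct S rule: finite_induct) (auto intro: polyfun.intros)

text \<open>The Lagrange polynomial that is 1 at \<open>m\<close> and 0 at the other points of \<open>{..N}\<close>; through it,
  projections to eigenspaces of polynomials in the \<open>X i * pdiff i\<close> are again such polynomials.\<close>

definition lag :: "nat \<Rightarrow> nat \<Rightarrow> complex \<Rightarrow> complex" where
  "lag N m t = (\<Prod>k\<in>{..N} - {m}. (t - of_nat k) / (of_nat m - of_nat k))"

lemma lag_eq:
  assumes "j \<le> N"
  shows "lag N m (of_nat j) = (if j = m then 1 else 0)"
proof (cases "j = m")
  case True
  have "(\<Prod>k\<in>{..N} - {m}. (of_nat m - of_nat k) / (of_nat m - of_nat k :: complex)) = (\<Prod>k\<in>{..N} - {m}. 1)"
    by (rule prod.cong) auto
  with True show ?thesis by (simp add: lag_def)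
next
  case False
  then have "lag N m (of_nat j) = 0"
    unfolding lag_def using assms by (subst prod_zero_iff) auto
  with False show ?thesis by simp
qed

lemma lag_polyfun: "q \<in> polyfun \<Longrightarrow> (\<lambda>w. lag N m (q w)) \<in> polyfun"
proof -
  assume q: "q \<in> polyfun"
  have "(\<lambda>w. (q w + (- of_nat k)) * (1 / (of_nat m - of_nat k))) \<in> polyfun" for k
    by (intro polyfun.intros q)
  then show ?thesis unfolding lag_def by (intro polyfun_prod) auto
qed

section \<open>The Fischer inner product\<close>

text \<open>Monomials are orthogonal and the square norm of \<open>xmon w\<close> is the product of the factorials of
  \<open>w\<close>.  With this choice multiplication by \<open>X i\<close> and \<open>pdiff i\<close> are adjoint, so the Weyl algebra
  is closed under adjoints.\<close>

definition ip :: "'n::finite cpoly \<Rightarrow> 'n cpoly \<Rightarrow> complex" where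
  "ip p q = (\<Sum>w\<in>supp p. (\<Prod>i\<in>UNIV. fact (w i)) * cf p w * cnj (cf q w))"

lemma ip_superset:
  assumes "finite S" "supp p \<subseteq> S"
  shows "ip p q = (\<Sum>w\<in>S. (\<Prod>i\<in>UNIV. fact (w i)) * cf p w * cnj (cf q w))"
  unfolding ip_def
  by (rule sum.mono_neutral_left) (use assms in \<open>auto simp: supp_iff\<close>)

lemma ip_cnj: "ip q p = cnj (ip p q)"
proof -
  have "ip q p = (\<Sum>w\<in>supp p \<union> supp q. (\<Prod>i\<in>UNIV. fact (w i)) * cf q w * cnj (cf p w))"
    by (rule ip_superset) auto
  moreover have "ip p q = (\<Sum>w\<in>supp p \<union> supp q. (\<Prod>i\<in>UNIV. fact (w i)) * cf p w * cnj (cf q w))"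
    by (rule ip_superset) auto
  ultimately show ?thesis by (simp add: mult.commute mult.left_commute mult.assoc)
qed

lemma ip_add: "ip (p + r) q = ip p q + ip r q"
proof -
  have "supp (p + r) \<subseteq> supp p \<union> supp r" by (auto simp: supp_iff)
  then show ?thesis
    by (simp add: ip_superset [of "supp p \<union> supp r"] ring_distribs sum.distrib)
qed

lemma ip_scale: "ip (Cst c * p) q = c * ip p q"
proof -
  have "supp (Cst c * p) \<subseteq> supp p" by (auto simp: supp_iff)
  then show ?thesis
    by (simp add: ip_superset [of "supp p"] sum_distrib_left mult.left_commute mult.assoc)
qed

lemma ip_add_right: "ip p (q + r) = ip p q + ip p r"
  and ip_scale_right: "ip p (Cst c * q) = cnj c * ip p q"
  using ip_add [of q r p] ip_scale [of c q p]
  by (simp_all add: ip_cnj [of p "q + r"] ip_cnj [of p "Cst c * q"] ip_cnj [of p q] ip_cnj [of p r])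

lemma ip_0 [simp]: "ip 0 q = 0"
  by (simp add: ip_def supp_iff)

lemma ip_0_right [simp]: "ip p 0 = 0"
  by (simp add: ip_def)

lemma ip_self_nonzero:
  assumes "p \<noteq> 0"
  shows "ip p p \<noteq> 0"
proof -
  let ?t = "\<lambda>w. (\<Prod>i\<in>UNIV. fact (w i)) * (cmod (cf p w))\<^sup>2"
  have eq: "ip p p = complex_of_real (\<Sum>w\<in>supp p. ?t w)"
    by (simp add: ip_def mult.assoc complex_norm_square [symmetric] of_real_prod)
  have pos: "(\<Sum>w\<in>supp p. ?t w) > 0"
  proof (rule sum_pos)
    show "supp p \<noteq> {}" using assms by simp
  qed (auto simp: supp_iff intro!: mult_pos_pos prod_pos)
  show ?thesis unfolding eq of_real_eq_0_iff using pos by linarith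
qed

lemma ip_nondegenerate: "(\<And>r. ip r p = ip r q) \<Longrightarrow> p = q"
proof -
  assume "\<And>r. ip r p = ip r q"
  then have "ip (p - q) (p + Cst (-1) * q) = 0" by (simp add: ip_add_right ip_scale_right)
  moreover have "p + Cst (-1) * q = p - q" by (rule cf_eqI) simp
  ultimately show "p = q" using ip_self_nonzero [of "p - q"] by auto
qed

definition adjoint_op :: "'n::finite oper \<Rightarrow> 'n oper \<Rightarrow> bool" where
  "adjoint_op D E \<longleftrightarrow> (\<forall>p q. ip (D p) q = ip p (E q))"

lemma adjoint_op_sym: "adjoint_op D E \<Longrightarrow> adjoint_op E D"
  unfolding adjoint_op_def by (metis ip_cnj)

lemma adjoint_X_pdiff: "adjoint_op (\<lambda>p. X i * p) (pdiff i)"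
  unfolding adjoint_op_def
proof (intro allI)
  fix p q :: "'a cpoly"
  let ?up = "\<lambda>w. w(i := Suc (w i))"
  have sub: "supp (X i * p) \<subseteq> ?up ` supp p"
  proof
    fix w assume "w \<in> supp (X i * p)"
    then have w: "w i \<noteq> 0" "w(i := w i - 1) \<in> supp p"
      by (auto simp: supp_iff cf_X_mult split: if_splits)
    then have "w = ?up (w(i := w i - 1))" by auto
    with w show "w \<in> ?up ` supp p" by blast
  qed
  have inj: "inj_on ?up (supp p)"
  proof (rule inj_onI)
    fix v w assume eq: "?up v = ?up w"
    show "v = w"
    proof
      fix j show "v j = w j" using fun_cong [OF eq, of j] by (cases "j = i") auto
    qed
  qed
  have fac: "(\<Prod>j\<in>UNIV. fact (?up w j)) = (of_nat (w i + 1) * (\<Prod>j\<in>UNIV. fact (w j)) :: complex)" for w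
  proof -
    have "(\<Prod>j\<in>UNIV. fact (?up w j)) = fact (Suc (w i)) * (\<Prod>j\<in>UNIV - {i}. fact (w j) :: complex)"
      by (subst prod.remove [of _ i]) auto
    moreover have "(\<Prod>j\<in>UNIV. fact (w j) :: complex) = fact (w i) * (\<Prod>j\<in>UNIV - {i}. fact (w j))"
      by (subst prod.remove [of _ i]) auto
    ultimately show ?thesis by (simp add: mult_ac)
  qed
  have "ip (X i * p) q = (\<Sum>w\<in>?up ` supp p. (\<Prod>i\<in>UNIV. fact (w i)) * cf (X i * p) w * cnj (cf q w))"
    by (rule ip_superset) (use sub in auto)
  also have "\<dots> = (\<Sum>w\<in>supp p. (\<Prod>j\<in>UNIV. fact (?up w j)) * cf (X i * p) (?up w) * cnj (cf q (?up w)))"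
    by (subst sum.reindex [OF inj]) simp
  also have "\<dots> = (\<Sum>w\<in>supp p. (\<Prod>j\<in>UNIV. fact (w j)) * cf p w * cnj (cf (pdiff i q) w))"
    by (rule sum.cong) (simp_all add: fac cf_X_mult cf_pdiff del: fun_upd_apply of_nat_Suc of_nat_add,
        simp add: mult_ac)
  finally show "ip (X i * p) q = ip p (pdiff i q)" by (simp add: ip_def)
qed

lemma adjoint_const: "adjoint_op (\<lambda>p. Cst c * p) (\<lambda>p. Cst (cnj c) * p)"
  by (simp add: adjoint_op_def ip_scale ip_scale_right)

lemma adjoint_add:
  "adjoint_op D D' \<Longrightarrow> adjoint_op E E' \<Longrightarrow> adjoint_op (\<lambda>p. D p + E p) (\<lambda>p. D' p + E' p)"
  by (simp add: adjoint_op_def ip_add ip_add_right)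

lemma adjoint_comp: "adjoint_op D D' \<Longrightarrow> adjoint_op E E' \<Longrightarrow> adjoint_op (D \<circ> E) (E' \<circ> D')"
  by (simp add: adjoint_op_def)

lemma weyl_adjoint: "D \<in> weyl \<Longrightarrow> \<exists>E\<in>weyl. adjoint_op D E"
proof (induct rule: weyl.induct)
  case (const c) show ?case by (rule bexI [where x = "\<lambda>p. Cst (cnj c) * p"], rule adjoint_const, rule weyl.const)
next
  case (mult i) show ?case by (rule bexI [where x = "pdiff i"], rule adjoint_X_pdiff, rule weyl.pdiff)
next
  case (pdiff i)
  show ?case by (rule bexI [where x = "\<lambda>p. X i * p"], rule adjoint_op_sym [OF adjoint_X_pdiff], rule weyl.mult)
next
  case (add D E)
  then obtain D' E' where "D' \<in> weyl" "adjoint_op D D'" "E' \<in> weyl" "adjoint_op E E'" by blast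
  then show ?case
    by (intro bexI [of _ "\<lambda>p. D' p + E' p"] adjoint_add weyl.add)
next
  case (comp D E)
  then obtain D' E' where "D' \<in> weyl" "adjoint_op D D'" "E' \<in> weyl" "adjoint_op E E'" by blast
  then show ?case
    by (intro bexI [of _ "E' \<circ> D'"] adjoint_comp weyl.comp)
qed

lemma weyl_hom_adjoint: "weyl_hom k D \<Longrightarrow> \<exists>E. weyl_hom (- k) E \<and> adjoint_op D E"
proof (induct rule: weyl_hom.induct)
  case (const c)
  have "weyl_hom (- 0) (\<lambda>p. Cst (cnj c) * p)" using weyl_hom.const by simp
  moreover have "adjoint_op (\<lambda>p. Cst c * p) (\<lambda>p. Cst (cnj c) * p)" by (rule adjoint_const)
  ultimately show ?case by blast
next
  case (mult i) show ?case
    by (intro exI [of _ "pdiff i"] conjI adjoint_X_pdiff weyl_hom.pdiff)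
next
  case (pdiff i)
  have "weyl_hom (- (- 1)) (\<lambda>p. X i * p)" using weyl_hom.mult by simp
  then show ?case
    by (intro exI [of _ "\<lambda>p. X i * p"] conjI adjoint_op_sym [OF adjoint_X_pdiff])
next
  case (add k D E)
  then obtain D' E' where "weyl_hom (- k) D'" "adjoint_op D D'" "weyl_hom (- k) E'" "adjoint_op E E'"
    by blast
  then show ?case
    by (intro exI [of _ "\<lambda>p. D' p + E' p"] conjI adjoint_add weyl_hom.add)
next
  case (comp k D l E)
  then obtain D' E' where h: "weyl_hom (- k) D'" "weyl_hom (- l) E'"
    and a: "adjoint_op D D'" "adjoint_op E E'"
    by blast
  have 1: "weyl_hom (- l + - k) (E' \<circ> D')" using h by (intro weyl_hom.comp)
  have 2: "adjoint_op (D \<circ> E) (E' \<circ> D')" using a by (rule adjoint_comp)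
  have "- l + - k = - (k + l)" by simp
  with 1 have "weyl_hom (- (k + l)) (E' \<circ> D')" by (simp only:)
  then show ?case using 2 by blast
qed

lemma ip_diag_act:
  assumes "\<And>i. cmod (a i) = 1"
  shows "ip (diag_act a p) (diag_act a q) = ip p q"
proof -
  let ?c = "\<lambda>w. \<Prod>i\<in>UNIV. a i ^ w i"
  have 1: "?c w * cnj (?c w) = 1" for w
    by (simp add: prod.distrib [symmetric] power_mult_distrib [symmetric] complex_norm_square [symmetric] assms)
  have "ip (diag_act a p) (diag_act a q) = (\<Sum>w\<in>supp p. (\<Prod>i\<in>UNIV. fact (w i)) * cf (diag_act a p) w * cnj (cf (diag_act a q) w))"
    by (rule ip_superset) (auto simp: supp_iff cf_diag_act)
  also have "\<dots> = ip p q"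
    unfolding ip_def
  proof (rule sum.cong [OF refl])
    fix w
    have "F * (C * x) * cnj (C * y) = F * x * cnj y * (C * cnj C)" for F C x y :: complex
      by (simp add: mult_ac)
    then show "(\<Prod>i\<in>UNIV. fact (w i)) * cf (diag_act a p) w * cnj (cf (diag_act a q) w) =
        (\<Prod>i\<in>UNIV. fact (w i)) * cf p w * cnj (cf q w)"
      unfolding cf_diag_act by (simp only: 1 mult_1_right)
  qed
  finally show ?thesis .
qed

lemma ip_perm_act:
  assumes "bij \<sigma>"
  shows "ip (perm_act \<sigma> p) (perm_act \<sigma> q) = ip p q"
proof -
  have inv: "w \<circ> inv \<sigma> \<circ> \<sigma> = w" "w \<circ> \<sigma> \<circ> inv \<sigma> = w" for w :: "'a \<Rightarrow> nat"
    using assms by (auto simp: fun_eq_iff bij_is_inj bij_is_surj surj_f_inv_f)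
  have s: "supp (perm_act \<sigma> p) = (\<lambda>w. w \<circ> inv \<sigma>) ` supp p"
  proof (intro set_eqI iffI)
    fix w assume "w \<in> supp (perm_act \<sigma> p)"
    then have "w \<circ> \<sigma> \<in> supp p" by (simp add: supp_iff cf_perm_act [OF assms])
    then show "w \<in> (\<lambda>w. w \<circ> inv \<sigma>) ` supp p" by (metis inv(2) imageI)
  qed (auto simp: supp_iff cf_perm_act [OF assms] inv)
  have "inj_on (\<lambda>w. w \<circ> inv \<sigma>) (supp p)" by (rule inj_onI) (metis inv(1))
  moreover have "(\<Prod>i\<in>UNIV. fact ((w \<circ> inv \<sigma>) i)) = (\<Prod>i\<in>UNIV. fact (w i) :: complex)" for w :: "'a \<Rightarrow> nat"
    unfolding comp_def
    by (rule prod.reindex_bij_betw [where g = "\<lambda>i. fact (w i)"]) (rule bij_imp_bij_inv [OF assms])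
  ultimately show ?thesis
    unfolding ip_def s
    by (subst sum.reindex) (simp_all add: cf_perm_act [OF assms] inv del: comp_apply,
        simp add: comp_def [of _ "\<lambda>w. w \<circ> inv \<sigma>"] inv del: comp_apply)
qed

section \<open>The groups and their rings of invariant operators\<close>

definition block_perms :: "'n set set \<Rightarrow> ('n \<Rightarrow> 'n) set" where
  "block_perms P = {\<sigma>. \<sigma> permutes UNIV \<and> (\<forall>\<Omega>\<in>P. \<sigma> ` \<Omega> = \<Omega>)}"

definition roots :: "nat \<Rightarrow> ('n \<Rightarrow> complex) set" where
  "roots d = {a. \<forall>i. a i ^ d = 1}"

definition monomial_mat :: "('n \<Rightarrow> complex) \<Rightarrow> ('n \<Rightarrow> 'n) \<Rightarrow> complex^'n^'n" where
  "monomial_mat a \<sigma> = (\<chi> i j. if i = \<sigma> j then a i else 0)"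

abbreviation singles :: "'n set set" where
  "singles \<equiv> range (\<lambda>x. {x})"

abbreviation inv_ops :: "nat \<Rightarrow> 'n set set \<Rightarrow> 'n::finite oper set" where
  "inv_ops d P \<equiv> weyl_inv (GP_mats d P)"

abbreviation inv_polys :: "nat \<Rightarrow> 'n set set \<Rightarrow> 'n::finite cpoly set" where
  "inv_polys d P \<equiv> poly_inv (GP_mats d P)"

lemma block_perms_bij: "\<sigma> \<in> block_perms P \<Longrightarrow> bij \<sigma>"
  by (auto simp: block_perms_def intro: permutes_bij)

lemma id_block_perms: "id \<in> block_perms P"
  by (simp add: block_perms_def permutes_id)

lemma inv_block_perms: "\<sigma> \<in> block_perms P \<Longrightarrow> inv \<sigma> \<in> block_perms P"
proof -
  assume \<sigma>: "\<sigma> \<in> block_perms P"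
  have "inv \<sigma> ` \<Omega> = \<Omega>" if "\<Omega> \<in> P" for \<Omega>
  proof -
    have "\<sigma> ` \<Omega> = \<Omega>" using \<sigma> that by (simp add: block_perms_def)
    then show ?thesis using image_inv_f_f [OF bij_is_inj [OF block_perms_bij [OF \<sigma>]], of \<Omega>] by simp
  qed
  then show "inv \<sigma> \<in> block_perms P" using \<sigma> by (simp add: block_perms_def permutes_inv)
qed

lemma comp_block_perms: "\<sigma> \<in> block_perms P \<Longrightarrow> \<tau> \<in> block_perms P \<Longrightarrow> \<sigma> \<circ> \<tau> \<in> block_perms P"
  unfolding block_perms_def by (simp add: permutes_compose image_comp [symmetric] del: comp_apply)

lemma block_perms_subset_empty: "block_perms P \<subseteq> block_perms {}"
  by (auto simp: block_perms_def)

lemma block_perms_singles: "block_perms singles = {id}"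
  by (auto simp: block_perms_def permutes_id)

lemma one_root: "(\<lambda>_. 1) \<in> roots d"
  by (simp add: roots_def)

lemma root_nonzero: "d \<ge> 1 \<Longrightarrow> a \<in> roots d \<Longrightarrow> a i \<noteq> 0"
proof
  assume "d \<ge> 1" "a \<in> roots d" "a i = 0"
  moreover from \<open>a \<in> roots d\<close> have "a i ^ d = 1" by (simp add: roots_def)
  ultimately show False by (simp add: power_0_left)
qed

lemma root_norm:
  assumes "d \<ge> 1" "a \<in> roots d"
  shows "cmod (a i) = 1"
proof -
  have "a i ^ d = 1" using assms(2) unfolding roots_def by blast
  then have "cmod (a i ^ d) = 1 ^ d" by simp
  then have "cmod (a i) ^ d = 1 ^ d" by (simp only: norm_power)
  then show ?thesis by (rule power_eq_imp_eq_base) (use assms(1) in auto)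
qed

lemma diag_act_inverse:
  assumes "d \<ge> 1" "a \<in> roots d"
  shows "diag_act a (diag_act (\<lambda>i. 1 / a i) p) = p" "diag_act (\<lambda>i. 1 / a i) (diag_act a p) = p"
  by (rule cf_eqI, simp add: cf_diag_act power_one_over root_nonzero [OF assms]
      flip: mult.assoc prod.distrib)+

lemma perm_act_inverse:
  assumes "bij \<sigma>"
  shows "perm_act \<sigma> (perm_act (inv \<sigma>) p) = p" "perm_act (inv \<sigma>) (perm_act \<sigma> p) = p"
  using assms by (simp_all add: perm_act_comp bij_is_inj bij_is_surj surj_iff [THEN iffD1])

lemma diag_perm_mat: "(\<chi> i j. if i = j then a i else 0) ** perm_mat \<sigma> = monomial_mat a \<sigma>"
proof -
  have "(\<Sum>k\<in>UNIV. (if i = k then a i else 0) * (if k = \<sigma> j then 1 else 0)) =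
      (if i = \<sigma> j then a i else 0)" for i j
    by (subst sum.cong [OF refl, of _ _ "\<lambda>k. if k = i then (if i = \<sigma> j then a i else 0) else 0"]) auto
  then show ?thesis
    by (simp add: matrix_matrix_mult_def perm_mat_def monomial_mat_def vec_eq_iff)
qed

lemma GP_mats_eq: "GP_mats d P = {monomial_mat a \<sigma> | a \<sigma>. a \<in> roots d \<and> \<sigma> \<in> block_perms P}"
proof -
  have "GP_mats d P = {(\<chi> i j. if i = j then a i else 0) ** perm_mat \<sigma> | a \<sigma>. a \<in> roots d \<and> \<sigma> \<in> block_perms P}"
    unfolding GP_mats_def A_mats_def roots_def block_perms_def by blast
  then show ?thesis by (simp only: diag_perm_mat)
qed

lemma G_mats_eq: "G_mats d = GP_mats d {}"
  by (simp add: G_mats_def GP_mats_def)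

lemma A_mats_eq: "A_mats d = GP_mats d singles"
proof -
  have "A_mats d = {monomial_mat a id | a. a \<in> roots d}"
    by (simp add: A_mats_def monomial_mat_def roots_def)
  then show ?thesis by (simp add: GP_mats_eq block_perms_singles)
qed

lemma mat_act_monomial_mat: "mat_act (monomial_mat a \<sigma>) p = diag_act a (perm_act \<sigma> p)"
proof -
  have "(\<Sum>i\<in>UNIV. Cst (if i = \<sigma> j then a i else 0) * X i) = Cst (a (\<sigma> j)) * X (\<sigma> j)" for j
    by (subst sum.cong [OF refl, of _ _ "\<lambda>i. if i = \<sigma> j then Cst (a i) * X i else 0"]) auto
  then show ?thesis
    by (simp add: mat_act_def monomial_mat_def diag_act_def perm_act_def poly_subst_poly_subst)
qed

lemma mat_act_mult: "mat_act (g ** h) p = mat_act g (mat_act h p)"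
proof -
  have "(\<Sum>k\<in>UNIV. Cst ((g ** h) $ k $ j) * X k) =
      (\<Sum>i\<in>UNIV. Cst (h $ i $ j) * (\<Sum>k\<in>UNIV. Cst (g $ k $ i) * X k))" for j
  proof -
    have sum_Cst: "Cst (sum c S) = (\<Sum>i\<in>S. Cst (c i))" for c and S :: "'a set"
      by (induct S rule: infinite_finite_induct) (auto simp: Cst_add)
    have "(\<Sum>k\<in>UNIV. Cst ((g ** h) $ k $ j) * X k) =
        (\<Sum>k\<in>UNIV. \<Sum>i\<in>UNIV. Cst (g $ k $ i) * (Cst (h $ i $ j) * X k))"
      by (simp add: matrix_matrix_mult_def sum_Cst sum_distrib_right Cst_mult mult.assoc)
    also have "\<dots> = (\<Sum>i\<in>UNIV. Cst (h $ i $ j) * (\<Sum>k\<in>UNIV. Cst (g $ k $ i) * X k))"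
      by (subst sum.swap) (simp add: sum_distrib_left mult.left_commute)
    finally show ?thesis .
  qed
  then show ?thesis
    by (simp add: mat_act_def poly_subst_poly_subst poly_subst_sum poly_subst_mult)
qed

lemma mat_act_1: "mat_act (mat 1) p = p"
proof -
  have "(\<Sum>i\<in>UNIV. Cst (if i = j then 1 else 0) * X i) = (X j :: 'a cpoly)" for j
    by (subst sum.cong [OF refl, of _ _ "\<lambda>i. if i = j then X i else 0"]) auto
  then show ?thesis by (simp add: mat_act_def mat_def)
qed

lemma monomial_mat_inverse:
  assumes "d \<ge> 1" "a \<in> roots d" "bij \<sigma>"
  shows "monomial_mat a \<sigma> ** monomial_mat (\<lambda>i. 1 / a (\<sigma> i)) (inv \<sigma>) = mat 1"
    and "monomial_mat (\<lambda>i. 1 / a (\<sigma> i)) (inv \<sigma>) ** monomial_mat a \<sigma> = mat 1"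
proof -
  note nz = root_nonzero [OF assms(1,2)]
  have inv: "inv \<sigma> (\<sigma> i) = i" "\<sigma> (inv \<sigma> i) = i" for i
    using assms(3) by (simp_all add: bij_is_inj bij_is_surj surj_f_inv_f)
  have "(\<Sum>k\<in>UNIV. (if i = \<sigma> k then a i else 0) * (if k = inv \<sigma> j then 1 / a (\<sigma> k) else 0)) =
      (if i = j then 1 else 0)" for i j
    by (subst sum.cong [OF refl, of _ _ "\<lambda>k. if k = inv \<sigma> j then (if i = j then 1 else 0) else 0"])
       (auto simp: inv nz)
  then show "monomial_mat a \<sigma> ** monomial_mat (\<lambda>i. 1 / a (\<sigma> i)) (inv \<sigma>) = mat 1"
    by (simp add: matrix_matrix_mult_def monomial_mat_def mat_def vec_eq_iff)
  have "(\<Sum>k\<in>UNIV. (if i = inv \<sigma> k then 1 / a (\<sigma> i) else 0) * (if k = \<sigma> j then a k else 0)) =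
      (if i = j then 1 else 0)" for i j
    by (subst sum.cong [OF refl, of _ _ "\<lambda>k. if k = \<sigma> j then (if i = j then 1 else 0) else 0"])
       (auto simp: inv nz)
  then show "monomial_mat (\<lambda>i. 1 / a (\<sigma> i)) (inv \<sigma>) ** monomial_mat a \<sigma> = mat 1"
    by (simp add: matrix_matrix_mult_def monomial_mat_def mat_def vec_eq_iff)
qed

text \<open>The matrices of the groups are invertible, so conjugation on operators can be read as commutation.\<close>

lemma mat_act_matrix_inv:
  assumes "d \<ge> 1" "g \<in> GP_mats d P"
  shows "mat_act g (mat_act (matrix_inv g) p) = p" "mat_act (matrix_inv g) (mat_act g p) = p"
proof -
  obtain a \<sigma> where "g = monomial_mat a \<sigma>" "a \<in> roots d" "\<sigma> \<in> block_perms P"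
    using assms(2) by (auto simp: GP_mats_eq)
  then have "\<exists>h. g ** h = mat 1 \<and> h ** g = mat 1"
    using monomial_mat_inverse [OF assms(1)] block_perms_bij by blast
  then have "g ** matrix_inv g = mat 1 \<and> matrix_inv g ** g = mat 1"
    unfolding matrix_inv_def by (rule someI_ex)
  then show "mat_act g (mat_act (matrix_inv g) p) = p" "mat_act (matrix_inv g) (mat_act g p) = p"
    by (metis mat_act_1 mat_act_mult)+
qed

lemma inv_ops_iff:
  assumes d: "d \<ge> 1"
  shows "D \<in> inv_ops d P \<longleftrightarrow> D \<in> weyl \<and> (\<forall>a\<in>roots d. \<forall>p. D (diag_act a p) = diag_act a (D p)) \<and>
    (\<forall>\<sigma>\<in>block_perms P. \<forall>p. D (perm_act \<sigma> p) = perm_act \<sigma> (D p))" (is "?L \<longleftrightarrow> ?R")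
proof
  assume L: ?L
  have comm: "D (diag_act a (perm_act \<sigma> p)) = diag_act a (perm_act \<sigma> (D p))" if "a \<in> roots d" "\<sigma> \<in> block_perms P" for a \<sigma> p
  proof -
    have g: "monomial_mat a \<sigma> \<in> GP_mats d P" using that by (auto simp: GP_mats_eq)
    then have "op_act (monomial_mat a \<sigma>) D = D" using L by (simp add: weyl_inv_def)
    then have "mat_act (monomial_mat a \<sigma>) (D (mat_act (matrix_inv (monomial_mat a \<sigma>)) (mat_act (monomial_mat a \<sigma>) p))) =
        D (mat_act (monomial_mat a \<sigma>) p)"
      by (metis comp_apply op_act_def)
    then show ?thesis unfolding mat_act_matrix_inv [OF d g] unfolding mat_act_monomial_mat by (rule sym)
  qed
  show ?R
    using L comm [OF _ id_block_perms] comm [OF one_root] by (simp add: weyl_inv_def)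
next
  assume R: ?R
  have "op_act g D = D" if g: "g \<in> GP_mats d P" for g
  proof
    fix p
    obtain a \<sigma> where [simp]: "g = monomial_mat a \<sigma>" and as: "a \<in> roots d" "\<sigma> \<in> block_perms P"
      using g by (auto simp: GP_mats_eq)
    have "op_act g D p = mat_act g (D (mat_act (matrix_inv g) p))" by (simp add: op_act_def)
    also have "\<dots> = D (mat_act g (mat_act (matrix_inv g) p))" using R as by (simp add: mat_act_monomial_mat)
    also have "\<dots> = D p" by (simp only: mat_act_matrix_inv [OF d g])
    finally show "op_act g D p = D p" .
  qed
  with R show ?L by (simp add: weyl_inv_def)
qed

lemma inv_polys_iff:
  "p \<in> inv_polys d P \<longleftrightarrow> (\<forall>a\<in>roots d. diag_act a p = p) \<and> (\<forall>\<sigma>\<in>block_perms P. perm_act \<sigma> p = p)" (is "?L \<longleftrightarrow> ?R")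
proof
  assume ?L
  then have "diag_act a (perm_act \<sigma> p) = p" if "a \<in> roots d" "\<sigma> \<in> block_perms P" for a \<sigma>
    using that unfolding poly_inv_def GP_mats_eq by (force simp flip: mat_act_monomial_mat)
  from this [OF _ id_block_perms] this [OF one_root] show ?R by simp
next
  assume ?R
  then show ?L by (auto simp: poly_inv_def GP_mats_eq mat_act_monomial_mat)
qed

lemma inv_ops_weyl: "D \<in> inv_ops d P \<Longrightarrow> D \<in> weyl"
  by (simp add: weyl_inv_def)

lemma inv_ops_antimono: "d \<ge> 1 \<Longrightarrow> block_perms Q \<subseteq> block_perms P \<Longrightarrow> inv_ops d P \<subseteq> inv_ops d Q"
  by (simp add: inv_ops_iff subset_eq)

context
  fixes d :: nat
  assumes d: "d \<ge> 1"
begin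

lemma inv_ops_const: "(\<lambda>p. Cst c * p) \<in> inv_ops d P"
  by (simp add: inv_ops_iff [OF d] weyl.const diag_act_mult perm_act_mult)

lemma inv_ops_add: "D \<in> inv_ops d P \<Longrightarrow> E \<in> inv_ops d P \<Longrightarrow> (\<lambda>p. D p + E p) \<in> inv_ops d P"
  by (simp add: inv_ops_iff [OF d] weyl.add diag_act_add perm_act_add)

lemma inv_ops_comp: "D \<in> inv_ops d P \<Longrightarrow> E \<in> inv_ops d P \<Longrightarrow> D \<circ> E \<in> inv_ops d P"
  unfolding inv_ops_iff [OF d] using weyl.comp [of D E] by simp

lemma inv_ops_mult: "f \<in> inv_polys d P \<Longrightarrow> (\<lambda>p. f * p) \<in> inv_ops d P"
  by (simp add: inv_ops_iff [OF d] inv_polys_iff weyl_mult_op diag_act_mult perm_act_mult)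

lemma inv_ops_diag:
  assumes "q \<in> polyfun" "\<And>\<sigma> w. \<sigma> \<in> block_perms P \<Longrightarrow> q (w \<circ> \<sigma>) = q w"
  shows "diag q \<in> inv_ops d P"
proof -
  have "diag q (diag_act a p) = diag_act a (diag q p)" for a p
    by (rule cf_eqI) (simp add: cf_diag_act)
  moreover have "diag q (perm_act \<sigma> p) = perm_act \<sigma> (diag q p)" if "\<sigma> \<in> block_perms P" for \<sigma> p
    by (rule cf_eqI) (simp add: cf_perm_act [OF block_perms_bij [OF that]] assms(2) [OF that])
  ultimately show ?thesis by (simp add: inv_ops_iff [OF d] diag_weyl assms(1))
qed

text \<open>As the group acts by unitary maps, the adjoint of an operator that commutes with it does so, too.\<close>

lemma inv_ops_adjointI:
  assumes D: "D \<in> inv_ops d P" and E: "E \<in> weyl" and adj: "adjoint_op D E"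
  shows "E \<in> inv_ops d P"
proof -
  have "E (diag_act a q) = diag_act a (E q)" if a: "a \<in> roots d" for a q
  proof (rule ip_nondegenerate)
    fix r
    define s where "s = diag_act (\<lambda>i. 1 / a i) r"
    have r: "r = diag_act a s" by (simp add: s_def diag_act_inverse [OF d a])
    have "ip r (E (diag_act a q)) = ip (D (diag_act a s)) (diag_act a q)"
      using adj by (simp add: adjoint_op_def r)
    also have "\<dots> = ip (D s) q"
      using D a by (simp add: inv_ops_iff [OF d] ip_diag_act root_norm [OF d])
    also have "\<dots> = ip (diag_act a s) (diag_act a (E q))"
      using adj a by (simp add: adjoint_op_def ip_diag_act root_norm [OF d])
    finally show "ip r (E (diag_act a q)) = ip r (diag_act a (E q))" by (simp add: r)
  qed
  moreover have "E (perm_act \<sigma> q) = perm_act \<sigma> (E q)" if \<sigma>: "\<sigma> \<in> block_perms P" for \<sigma> q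
  proof (rule ip_nondegenerate)
    fix r
    note b = block_perms_bij [OF \<sigma>]
    define s where "s = perm_act (inv \<sigma>) r"
    have r: "r = perm_act \<sigma> s" by (simp add: s_def perm_act_inverse [OF b])
    have "ip r (E (perm_act \<sigma> q)) = ip (D (perm_act \<sigma> s)) (perm_act \<sigma> q)"
      using adj by (simp add: adjoint_op_def r)
    also have "\<dots> = ip (D s) q"
      using D \<sigma> by (simp add: inv_ops_iff [OF d] ip_perm_act [OF b])
    also have "\<dots> = ip (perm_act \<sigma> s) (perm_act \<sigma> (E q))"
      using adj by (simp add: adjoint_op_def ip_perm_act [OF b])
    finally show "ip r (E (perm_act \<sigma> q)) = ip r (perm_act \<sigma> (E q))" by (simp add: r)
  qed
  ultimately show ?thesis using E by (simp add: inv_ops_iff [OF d])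
qed

lemma inv_ops_adjoint: "D \<in> inv_ops d P \<Longrightarrow> \<exists>E\<in>inv_ops d P. adjoint_op D E"
  using weyl_adjoint inv_ops_adjointI inv_ops_weyl by blast

lemma inv_ops_submodule: "op_submodule (inv_ops d P) {D v | D. D \<in> inv_ops d P}"
  unfolding op_submodule_def
proof (intro conjI ballI)
  show "0 \<in> {D v | D. D \<in> inv_ops d P}" using inv_ops_const [of 0] by force
next
  fix x y assume "x \<in> {D v | D. D \<in> inv_ops d P}" "y \<in> {D v | D. D \<in> inv_ops d P}"
  then obtain D E where xy: "x = D v" "y = E v" and D: "D \<in> inv_ops d P" "E \<in> inv_ops d P" by blast
  have "x - y = D v + Cst (-1) * E v" by (rule cf_eqI) (simp add: xy)
  moreover have "(\<lambda>p. D p + ((\<lambda>p. Cst (-1) * p) \<circ> E) p) \<in> inv_ops d P"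
    by (rule inv_ops_add [OF D(1) inv_ops_comp [OF inv_ops_const D(2)]])
  ultimately show "x - y \<in> {D v | D. D \<in> inv_ops d P}"
    by (intro CollectI exI [of _ "\<lambda>p. D p + ((\<lambda>p. Cst (-1) * p) \<circ> E) p"]) simp
next
  fix E x assume "E \<in> inv_ops d P" "x \<in> {D v | D. D \<in> inv_ops d P}"
  then obtain D where "x = D v" "E \<circ> D \<in> inv_ops d P" using inv_ops_comp by blast
  then show "E x \<in> {D v | D. D \<in> inv_ops d P}" by (auto intro!: exI [of _ "E \<circ> D"])
qed

end

section \<open>Submodules\<close>

lemma op_submodule_0: "op_submodule R N \<Longrightarrow> 0 \<in> N"
  and op_submodule_minus: "op_submodule R N \<Longrightarrow> x \<in> N \<Longrightarrow> y \<in> N \<Longrightarrow> x - y \<in> N"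
  and op_submodule_op: "op_submodule R N \<Longrightarrow> D \<in> R \<Longrightarrow> x \<in> N \<Longrightarrow> D x \<in> N"
  by (auto simp: op_submodule_def)

lemma op_submodule_add: "op_submodule R N \<Longrightarrow> x \<in> N \<Longrightarrow> y \<in> N \<Longrightarrow> x + y \<in> N"
  using op_submodule_minus [of R N x "0 - y"] op_submodule_minus [of R N 0 y] op_submodule_0 [of R N]
  by simp

lemma op_submodule_sum:
  "op_submodule R N \<Longrightarrow> (\<And>x. x \<in> S \<Longrightarrow> f x \<in> N) \<Longrightarrow> sum f S \<in> N"
  by (induct S rule: infinite_finite_induct) (auto intro: op_submodule_add op_submodule_0)

lemma op_submodule_Int: "op_submodule R N \<Longrightarrow> op_submodule R M \<Longrightarrow> op_submodule R (N \<inter> M)"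
  by (simp add: op_submodule_def)

text \<open>With two simple modules this is applied both ways, to identify them by one common element.\<close>

lemma op_simple_eqI:
  assumes "op_simple R M" "op_submodule R N" "x \<in> M" "x \<in> N" "x \<noteq> 0"
  shows "M \<subseteq> N"
proof -
  have "op_submodule R (M \<inter> N)"
    using assms by (intro op_submodule_Int) (auto simp: op_simple_def)
  then have "M \<inter> N = {0} \<or> M \<inter> N = M" using assms(1) unfolding op_simple_def by blast
  with assms(3-5) show ?thesis by blast
qed

lemma op_iso_refl: "op_iso R N N"
  unfolding op_iso_def by (rule exI [of _ "\<lambda>x. x"]) (simp add: bij_betw_def)

lemma op_iso_sym:
  assumes "op_iso R N N'" "op_submodule R N"
  shows "op_iso R N' N"
proof -
  obtain \<phi> where b: "bij_betw \<phi> N N'" and add: "\<And>x y. x \<in> N \<Longrightarrow> y \<in> N \<Longrightarrow> \<phi> (x + y) = \<phi> x + \<phi> y"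
    and op: "\<And>D x. D \<in> R \<Longrightarrow> x \<in> N \<Longrightarrow> \<phi> (D x) = D (\<phi> x)"
    using assms(1) by (auto simp: op_iso_def)
  define \<psi> where "\<psi> = the_inv_into N \<phi>"
  have inj: "inj_on \<phi> N" and img: "\<phi> ` N = N'" using b by (auto simp: bij_betw_def)
  have \<psi>: "\<psi> (\<phi> x) = x" if "x \<in> N" for x
    using that inj by (simp add: \<psi>_def the_inv_into_f_f)
  have "bij_betw \<psi> N' N" unfolding \<psi>_def by (rule bij_betw_the_inv_into [OF b])
  moreover have "\<psi> (x + y) = \<psi> x + \<psi> y" if xy: "x \<in> N'" "y \<in> N'" for x y
  proof -
    obtain u v where u: "u \<in> N" "x = \<phi> u" and v: "v \<in> N" "y = \<phi> v" using xy img by blast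
    then have "u + v \<in> N" using op_submodule_add [OF assms(2)] by blast
    then show ?thesis using u v by (simp add: \<psi> add [symmetric])
  qed
  moreover have "\<psi> (D x) = D (\<psi> x)" if D: "D \<in> R" and x: "x \<in> N'" for D x
  proof -
    obtain u where u: "u \<in> N" "x = \<phi> u" using x img by blast
    then have "D u \<in> N" using op_submodule_op [OF assms(2) D] by blast
    then show ?thesis using u by (simp add: \<psi> op [OF D, symmetric])
  qed
  ultimately show ?thesis unfolding op_iso_def by blast
qed

lemma op_iso_trans:
  assumes "op_iso R L M" "op_iso R M N"
  shows "op_iso R L N"
proof -
  obtain \<phi> \<psi> where b: "bij_betw \<phi> L M" "bij_betw \<psi> M N"
    and p: "\<forall>x\<in>L. \<forall>y\<in>L. \<phi> (x + y) = \<phi> x + \<phi> y" "\<forall>D\<in>R. \<forall>x\<in>L. \<phi> (D x) = D (\<phi> x)"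
    and q: "\<forall>x\<in>M. \<forall>y\<in>M. \<psi> (x + y) = \<psi> x + \<psi> y" "\<forall>D\<in>R. \<forall>x\<in>M. \<psi> (D x) = D (\<psi> x)"
    using assms by (auto simp: op_iso_def)
  have "\<phi> x \<in> M" if "x \<in> L" for x using b(1) that by (auto simp: bij_betw_def)
  with b p q show ?thesis
    unfolding op_iso_def by (intro exI [of _ "\<psi> \<circ> \<phi>"]) (auto intro: bij_betw_trans)
qed

text \<open>Schur's lemma: a homomorphism that does not vanish on a simple module is injective on it.\<close>

lemma op_simple_image:
  assumes simple: "op_simple R M"
    and add: "\<And>x y. \<phi> (x + y) = \<phi> x + \<phi> y"
    and op: "\<And>D x. D \<in> R \<Longrightarrow> x \<in> M \<Longrightarrow> \<phi> (D x) = D (\<phi> x)"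
    and R0: "\<And>D. D \<in> R \<Longrightarrow> D 0 = 0"
    and nz: "x \<in> M" "\<phi> x \<noteq> 0"
  shows "op_iso R M (\<phi> ` M)" and "op_simple R (\<phi> ` M)"
proof -
  have M: "op_submodule R M" using simple by (simp add: op_simple_def)
  have \<phi>0: "\<phi> 0 = 0" using add [of 0 0] by simp
  have minus: "\<phi> (x - y) = \<phi> x - \<phi> y" for x y using add [of "x - y" y] by simp
  have sub: "op_submodule R (M \<inter> \<phi> -` N)" if "op_submodule R N" for N
    using M that unfolding op_submodule_def by (auto simp: \<phi>0 minus op)
  have "op_submodule R {0}" by (simp add: op_submodule_def R0)
  from sub [OF this] have ker: "M \<inter> \<phi> -` {0} = {0}"
    using simple nz unfolding op_simple_def by blast
  have inj: "inj_on \<phi> M"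
  proof (rule inj_onI)
    fix x y assume xy: "x \<in> M" "y \<in> M" "\<phi> x = \<phi> y"
    then have "x - y \<in> M \<inter> \<phi> -` {0}" using op_submodule_minus [OF M] by (simp add: minus)
    with ker show "x = y" by simp
  qed
  then show "op_iso R M (\<phi> ` M)"
    unfolding op_iso_def using add op by (intro exI [of _ \<phi>]) (auto simp: bij_betw_def)
  show "op_simple R (\<phi> ` M)"
    unfolding op_simple_def
  proof (intro conjI allI impI)
    show "op_submodule R (\<phi> ` M)"
      using M unfolding op_submodule_def
      by (auto simp: image_iff minus [symmetric] op [symmetric]) (metis \<phi>0)+
    show "\<phi> ` M \<noteq> {0}" using nz by blast
    fix N assume N: "op_submodule R N" "N \<subseteq> \<phi> ` M"
    have img: "N = \<phi> ` (M \<inter> \<phi> -` N)" using N(2) by blast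
    have "M \<inter> \<phi> -` N = {0} \<or> M \<inter> \<phi> -` N = M"
      using simple sub [OF N(1)] unfolding op_simple_def by blast
    then show "N = {0} \<or> N = \<phi> ` M" using img \<phi>0 by (metis image_empty image_insert)
  qed
qed

section \<open>Homogeneous components\<close>

definition hom_part :: "nat \<Rightarrow> 'n::finite oper" where
  "hom_part m = diag (\<lambda>w. if wt w = m then 1 else 0)"

abbreviation hom_deg :: "nat \<Rightarrow> 'n::finite cpoly \<Rightarrow> bool" where
  "hom_deg m p \<equiv> \<forall>w\<in>supp p. wt w = m"

lemma cf_hom_part: "cf (hom_part m p) w = (if wt w = m then cf p w else 0)"
  by (simp add: hom_part_def)

lemma hom_deg_hom_part: "hom_deg m (hom_part m p)"
  by (auto simp: supp_iff cf_hom_part split: if_splits)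

lemma hom_part_hom_deg: "hom_deg m p \<Longrightarrow> hom_part m p = p"
  by (rule cf_eqI) (auto simp: supp_iff cf_hom_part)

lemma hom_part_hom_deg_other: "hom_deg m p \<Longrightarrow> k \<noteq> m \<Longrightarrow> hom_part k p = 0"
  by (rule cf_eqI) (auto simp: supp_iff cf_hom_part)

lemma hom_part_add: "hom_part m (p + q) = hom_part m p + hom_part m q"
  by (rule cf_eqI) (simp add: cf_hom_part)

lemma hom_part_0 [simp]: "hom_part m 0 = 0"
  by (rule cf_eqI) (simp add: cf_hom_part)

lemma hom_part_sum: "hom_part m (sum f S) = (\<Sum>x\<in>S. hom_part m (f x))"
  by (induct S rule: infinite_finite_induct) (auto simp: hom_part_add)

lemma hom_part_expand: "p = (\<Sum>m\<in>wt ` supp p. hom_part m p)"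
proof (rule cf_eqI)
  fix w
  show "cf p w = cf (\<Sum>m\<in>wt ` supp p. hom_part m p) w"
    by (cases "w \<in> supp p") (auto simp: cf_hom_part supp_iff)
qed

lemma hom_part_nonzero: "p \<noteq> 0 \<Longrightarrow> \<exists>m. hom_part m p \<noteq> 0"
  by (metis hom_part_expand sum.neutral)

lemma hom_part_degree_0: "hom_part 0 p = Cst (cf p (\<lambda>_. 0))"
proof (rule cf_eqI)
  fix w :: "'a \<Rightarrow> nat"
  have "wt w = 0 \<longleftrightarrow> w = (\<lambda>_. 0)" by (auto simp: wt_def fun_eq_iff)
  then show "cf (hom_part 0 p) w = cf (Cst (cf p (\<lambda>_. 0))) w" by (simp add: cf_hom_part cf_Cst)
qed

lemma hom_deg_mult: "hom_deg k p \<Longrightarrow> hom_deg m q \<Longrightarrow> hom_deg (k + m) (p * q)"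
  using supp_mult [of _ p q] by (force simp: wt_def sum.distrib)

lemma hom_part_mult:
  assumes "hom_deg m v"
  shows "hom_part j (f * v) = (if m \<le> j then hom_part (j - m) f * v else 0)"
proof -
  have "hom_part j (hom_part k f * v) = (if k + m = j then hom_part k f * v else 0)" for k
    using hom_deg_mult [OF hom_deg_hom_part assms] hom_part_hom_deg hom_part_hom_deg_other by metis
  then have "hom_part j (f * v) = (\<Sum>k\<in>wt ` supp f. if k + m = j then hom_part k f * v else 0)"
    by (subst hom_part_expand [of f]) (simp add: sum_distrib_right hom_part_sum)
  also have "\<dots> = (\<Sum>k\<in>wt ` supp f. if k = j - m then (if m \<le> j then hom_part k f * v else 0) else 0)"
    by (rule sum.cong) auto
  also have "\<dots> = (if m \<le> j then hom_part (j - m) f * v else 0)"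
  proof (cases "j - m \<in> wt ` supp f")
    case False
    then have "w \<notin> supp f" if "wt w = j - m" for w using that by (metis imageI)
    then have "hom_part (j - m) f = 0" by (intro cf_eqI) (simp add: cf_hom_part supp_iff)
    then show ?thesis by simp
  qed simp
  finally show ?thesis .
qed

lemma ip_hom_part: "hom_deg m q \<Longrightarrow> ip (hom_part m p) q = ip p q"
proof -
  assume q: "hom_deg m q"
  have "ip (hom_part m p) q = (\<Sum>w\<in>supp p. (\<Prod>i\<in>UNIV. fact (w i)) * cf (hom_part m p) w * cnj (cf q w))"
    by (rule ip_superset) (auto simp: supp_iff cf_hom_part split: if_splits)
  also have "\<dots> = ip p q"
    unfolding ip_def
  proof (rule sum.cong [OF refl])
    fix w
    have "cf q w = 0" if "wt w \<noteq> m" using q that by (auto simp: supp_iff)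
    then show "(\<Prod>i\<in>UNIV. fact (w i)) * cf (hom_part m p) w * cnj (cf q w) =
        (\<Prod>i\<in>UNIV. fact (w i)) * cf p w * cnj (cf q w)"
      by (auto simp: cf_hom_part)
  qed
  finally show ?thesis .
qed

lemma inv_polys_hom_part: "f \<in> inv_polys d P \<Longrightarrow> hom_part k f \<in> inv_polys d P"
  unfolding inv_polys_iff
proof (intro conjI ballI; elim conjE)
  fix a :: "'a \<Rightarrow> complex" assume "\<forall>a\<in>roots d. diag_act a f = f" "a \<in> roots d"
  then have "cf (diag_act a f) w = cf f w" for w by simp
  then show "diag_act a (hom_part k f) = hom_part k f" by (intro cf_eqI) (simp add: cf_diag_act cf_hom_part)
next
  fix \<sigma> assume "\<forall>\<sigma>\<in>block_perms P. perm_act \<sigma> f = f" and \<sigma>: "\<sigma> \<in> block_perms P"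
  then have "cf (perm_act \<sigma> f) w = cf f w" for w by simp
  then show "perm_act \<sigma> (hom_part k f) = hom_part k f"
    by (intro cf_eqI) (simp add: cf_perm_act [OF block_perms_bij [OF \<sigma>]] cf_hom_part wt_comp [OF block_perms_bij [OF \<sigma>]])
qed

context
  fixes d :: nat
  assumes d: "d \<ge> 1"
begin

text \<open>On a given polynomial, the projection to a homogeneous component is a Lagrange polynomial in
  the Euler operator.\<close>

lemma hom_part_as_op: "\<exists>D\<in>inv_ops d P. D p = hom_part m p"
proof -
  define N where "N = Max (insert 0 (wt ` supp p))"
  define q where "q = (\<lambda>w :: 'a \<Rightarrow> nat. lag N m (\<Sum>i\<in>UNIV. of_nat (w i)))"
  have q: "q w = lag N m (of_nat (wt w))" for w by (simp add: q_def wt_def)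
  have "q \<in> polyfun" unfolding q_def by (intro lag_polyfun polyfun_sum polyfun.coord) simp
  then have "diag q \<in> inv_ops d P"
    by (rule inv_ops_diag [OF d]) (simp only: q wt_comp [OF block_perms_bij])
  moreover have "diag q p = hom_part m p"
  proof (rule cf_eqI)
    fix w
    show "cf (diag q p) w = cf (hom_part m p) w"
    proof (cases "w \<in> supp p")
      case True
      then have "wt w \<le> N" by (simp add: N_def)
      then show ?thesis by (simp add: q lag_eq cf_hom_part)
    qed (simp add: cf_hom_part supp_iff)
  qed
  ultimately show ?thesis by blast
qed

lemma op_submodule_hom_part: "op_submodule (inv_ops d P) N \<Longrightarrow> p \<in> N \<Longrightarrow> hom_part m p \<in> N"
  using hom_part_as_op [of P p m] op_submodule_op by metis

lemma op_submodule_scale: "op_submodule (inv_ops d P) N \<Longrightarrow> p \<in> N \<Longrightarrow> Cst c * p \<in> N"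
  using op_submodule_op [OF _ inv_ops_const [OF d]] by metis

text \<open>If the degree \<open>m\<close> part of a submodule over a smaller ring is the line spanned by \<open>v\<close>, then a
  nonzero element \<open>D v\<close> is led back to \<open>v\<close> by the adjoint of \<open>D\<close>, followed by the projection to
  degree \<open>m\<close>: what results is a multiple of \<open>v\<close>, and its inner product with \<open>v\<close> is the square
  norm of \<open>D v\<close>.\<close>

lemma cyclic_simple:
  assumes PQ: "block_perms P \<subseteq> block_perms Q" and N: "op_submodule (inv_ops d P) N"
    and v: "v \<in> N" "v \<noteq> 0" "hom_deg m v" and line: "\<And>u. u \<in> N \<Longrightarrow> \<exists>c. hom_part m u = Cst c * v"
  shows "op_simple (inv_ops d Q) {D v | D. D \<in> inv_ops d Q}"
  unfolding op_simple_def
proof (intro conjI allI impI)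
  show "op_submodule (inv_ops d Q) {D v | D. D \<in> inv_ops d Q}" by (rule inv_ops_submodule [OF d])
  show "{D v | D. D \<in> inv_ops d Q} \<noteq> {0}" using inv_ops_const [OF d, of 1] v(2) by force
  fix N' assume N': "op_submodule (inv_ops d Q) N'" "N' \<subseteq> {D v | D. D \<in> inv_ops d Q}"
  show "N' = {0} \<or> N' = {D v | D. D \<in> inv_ops d Q}"
  proof (cases "N' = {0}")
    case False
    then obtain y where y: "y \<in> N'" "y \<noteq> 0" using op_submodule_0 [OF N'(1)] by blast
    then obtain D where D: "D \<in> inv_ops d Q" "y = D v" using N'(2) by blast
    obtain E where E: "E \<in> inv_ops d Q" "adjoint_op D E" using inv_ops_adjoint [OF d D(1)] by blast
    have "E \<circ> D \<in> inv_ops d P"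
      using inv_ops_comp [OF d E(1) D(1)] inv_ops_antimono [OF d PQ] by blast
    then have "E y \<in> N" using op_submodule_op [OF N _ v(1)] D(2) by fastforce
    then obtain c where c: "hom_part m (E y) = Cst c * v" using line by blast
    have "ip (hom_part m (E y)) v = ip (E y) v" using v(3) by (rule ip_hom_part)
    also have "\<dots> = ip y y" using adjoint_op_sym [OF E(2)] by (simp add: adjoint_op_def D(2))
    finally have "c \<noteq> 0" using ip_self_nonzero [OF y(2)] c by auto
    have "E y \<in> N'" using op_submodule_op [OF N'(1) E(1) y(1)] .
    then have "Cst c * v \<in> N'" using op_submodule_hom_part [OF N'(1)] c by metis
    then have "v \<in> N'" using op_submodule_scale [OF N'(1), of "Cst c * v" "1 / c"] \<open>c \<noteq> 0\<close>
      by (simp add: Cst_inverse_cancel)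
    then show ?thesis using N'(2) op_submodule_op [OF N'(1)] by blast
  qed simp
qed

text \<open>In \<open>N = inv_polys d P * v\<close> an element with a component of degree above that of \<open>v\<close>, say
  \<open>f * v\<close> with \<open>f\<close> homogeneous of positive degree, is not killed by the adjoint of the
  multiplication by \<open>f\<close>, which has negative degree.\<close>

lemma killed_by_negative:
  assumes N: "N = {f * v | f. f \<in> inv_polys d P}" "op_submodule (inv_ops d P) N"
    and v: "hom_deg m v"
  shows "{y \<in> N. \<forall>D\<in>weyl_inv_neg (GP_mats d P). D y = 0} = {Cst c * v | c. True}"
proof (intro set_eqI iffI)
  fix y assume "y \<in> {y \<in> N. \<forall>D\<in>weyl_inv_neg (GP_mats d P). D y = 0}"
  then have yN: "y \<in> N" and kill: "\<And>D. D \<in> weyl_inv_neg (GP_mats d P) \<Longrightarrow> D y = 0" by auto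
  then obtain f where f: "f \<in> inv_polys d P" "y = f * v" using N(1) by blast
  have zero: "hom_part j y = 0" if "j \<noteq> m" for j
  proof (cases "j > m")
    case True
    define k where "k = j - m"
    have k: "k > 0" "hom_part j y = hom_part k f * v" using True by (auto simp: f(2) hom_part_mult [OF v] k_def)
    have mul: "(\<lambda>p. hom_part k f * p) \<in> inv_ops d P" "weyl_hom (int k) (\<lambda>p. hom_part k f * p)"
      using inv_ops_mult [OF d inv_polys_hom_part [OF f(1)]] weyl_hom_mult_op [OF hom_deg_hom_part [THEN bspec]]
      by auto
    from weyl_hom_adjoint [OF mul(2)] obtain E
      where E: "weyl_hom (- int k) E" "adjoint_op (\<lambda>p. hom_part k f * p) E" by blast
    have "E \<in> inv_ops d P" using inv_ops_adjointI [OF d mul(1) weyl_hom_weyl [OF E(1)] E(2)] .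
    then have "(\<lambda>p. \<Sum>j\<in>{- int k}. E p) \<in> weyl_inv_neg (GP_mats d P)"
      unfolding weyl_inv_neg_def using E(1) k(1)
      by (intro CollectI exI [of _ "{- int k}"] exI [of _ "\<lambda>_. E"]) auto
    then have "E y = 0" using kill by fastforce
    then have "ip (hom_part k f * v) y = 0" using E(2) by (simp add: adjoint_op_def)
    then have "ip y (hom_part j y) = 0" using ip_cnj [of y "hom_part j y"] k(2) by simp
    then have "ip (hom_part j y) (hom_part j y) = 0" using ip_hom_part [OF hom_deg_hom_part, of j y y] by simp
    then show ?thesis using ip_self_nonzero by blast
  next
    case False
    with that show ?thesis by (simp add: f(2) hom_part_mult [OF v])
  qed
  have "y = hom_part m y"
    by (rule cf_eqI) (metis cf_hom_part cf_zero zero)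
  also have "\<dots> = Cst (cf f (\<lambda>_. 0)) * v" by (simp add: f(2) hom_part_mult [OF v] hom_part_degree_0)
  finally show "y \<in> {Cst c * v | c. True}" by blast
next
  fix y assume "y \<in> {Cst c * v | c. True}"
  then obtain c where y: "y = Cst c * v" by blast
  have "Cst c \<in> inv_polys d P" by (simp add: inv_polys_iff)
  then have yN: "y \<in> N" using N(1) y by blast
  have hom: "hom_deg m y" using v by (auto simp: y supp_iff)
  have zero: "E y = 0" if E: "k < 0" "E \<in> inv_ops d P" "weyl_hom k E" for k E
  proof (rule ccontr)
    assume nz: "E y \<noteq> 0"
    then obtain w where w: "w \<in> supp (E y)" using exists_supp by blast
    then obtain u where "u \<in> supp y" "int (wt w) = int (wt u) + k" using weyl_hom_wt [OF E(3)] by blast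
    then have lt: "wt w < m" using hom E(1) by force
    have "E y \<in> N" using op_submodule_op [OF N(2) E(2) yN] .
    then obtain f where "E y = f * v" using N(1) by blast
    then have "hom_part (wt w) (E y) = 0" using lt by (simp add: hom_part_mult [OF v])
    then have "cf (E y) w = 0" by (metis cf_hom_part cf_zero)
    with w show False by (simp add: supp_iff)
  qed
  have "D y = 0" if D: "D \<in> weyl_inv_neg (GP_mats d P)" for D
  proof -
    obtain S E where DE: "D = (\<lambda>p. \<Sum>k\<in>S. E k p)"
      and E: "\<forall>k\<in>S. k < 0 \<and> E k \<in> inv_ops d P \<and> weyl_hom k (E k)"
      using D unfolding weyl_inv_neg_def by blast
    have "E k y = 0" if "k \<in> S" for k using E that zero by blast
    then show ?thesis by (simp add: DE)
  qed
  with yN show "y \<in> {y \<in> N. \<forall>D\<in>weyl_inv_neg (GP_mats d P). D y = 0}" by blast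
qed

lemma op_gen_line: "op_gen (inv_ops d P) {Cst c * v | c. True} = {D v | D. D \<in> inv_ops d P}"
proof (intro set_eqI iffI)
  fix x assume "x \<in> op_gen (inv_ops d P) {Cst c * v | c. True}"
  then obtain F D where F: "F \<subseteq> {Cst c * v | c. True}" "\<forall>y\<in>F. D y \<in> inv_ops d P" "x = (\<Sum>y\<in>F. D y y)"
    unfolding op_gen_def by blast
  show "x \<in> {D v | D. D \<in> inv_ops d P}"
    unfolding F(3)
  proof (rule op_submodule_sum [OF inv_ops_submodule [OF d]])
    fix y assume y: "y \<in> F"
    then obtain c where "y = Cst c * v" using F(1) by blast
    moreover have "D y \<circ> (\<lambda>p. Cst c * p) \<in> inv_ops d P"
      using F(2) y by (intro inv_ops_comp [OF d] inv_ops_const [OF d]) blast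
    ultimately show "D y y \<in> {D v | D. D \<in> inv_ops d P}"
      by (intro CollectI exI [of _ "D y \<circ> (\<lambda>p. Cst c * p)"]) simp
  qed
next
  fix x assume "x \<in> {D v | D. D \<in> inv_ops d P}"
  then obtain D where "D \<in> inv_ops d P" "x = D v" by blast
  moreover have "v \<in> {Cst c * v | c. True}" by (rule CollectI, rule exI [of _ 1]) simp
  ultimately show "x \<in> op_gen (inv_ops d P) {Cst c * v | c. True}"
    unfolding op_gen_def by (intro CollectI exI [of _ "{v}"] exI [of _ "\<lambda>_. D"]) simp
qed

lemma op_gen_single: "op_gen (inv_ops d P) {v} = {D v | D. D \<in> inv_ops d P}"
proof (intro set_eqI iffI)
  fix x assume "x \<in> op_gen (inv_ops d P) {v}"
  then have "x \<in> op_gen (inv_ops d P) {Cst c * v | c. True}"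
    unfolding op_gen_def by (fastforce intro: exI [of _ 1])
  then show "x \<in> {D v | D. D \<in> inv_ops d P}" by (simp only: op_gen_line)
next
  fix x assume "x \<in> {D v | D. D \<in> inv_ops d P}"
  then obtain D where "D \<in> inv_ops d P" "x = D v" by blast
  then show "x \<in> op_gen (inv_ops d P) {v}"
    unfolding op_gen_def by (intro CollectI exI [of _ "{v}"] exI [of _ "\<lambda>_. D"]) simp
qed

end

section \<open>Semi-invariants\<close>

abbreviation sgn_poly :: "('n \<Rightarrow> 'n) \<Rightarrow> 'n::finite cpoly" where
  "sgn_poly \<sigma> \<equiv> Cst (of_int (sign \<sigma>))"

definition Semi :: "nat \<Rightarrow> ('n::finite \<Rightarrow> nat) \<Rightarrow> 'n set set \<Rightarrow> 'n cpoly set" where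
  "Semi d \<alpha> P = {p. (\<forall>w\<in>supp p. \<forall>i. w i mod d = \<alpha> i) \<and>
     (\<forall>\<sigma>\<in>block_perms P. perm_act \<sigma> p = sgn_poly \<sigma> * p)}"

lemma Semi_residue: "p \<in> Semi d \<alpha> P \<Longrightarrow> w \<in> supp p \<Longrightarrow> w i mod d = \<alpha> i"
  by (auto simp: Semi_def)

lemma Semi_perm_act: "p \<in> Semi d \<alpha> P \<Longrightarrow> \<sigma> \<in> block_perms P \<Longrightarrow> perm_act \<sigma> p = sgn_poly \<sigma> * p"
  by (auto simp: Semi_def)

lemma Semi_cf:
  assumes "p \<in> Semi d \<alpha> P" "\<sigma> \<in> block_perms P"
  shows "cf p (w \<circ> \<sigma>) = of_int (sign \<sigma>) * cf p w"
proof -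
  have "cf p (w \<circ> \<sigma>) = cf (perm_act \<sigma> p) w" by (simp add: cf_perm_act [OF block_perms_bij [OF assms(2)]])
  then show ?thesis by (simp add: Semi_perm_act [OF assms])
qed

lemma root_power_mod: "a \<in> roots d \<Longrightarrow> a i ^ k = a i ^ (k mod d)"
proof -
  assume "a \<in> roots d"
  then have "(a i ^ d) ^ (k div d) * a i ^ (k mod d) = a i ^ (k mod d)" by (simp add: roots_def)
  then show ?thesis by (metis div_mult_mod_eq mult.commute power_add power_mult)
qed

text \<open>A primitive root of unity in one coordinate detects the residue of the exponent there.\<close>

lemma residue_iff_diag_act:
  fixes \<alpha> :: "'n::finite \<Rightarrow> nat"
  assumes d: "d \<ge> 1" and \<alpha>: "multi_index d \<alpha>"
  shows "(\<forall>w\<in>supp p. \<forall>i. w i mod d = \<alpha> i) \<longleftrightarrow>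
    (\<forall>a\<in>roots d. diag_act a p = Cst (\<Prod>i\<in>UNIV. a i ^ \<alpha> i) * p)" (is "?L \<longleftrightarrow> ?R")
proof
  assume L: ?L
  show ?R
  proof (intro ballI cf_eqI)
    fix a :: "'n \<Rightarrow> complex" and w assume a: "a \<in> roots d"
    have "(\<Prod>i\<in>UNIV. a i ^ w i) = (\<Prod>i\<in>UNIV. a i ^ \<alpha> i)" if "w \<in> supp p"
      using L that by (intro prod.cong [OF refl]) (metis root_power_mod [OF a])
    then show "cf (diag_act a p) w = cf (Cst (\<Prod>i\<in>UNIV. a i ^ \<alpha> i) * p) w"
      by (cases "w \<in> supp p") (auto simp: cf_diag_act supp_iff)
  qed
next
  assume R: ?R
  show ?L
  proof (intro ballI allI)
    fix w and i :: 'n assume w: "w \<in> supp p"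
    define z where "z = exp (2 * of_real pi * \<i> / of_nat d)"
    define a where "a = (\<lambda>j. if j = i then z else 1)"
    have pow: "z ^ k = exp (2 * of_real pi * \<i> * of_nat k / of_nat d)" for k
      by (simp add: z_def exp_of_nat_mult [symmetric] mult_ac)
    have "z ^ d = 1" using d by (simp add: pow exp_eq_1)
    then have "a \<in> roots d" by (simp add: roots_def a_def)
    moreover have "(\<Prod>j\<in>UNIV. a j ^ u j) = z ^ u i" for u :: "'n \<Rightarrow> nat"
    proof -
      have "(\<Prod>j\<in>UNIV. a j ^ u j) = (\<Prod>j\<in>UNIV. if j = i then z ^ u j else 1)"
        by (rule prod.cong) (auto simp: a_def)
      then show ?thesis by simp
    qed
    ultimately have "diag_act a p = Cst (z ^ \<alpha> i) * p" and "cf (diag_act a p) w = z ^ w i * cf p w"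
      using R unfolding cf_diag_act by metis+
    then have "z ^ w i * cf p w = z ^ \<alpha> i * cf p w" by (metis cf_Cst_mult)
    then have "z ^ w i = z ^ \<alpha> i" using w by (simp add: supp_iff)
    then have "w i mod d = \<alpha> i mod d" unfolding pow complex_root_unity_eq [OF d] .
    then show "w i mod d = \<alpha> i" using \<alpha> by (simp add: multi_index_def)
  qed
qed

lemma Semi_submodule:
  assumes d: "d \<ge> 1" and \<alpha>: "multi_index d \<alpha>"
  shows "op_submodule (inv_ops d P) (Semi d \<alpha> P)"
  unfolding op_submodule_def
proof (intro conjI ballI)
  show "0 \<in> Semi d \<alpha> P" by (simp add: Semi_def supp_eq_image)
next
  fix x y assume x: "x \<in> Semi d \<alpha> P" and y: "y \<in> Semi d \<alpha> P"
  have "w \<in> supp x \<or> w \<in> supp y" if "w \<in> supp (x - y)" for w using that by (auto simp: supp_iff)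
  moreover have "perm_act \<sigma> (x - y) = sgn_poly \<sigma> * (x - y)" if "\<sigma> \<in> block_perms P" for \<sigma>
    using perm_act_add [of \<sigma> x "- y"] Semi_perm_act [OF x that] Semi_perm_act [OF y that]
    by (simp add: perm_act_uminus right_diff_distrib)
  ultimately show "x - y \<in> Semi d \<alpha> P"
    using Semi_residue [OF x] Semi_residue [OF y] unfolding Semi_def by blast
next
  fix D x assume D: "D \<in> inv_ops d P" and x: "x \<in> Semi d \<alpha> P"
  note lin = weyl_linear(2) [OF inv_ops_weyl [OF D]]
  have "diag_act a (D x) = Cst (\<Prod>i\<in>UNIV. a i ^ \<alpha> i) * D x" if a: "a \<in> roots d" for a
  proof -
    have "diag_act a x = Cst (\<Prod>i\<in>UNIV. a i ^ \<alpha> i) * x"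
      using x a residue_iff_diag_act [OF d \<alpha>, of x] unfolding Semi_def by blast
    then show ?thesis using D a by (metis inv_ops_iff [OF d] lin)
  qed
  then have "\<forall>w\<in>supp (D x). \<forall>i. w i mod d = \<alpha> i" using residue_iff_diag_act [OF d \<alpha>] by blast
  moreover have "perm_act \<sigma> (D x) = sgn_poly \<sigma> * D x" if \<sigma>: "\<sigma> \<in> block_perms P" for \<sigma>
    using Semi_perm_act [OF x \<sigma>] D \<sigma> by (metis inv_ops_iff [OF d] lin)
  ultimately show "D x \<in> Semi d \<alpha> P" by (simp add: Semi_def)
qed

lemma dpow_sum: "dpow d (sum f S) = (\<Sum>x\<in>S. dpow d (f x))"
  by (simp add: dpow_def poly_subst_sum)

text \<open>Polynomials on which the diagonal group acts by \<open>\<alpha>\<close> have exponents congruent to \<open>\<alpha>\<close>, and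
  since \<open>\<alpha>\<close> is below \<open>d\<close> the quotient by \<open>xmon \<alpha>\<close> is a polynomial in the \<open>d\<close>-th powers.\<close>

lemma residue_factor:
  assumes "\<forall>w\<in>supp p. \<forall>i. w i mod d = \<alpha> i"
  shows "\<exists>q. p = xmon \<alpha> * dpow d q"
proof -
  have "xmon \<alpha> * (Cst (cf p w) * xmon (\<lambda>i. d * (w i div d))) = Cst (cf p w) * xmon w" if "w \<in> supp p" for w
  proof -
    have "(\<lambda>i. \<alpha> i + d * (w i div d)) = w"
    proof
      fix i
      have "w i mod d = \<alpha> i" using assms that by blast
      then show "\<alpha> i + d * (w i div d) = w i" using mult_div_mod_eq [of d "w i"] by simp
    qed
    then show ?thesis by (simp add: mult.left_commute [of "xmon \<alpha>"] xmon_mult)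
  qed
  then have "(\<Sum>w\<in>supp p. Cst (cf p w) * xmon w) =
      xmon \<alpha> * dpow d (\<Sum>w\<in>supp p. Cst (cf p w) * xmon (\<lambda>i. w i div d))"
    by (simp add: dpow_sum dpow_scale dpow_xmon sum_distrib_left)
  then show ?thesis unfolding poly_expand [of p, symmetric] by (rule exI)
qed

lemma dpow_supp: "d \<ge> 1 \<Longrightarrow> w \<in> supp (dpow d p) \<Longrightarrow> d dvd w i"
  by (auto simp: supp_iff cf_dpow split: if_splits)

lemma residue_product:
  assumes d: "d \<ge> 1" and \<alpha>: "multi_index d \<alpha>" and w: "w \<in> supp (xmon \<alpha> * dpow d q)"
  shows "w i mod d = \<alpha> i"
proof -
  obtain u v where u: "u \<in> supp (xmon \<alpha>)" and v: "v \<in> supp (dpow d q)" and uv: "w = (\<lambda>i. u i + v i)"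
    using supp_mult [OF w] by blast
  have "u = \<alpha>" using u by (auto simp: supp_iff cf_xmon split: if_splits)
  moreover have "v i mod d = 0" using dpow_supp [OF d v] by simp
  ultimately show ?thesis using \<alpha> mod_add_right_eq [of "u i" "v i" d] by (simp add: uv multi_index_def)
qed

lemma diag_act_dpow: "d \<ge> 1 \<Longrightarrow> a \<in> roots d \<Longrightarrow> diag_act a (dpow d p) = dpow d p"
  using residue_iff_diag_act [of d "\<lambda>_. 0" "dpow d p"] dpow_supp by (fastforce simp: multi_index_def)

lemma N_alpha_eq_Semi:
  assumes d: "d \<ge> 1" and \<alpha>: "multi_index d \<alpha>"
  shows "N_alpha d \<alpha> = Semi d \<alpha> singles"
proof (intro set_eqI iffI)
  fix p assume "p \<in> N_alpha d \<alpha>"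
  then obtain f where f: "p = f * xmon \<alpha>" "f \<in> inv_polys d singles"
    unfolding N_alpha_def A_mats_eq xpow_eq_xmon by blast
  then have "\<forall>a\<in>roots d. diag_act a f = Cst (\<Prod>i\<in>UNIV. a i ^ 0) * f" by (simp add: inv_polys_iff)
  then have "\<forall>w\<in>supp f. \<forall>i. w i mod d = 0"
    using residue_iff_diag_act [OF d, of "\<lambda>_. 0" f] d by (simp add: multi_index_def)
  from residue_factor [OF this] obtain q where "f = dpow d q" by (auto simp: xmon_0)
  then show "p \<in> Semi d \<alpha> singles"
    using residue_product [OF d \<alpha>, of _ q] by (simp add: Semi_def block_perms_singles f(1) mult.commute sign_id)
next
  fix p assume "p \<in> Semi d \<alpha> singles"
  then obtain q where "p = xmon \<alpha> * dpow d q" using residue_factor [of p d \<alpha>] by (auto simp: Semi_def)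
  moreover have "dpow d q \<in> inv_polys d singles"
    by (simp add: inv_polys_iff block_perms_singles diag_act_dpow [OF d])
  ultimately show "p \<in> N_alpha d \<alpha>"
    unfolding N_alpha_def A_mats_eq xpow_eq_xmon
    by (intro CollectI exI [of _ "dpow d q"]) (simp add: mult.commute)
qed

section \<open>Alternants\<close>

definition same_block :: "'n set set \<Rightarrow> 'n \<Rightarrow> 'n \<Rightarrow> bool" where
  "same_block P i j \<longleftrightarrow> (\<exists>\<Omega>\<in>P. i \<in> \<Omega> \<and> j \<in> \<Omega>)"

definition alt :: "'n::finite set set \<Rightarrow> ('n \<Rightarrow> nat) \<Rightarrow> 'n cpoly" where
  "alt P \<mu> = det (\<chi> i j. if same_block P i j then X j ^ \<mu> i else 0)"

lemma finite_block_perms [simp]: "finite (block_perms (P :: 'n::finite set set))"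
  unfolding block_perms_def by (rule finite_subset [OF _ finite_permutations [of "UNIV :: 'n set"]]) auto

lemma block_unique:
  "partition_on UNIV P \<Longrightarrow> \<Omega> \<in> P \<Longrightarrow> \<Omega>' \<in> P \<Longrightarrow> i \<in> \<Omega> \<Longrightarrow> i \<in> \<Omega>' \<Longrightarrow> \<Omega> = \<Omega>'"
  by (meson disjointD disjoint_iff partition_onD2)

lemma block_perms_iff_same_block:
  fixes P :: "'n::finite set set"
  assumes P: "partition_on UNIV P" and \<sigma>: "\<sigma> permutes UNIV"
  shows "\<sigma> \<in> block_perms P \<longleftrightarrow> (\<forall>i. same_block P i (\<sigma> i))"
proof
  assume S: "\<sigma> \<in> block_perms P"
  show "\<forall>i. same_block P i (\<sigma> i)"
  proof
    fix i
    obtain \<Omega> where "\<Omega> \<in> P" "i \<in> \<Omega>" using partition_onD1 [OF P] by blast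
    moreover from this have "\<sigma> i \<in> \<Omega>" using S unfolding block_perms_def by blast
    ultimately show "same_block P i (\<sigma> i)" by (auto simp: same_block_def)
  qed
next
  assume S: "\<forall>i. same_block P i (\<sigma> i)"
  have "\<sigma> ` \<Omega> = \<Omega>" if \<Omega>: "\<Omega> \<in> P" for \<Omega>
  proof (rule card_subset_eq)
    show "\<sigma> ` \<Omega> \<subseteq> \<Omega>"
    proof
      fix y assume "y \<in> \<sigma> ` \<Omega>"
      then obtain i where i: "i \<in> \<Omega>" "y = \<sigma> i" by blast
      obtain \<Omega>' where "\<Omega>' \<in> P" "i \<in> \<Omega>'" "\<sigma> i \<in> \<Omega>'" using S by (auto simp: same_block_def)
      moreover from this have "\<Omega>' = \<Omega>"
        using block_unique [OF P] i(1) \<Omega> by blast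
      ultimately show "y \<in> \<Omega>" using i(2) by simp
    qed
    show "card (\<sigma> ` \<Omega>) = card \<Omega>"
      by (rule card_image) (metis \<sigma> inj_on_subset permutes_inj subset_UNIV)
  qed simp
  then show "\<sigma> \<in> block_perms P" using \<sigma> by (simp add: block_perms_def)
qed

lemma alt_expand:
  fixes P :: "'n::finite set set"
  assumes P: "partition_on UNIV P"
  shows "alt P \<mu> = (\<Sum>\<sigma>\<in>block_perms P. sgn_poly \<sigma> * perm_act \<sigma> (xmon \<mu>))"
proof -
  have "(\<Prod>i\<in>UNIV. if same_block P i (\<sigma> i) then X (\<sigma> i) ^ \<mu> i else 0) =
      (if \<sigma> \<in> block_perms P then perm_act \<sigma> (xmon \<mu>) else 0)" if "\<sigma> permutes UNIV" for \<sigma>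
  proof (cases "\<sigma> \<in> block_perms P")
    case True
    then show ?thesis
      using block_perms_iff_same_block [OF P that] by (simp add: perm_act_def poly_subst_xmon)
  next
    case False
    then obtain i where "\<not> same_block P i (\<sigma> i)"
      using block_perms_iff_same_block [OF P \<open>\<sigma> permutes UNIV\<close>] by blast
    then have "(\<Prod>i\<in>UNIV. if same_block P i (\<sigma> i) then X (\<sigma> i) ^ \<mu> i else (0 :: 'n cpoly)) = 0"
      by (intro prod_zero) auto
    with False show ?thesis by simp
  qed
  then have "alt P \<mu> = (\<Sum>\<sigma>\<in>{\<sigma>. \<sigma> permutes UNIV}.
      if \<sigma> \<in> block_perms P then sgn_poly \<sigma> * perm_act \<sigma> (xmon \<mu>) else 0)"
    unfolding alt_def det_def by (intro sum.cong) (auto simp: Cst_of_int)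
  also have "\<dots> = (\<Sum>\<sigma>\<in>{\<sigma>. \<sigma> permutes UNIV} \<inter> block_perms P. sgn_poly \<sigma> * perm_act \<sigma> (xmon \<mu>))"
    by (rule sum.inter_restrict [symmetric]) (simp add: finite_permutations)
  also have "{\<sigma>. \<sigma> permutes UNIV} \<inter> block_perms P = block_perms P" by (auto simp: block_perms_def)
  finally show ?thesis .
qed

text \<open>Antisymmetrizing multiplies \<open>p\<close> by the order of the group, and each of its monomials becomes an
  alternant.\<close>

lemma antisym_alt:
  assumes P: "partition_on UNIV P"
    and anti: "\<And>\<sigma>. \<sigma> \<in> block_perms P \<Longrightarrow> perm_act \<sigma> p = sgn_poly \<sigma> * p"
  shows "Cst (of_nat (card (block_perms P))) * p = (\<Sum>w\<in>supp p. Cst (cf p w) * alt P w)"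
proof -
  have "(\<Sum>w\<in>supp p. Cst (cf p w) * alt P w) =
      (\<Sum>w\<in>supp p. \<Sum>\<sigma>\<in>block_perms P. sgn_poly \<sigma> * perm_act \<sigma> (Cst (cf p w) * xmon w))"
    by (simp add: alt_expand [OF P] sum_distrib_left perm_act_mult mult.left_commute)
  also have "\<dots> = (\<Sum>\<sigma>\<in>block_perms P. sgn_poly \<sigma> * perm_act \<sigma> (\<Sum>w\<in>supp p. Cst (cf p w) * xmon w))"
    by (subst sum.swap) (simp add: perm_act_sum sum_distrib_left)
  also have "\<dots> = (\<Sum>\<sigma>\<in>block_perms P. sgn_poly \<sigma> * perm_act \<sigma> p)"
    by (simp flip: poly_expand)
  also have "\<dots> = (\<Sum>\<sigma>\<in>block_perms P. p)"
    by (rule sum.cong)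
       (simp_all add: anti mult.assoc [symmetric] Cst_mult [symmetric] of_int_mult [symmetric] sign_idempotent)
  also have "\<dots> = Cst (of_nat (card (block_perms P))) * p"
    by (simp add: Cst_def)
  finally show ?thesis by simp
qed

lemma alt_antisym:
  assumes P: "partition_on UNIV P" and \<tau>: "\<tau> \<in> block_perms P"
  shows "perm_act \<tau> (alt P \<mu>) = sgn_poly \<tau> * alt P \<mu>"
proof -
  have perm: "permutation \<sigma>" if "\<sigma> \<in> block_perms P" for \<sigma>
    using that by (auto simp: block_perms_def permutation_permutes)
  have sgn: "sign \<sigma> = sign \<tau> * sign (\<tau> \<circ> \<sigma>)" if "\<sigma> \<in> block_perms P" for \<sigma>
    using sign_compose [OF perm [OF \<tau>] perm [OF that]] sign_idempotent [of \<tau>]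
    by (simp add: mult.assoc [symmetric])
  have bij: "bij_betw (\<lambda>\<sigma>. \<tau> \<circ> \<sigma>) (block_perms P) (block_perms P)"
  proof (rule bij_betw_byWitness [where f' = "\<lambda>\<sigma>. inv \<tau> \<circ> \<sigma>"])
    show "\<forall>\<sigma>\<in>block_perms P. inv \<tau> \<circ> (\<tau> \<circ> \<sigma>) = \<sigma>" "\<forall>\<sigma>\<in>block_perms P. \<tau> \<circ> (inv \<tau> \<circ> \<sigma>) = \<sigma>"
      using block_perms_bij [OF \<tau>] by (auto simp: fun_eq_iff bij_is_inj bij_is_surj surj_f_inv_f)
  qed (use comp_block_perms \<tau> inv_block_perms in blast)+
  have "perm_act \<tau> (alt P \<mu>) = (\<Sum>\<sigma>\<in>block_perms P. sgn_poly \<sigma> * perm_act (\<tau> \<circ> \<sigma>) (xmon \<mu>))"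
    by (simp add: alt_expand [OF P] perm_act_sum perm_act_mult perm_act_comp)
  also have "\<dots> = (\<Sum>\<sigma>\<in>block_perms P. sgn_poly \<tau> *
      (sgn_poly (\<tau> \<circ> \<sigma>) * perm_act (\<tau> \<circ> \<sigma>) (xmon \<mu>)))"
    by (rule sum.cong [OF refl]) (subst sgn, simp_all add: Cst_mult mult.assoc del: comp_apply)
  also have "\<dots> = sgn_poly \<tau> * alt P \<mu>"
    unfolding alt_expand [OF P] sum_distrib_left [symmetric]
    by (subst sum.reindex_bij_betw [OF bij, where g = "\<lambda>\<sigma>. sgn_poly \<sigma> * perm_act \<sigma> (xmon \<mu>)"]) simp
  finally show ?thesis .
qed

text \<open>Only the identity fixes \<open>r\<close>, when \<open>r\<close> is injective on blocks, so no terms of the expansion cancel.\<close>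

lemma cf_alt:
  fixes P :: "'n::finite set set"
  assumes P: "partition_on UNIV P" and r: "\<And>\<Omega>. \<Omega> \<in> P \<Longrightarrow> inj_on r \<Omega>"
  shows "cf (alt P r) r = 1"
proof -
  have "cf (sgn_poly \<sigma> * perm_act \<sigma> (xmon r)) r = (if \<sigma> = id then 1 else 0)" if \<sigma>: "\<sigma> \<in> block_perms P" for \<sigma>
  proof (cases "r = r \<circ> \<sigma>")
    case True
    have "\<sigma> i = i" for i
    proof -
      have "\<sigma> permutes UNIV" using \<sigma> by (simp add: block_perms_def)
      with \<sigma> have "same_block P i (\<sigma> i)" using block_perms_iff_same_block [OF P] by blast
      then obtain \<Omega> where "\<Omega> \<in> P" "i \<in> \<Omega>" "\<sigma> i \<in> \<Omega>" by (auto simp: same_block_def)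
      moreover have "r (\<sigma> i) = r i" using fun_cong [OF True, of i] by simp
      ultimately show ?thesis using r by (meson inj_onD)
    qed
    then have "\<sigma> = id" by auto
    then show ?thesis by (simp add: cf_xmon sign_id)
  next
    case False
    then have "\<sigma> \<noteq> id" by auto
    with False show ?thesis by (auto simp: cf_perm_act [OF block_perms_bij [OF \<sigma>]] cf_xmon)
  qed
  then have "cf (alt P r) r = (\<Sum>\<sigma>\<in>block_perms P. if \<sigma> = id then 1 else 0)"
    unfolding alt_expand [OF P] cf_sum by (rule sum.cong [OF refl])
  then show ?thesis by (simp add: id_block_perms)
qed

section \<open>The Jacobian\<close>

definition jac :: "('n::finite \<Rightarrow> 'n cpoly) \<Rightarrow> 'n cpoly" where
  "jac F = det (\<chi> i j. pdiff j (F i))"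

lemma jac_poly_subst: "jac (\<lambda>i. poly_subst F (H i)) = poly_subst F (jac H) * jac F"
proof -
  have "(\<chi> i j. pdiff j (poly_subst F (H i))) =
      (\<chi> i k. poly_subst F (pdiff k (H i))) ** (\<chi> k j. pdiff j (F k))"
    by (simp add: matrix_matrix_mult_def pdiff_poly_subst vec_eq_iff)
  then show ?thesis by (simp add: jac_def det_mul poly_subst_det)
qed

definition psum :: "'n::finite set set \<Rightarrow> nat \<Rightarrow> 'n \<Rightarrow> 'n cpoly" where
  "psum P k i = (\<Sum>j | same_block P i j. X j ^ (k + 1))"

lemma pdiff_X_power: "pdiff j (X l ^ Suc k :: 'n::finite cpoly) = (if l = j then Cst (of_nat (k + 1)) * X j ^ k else 0)"
proof (induct k)
  case 0
  then show ?case by (simp add: pdiff_X)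
next
  case (Suc k)
  have "pdiff j (X l ^ Suc (Suc k) :: 'n cpoly) = pdiff j (X l * X l ^ Suc k)" by simp
  also have "\<dots> = (if l = j then Cst (of_nat (Suc k + 1)) * X j ^ Suc k else 0)"
  proof -
    have c: "Cst (of_nat (Suc k + 1)) = 1 + (Cst (of_nat (k + 1)) :: 'n cpoly)"
      by (simp flip: Cst_add Cst_1)
    show ?thesis unfolding pdiff_X_mult Suc c by (simp add: distrib_left distrib_right mult.left_commute)
  qed
  finally show ?case .
qed

text \<open>Every alternant is obtained, as the exponents \<open>\<mu>\<close> of the rows are arbitrary.\<close>

lemma jac_psum: "jac (\<lambda>i. psum P (\<mu> i) i) = (\<Prod>i\<in>UNIV. Cst (of_nat (\<mu> i + 1))) * alt P \<mu>"
proof -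
  have "pdiff j (psum P (\<mu> i) i) = Cst (of_nat (\<mu> i + 1)) * (if same_block P i j then X j ^ \<mu> i else 0)" for i j
  proof -
    have "pdiff j (psum P (\<mu> i) i) =
        (\<Sum>l | same_block P i l. if l = j then Cst (of_nat (\<mu> i + 1)) * X j ^ \<mu> i else 0)"
      unfolding psum_def pdiff_sum by (intro sum.cong [OF refl]) (simp only: pdiff_X_power Suc_eq_plus1 [symmetric])
    then show ?thesis by simp
  qed
  then have "(\<chi> i j. pdiff j (psum P (\<mu> i) i)) =
      (\<chi> i. Cst (of_nat (\<mu> i + 1)) *s (\<chi> j. if same_block P i j then X j ^ \<mu> i else 0))"
    by (simp add: vec_eq_iff vector_scalar_mult_def)
  then show ?thesis unfolding jac_def alt_def by (simp only: det_rows_mul)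
qed

lemma perm_act_psum:
  assumes P: "partition_on UNIV P" and \<sigma>: "\<sigma> \<in> block_perms P"
  shows "perm_act \<sigma> (psum P k i) = psum P k i"
proof -
  have step: "same_block P i (\<tau> j)" if "same_block P i j" "\<tau> \<in> block_perms P" for j \<tau>
    using that unfolding block_perms_def same_block_def by blast
  have "bij_betw \<sigma> {j. same_block P i j} {j. same_block P i j}"
  proof (rule bij_betw_byWitness [where f' = "inv \<sigma>"])
    show "\<forall>j\<in>{j. same_block P i j}. inv \<sigma> (\<sigma> j) = j" "\<forall>j\<in>{j. same_block P i j}. \<sigma> (inv \<sigma> j) = j"
      using block_perms_bij [OF \<sigma>] by (auto simp: bij_is_inj bij_is_surj surj_f_inv_f)
  qed (use step \<sigma> inv_block_perms [OF \<sigma>] in auto)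
  then have "psum P k i = (\<Sum>j | same_block P i j. X (\<sigma> j) ^ (k + 1))"
    unfolding psum_def by (rule sum.reindex_bij_betw [symmetric])
  then show ?thesis
    unfolding psum_def perm_act_sum by (simp add: perm_act_def poly_subst_mult poly_subst_power)
qed

lemma hom_deg_prod:
  "finite S \<Longrightarrow> (\<And>i. i \<in> S \<Longrightarrow> hom_deg (e i) (f i)) \<Longrightarrow> hom_deg (sum e S) (prod f S)"
proof (induct S rule: finite_induct)
  case empty
  have "wt w = 0" if "w \<in> supp (xmon (\<lambda>_. 0))" for w :: "'b \<Rightarrow> nat"
    using that by (auto simp: supp_iff cf_xmon wt_def split: if_splits)
  then show ?case by (simp add: xmon_0)
next
  case (insert x S)
  have "hom_deg (e x + sum e S) (f x * prod f S)"
    using insert.prems insert.hyps by (intro hom_deg_mult) blast+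
  then show ?case using insert.hyps(1,2) by (simp only: sum.insert prod.insert not_False_eq_True)
qed

lemma hom_deg_sum: "(\<And>i. i \<in> S \<Longrightarrow> hom_deg m (f i)) \<Longrightarrow> hom_deg m (sum f S)"
proof -
  assume f: "\<And>i. i \<in> S \<Longrightarrow> hom_deg m (f i)"
  have "\<exists>i\<in>S. w \<in> supp (f i)" if "w \<in> supp (sum f S)" for w
  proof (rule ccontr)
    assume "\<not> ?thesis"
    then have "(\<Sum>i\<in>S. cf (f i) w) = 0" by (intro sum.neutral) (auto simp: supp_iff)
    with that show False by (simp add: supp_iff)
  qed
  with f show ?thesis by blast
qed

lemma hom_deg_scale: "hom_deg m p \<Longrightarrow> hom_deg m (Cst c * p)"
  by (auto simp: supp_iff)

text \<open>What is needed from a Jacobian \<open>s = dpow d (jac F)\<close>.  Every family of invariants is obtained by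
  substituting the generators \<open>F\<close> into polynomials, so its Jacobian is divisible by \<open>jac F\<close>, by the
  chain rule.  Applied to power sums this shows that \<open>jac F\<close> divides all alternants, and with them
  all antisymmetric polynomials.  By the chain rule for a permutation it is itself antisymmetric.\<close>

lemma is_jacobian_properties:
  fixes P :: "'n::finite set set"
  assumes d: "d \<ge> 1" and P: "partition_on UNIV P" and jacobian: "is_jacobian d P s"
  obtains t where "s = dpow d t"
    and "\<And>\<sigma>. \<sigma> \<in> block_perms P \<Longrightarrow> perm_act \<sigma> t = sgn_poly \<sigma> * t"
    and "\<exists>m. hom_deg m s"
    and "\<And>p. \<forall>\<sigma>\<in>block_perms P. perm_act \<sigma> p = sgn_poly \<sigma> * p \<Longrightarrow>
      \<exists>q. p = q * t \<and> dpow d q \<in> inv_polys d P"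
proof -
  obtain F :: "'n \<Rightarrow> 'n cpoly" where hom: "\<And>i. homogeneous (dpow d (F i))"
    and range: "range (poly_subst (\<lambda>i. dpow d (F i))) = inv_polys d P"
    and s: "s = det (\<chi> i j. dpow d (pdiff j (F i)))"
    using jacobian unfolding is_jacobian_def by blast
  have s_jac: "s = dpow d (jac F)" by (simp add: s jac_def dpow_det)
  have F_inv: "perm_act \<sigma> (F i) = F i" if \<sigma>: "\<sigma> \<in> block_perms P" for \<sigma> i
  proof -
    have "poly_subst (\<lambda>i. dpow d (F i)) (X i) \<in> inv_polys d P" using range by blast
    then have "dpow d (perm_act \<sigma> (F i)) = dpow d (F i)" using \<sigma> by (simp add: inv_polys_iff perm_act_dpow)
    then show ?thesis by (rule dpow_inj [OF d])
  qed
  have anti: "perm_act \<sigma> (jac F) = sgn_poly \<sigma> * jac F" if \<sigma>: "\<sigma> \<in> block_perms P" for \<sigma>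
  proof -
    have "perm_act \<sigma> (jac F) = det (\<chi> i j. perm_act \<sigma> (pdiff j (F i)))"
      by (simp add: jac_def perm_act_def poly_subst_det)
    also have "\<dots> = det (\<chi> i j. (\<chi> i j. pdiff j (F i)) $ i $ \<sigma> j)"
      by (simp add: perm_act_pdiff [OF block_perms_bij [OF \<sigma>]] F_inv [OF \<sigma>])
    also have "\<dots> = of_int (sign \<sigma>) * jac F"
      unfolding jac_def by (rule det_permute_columns) (use \<sigma> in \<open>simp add: block_perms_def\<close>)
    finally show ?thesis by (simp add: Cst_of_int)
  qed
  have gen: "\<exists>H. g = poly_subst F H" if "\<And>\<sigma>. \<sigma> \<in> block_perms P \<Longrightarrow> perm_act \<sigma> g = g" for g
  proof -
    have "dpow d g \<in> inv_polys d P"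
      using that by (simp add: inv_polys_iff diag_act_dpow [OF d] perm_act_dpow)
    then obtain H where "dpow d g = poly_subst (\<lambda>i. dpow d (F i)) H" using range by blast
    then have "dpow d g = dpow d (poly_subst F H)" by (simp add: dpow_poly_subst)
    then show ?thesis using dpow_inj [OF d] by blast
  qed
  have alt_div: "\<exists>q. alt P \<mu> = poly_subst F q * jac F" for \<mu>
  proof -
    have "\<exists>H. psum P (\<mu> i) i = poly_subst F H" for i
      by (rule gen) (rule perm_act_psum [OF P])
    then obtain H where "\<And>i. psum P (\<mu> i) i = poly_subst F (H i)" by metis
    then have eq: "(\<Prod>i\<in>UNIV. Cst (of_nat (\<mu> i + 1))) * alt P \<mu> = poly_subst F (jac H) * jac F"
      by (simp only: jac_psum [symmetric] jac_poly_subst [symmetric])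
    define c :: complex where "c = (\<Prod>i\<in>UNIV. of_nat (\<mu> i + 1))"
    have "c \<noteq> 0" by (simp add: c_def del: of_nat_add of_nat_Suc)
    have "alt P \<mu> = Cst (1 / c) * (Cst c * alt P \<mu>)" by (simp add: Cst_inverse_cancel [OF \<open>c \<noteq> 0\<close>])
    also have "\<dots> = poly_subst F (Cst (1 / c) * jac H) * jac F"
      using eq by (simp add: c_def Cst_prod poly_subst_scale mult.assoc)
    finally show ?thesis by blast
  qed
  have div: "\<exists>q. p = q * jac F \<and> dpow d q \<in> inv_polys d P"
    if p: "\<And>\<sigma>. \<sigma> \<in> block_perms P \<Longrightarrow> perm_act \<sigma> p = sgn_poly \<sigma> * p" for p
  proof -
    from alt_div obtain Q where Q: "\<And>\<mu>. alt P \<mu> = poly_subst F (Q \<mu>) * jac F" by metis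
    define c :: complex where "c = of_nat (card (block_perms P))"
    have "c \<noteq> 0" using id_block_perms [of P] by (auto simp: c_def)
    have "p = Cst (1 / c) * (Cst c * p)" by (simp add: Cst_inverse_cancel [OF \<open>c \<noteq> 0\<close>])
    also have "\<dots> = Cst (1 / c) * (\<Sum>w\<in>supp p. Cst (cf p w) * alt P w)"
      by (simp only: c_def antisym_alt [OF P p])
    also have "\<dots> = poly_subst F (Cst (1 / c) * (\<Sum>w\<in>supp p. Cst (cf p w) * Q w)) * jac F"
      by (simp add: Q poly_subst_scale poly_subst_sum sum_distrib_right sum_distrib_left mult.assoc)
    finally have "p = poly_subst F (Cst (1 / c) * (\<Sum>w\<in>supp p. Cst (cf p w) * Q w)) * jac F" .
    moreover have "dpow d (poly_subst F r) \<in> inv_polys d P" for r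
      using range by (auto simp: dpow_poly_subst)
    ultimately show ?thesis by blast
  qed
  have "\<exists>e. hom_deg e (F i)" for i
  proof -
    obtain k where k: "\<And>m. m \<in> Poly_Mapping.keys (dpow d (F i)) \<Longrightarrow>
        (\<Sum>j\<in>UNIV. Poly_Mapping.lookup m j) = k"
      using hom unfolding homogeneous_def by blast
    have "wt w = k div d" if "w \<in> supp (F i)" for w
    proof -
      have "cf (dpow d (F i)) (\<lambda>j. d * w j) = cf (F i) w" using d by (simp add: cf_dpow)
      then have "(\<lambda>j. d * w j) \<in> supp (dpow d (F i))" using that by (simp add: supp_iff)
      then have "wt (\<lambda>j. d * w j) = k" using k unfolding supp_eq_image wt_def by auto metis
      then show ?thesis using d by (auto simp: wt_def sum_distrib_left [symmetric])
    qed
    then show ?thesis by blast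
  qed
  then obtain e where e: "\<And>i. hom_deg (e i) (F i)" by metis
  have "hom_deg (e i - 1) (pdiff j (F i))" for i j
  proof
    fix w assume "w \<in> supp (pdiff j (F i))"
    then have "w(j := w j + 1) \<in> supp (F i)" by (auto simp: supp_iff cf_pdiff)
    then have "wt (w(j := w j + 1)) = e i" using e by blast
    then show "wt w = e i - 1" using wt_upd [of w j "w j + 1"] by linarith
  qed
  then have "hom_deg (\<Sum>i\<in>UNIV. e i - 1) (sgn_poly \<sigma> * (\<Prod>i\<in>UNIV. pdiff (\<sigma> i) (F i)))" for \<sigma>
    by (intro hom_deg_scale hom_deg_prod) auto
  then have jac_hom: "hom_deg (\<Sum>i\<in>UNIV. e i - 1) (jac F)"
    unfolding jac_def det_def by (intro hom_deg_sum) (simp flip: Cst_of_int)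
  have "hom_deg (d * (\<Sum>i\<in>UNIV. e i - 1)) s"
  proof
    fix w assume w: "w \<in> supp s"
    then have "\<forall>i. d dvd w i" "(\<lambda>i. w i div d) \<in> supp (jac F)"
      by (auto simp: supp_iff s_jac cf_dpow [OF d] split: if_splits)
    moreover from this have "wt w = d * wt (\<lambda>i. w i div d)" by (simp add: wt_def sum_distrib_left)
    ultimately show "wt w = d * (\<Sum>i\<in>UNIV. e i - 1)" using jac_hom by simp
  qed
  then have hom_s: "\<exists>m. hom_deg m s" by blast
  show ?thesis by (rule that [OF s_jac anti hom_s div]) blast+
qed

section \<open>The modules of a partition\<close>

lemma alpha_partition_on: "alpha_partition \<alpha> P \<Longrightarrow> partition_on UNIV P"
  by (simp add: alpha_partition_def)

lemma alpha_block:
  assumes "alpha_partition \<alpha> P" "\<Omega> \<in> P" "i \<in> \<Omega>" "j \<in> \<Omega>"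
  shows "\<alpha> i = \<alpha> j"
proof -
  have "j \<in> \<Union>(blocks_at \<alpha> P (\<alpha> j))" using assms(1) by (simp add: alpha_partition_def level_def)
  then obtain \<Omega>' where "\<Omega>' \<in> P" "\<Omega>' \<subseteq> level \<alpha> (\<alpha> j)" "j \<in> \<Omega>'" by (auto simp: blocks_at_def)
  moreover from this have "\<Omega>' = \<Omega>"
    using block_unique [OF alpha_partition_on [OF assms(1)]] assms by blast
  ultimately show ?thesis using assms(3) by (auto simp: level_def)
qed

lemma alpha_partitionI:
  assumes P: "partition_on UNIV P" and const: "\<And>\<Omega> i j. \<Omega> \<in> P \<Longrightarrow> i \<in> \<Omega> \<Longrightarrow> j \<in> \<Omega> \<Longrightarrow> \<alpha> i = \<alpha> j"
  shows "alpha_partition \<alpha> P"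
  unfolding alpha_partition_def
proof (intro conjI allI P set_eqI iffI)
  fix k j assume "j \<in> level \<alpha> k"
  moreover obtain \<Omega> where "\<Omega> \<in> P" "j \<in> \<Omega>" using partition_onD1 [OF P] by blast
  moreover from this have "\<alpha> i = \<alpha> j" if "i \<in> \<Omega>" for i using const that by blast
  ultimately have "\<Omega> \<in> blocks_at \<alpha> P k" unfolding blocks_at_def level_def by blast
  with \<open>j \<in> \<Omega>\<close> show "j \<in> \<Union>(blocks_at \<alpha> P k)" by blast
qed (auto simp: blocks_at_def)

lemma perm_act_xmon_alpha:
  assumes P: "alpha_partition \<alpha> P" and \<sigma>: "\<sigma> \<in> block_perms P"
  shows "perm_act \<sigma> (xmon \<alpha>) = xmon \<alpha>"
proof -
  have "\<alpha> (inv \<sigma> i) = \<alpha> i" for i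
  proof -
    obtain \<Omega> where \<Omega>: "\<Omega> \<in> P" "i \<in> \<Omega>" using partition_onD1 [OF alpha_partition_on [OF P]] by blast
    then have "inv \<sigma> i \<in> \<Omega>" using inv_block_perms [OF \<sigma>] unfolding block_perms_def by blast
    then show ?thesis using alpha_block [OF P] \<Omega> by blast
  qed
  then have "\<alpha> \<circ> inv \<sigma> = \<alpha>" by auto
  then show ?thesis by (simp only: perm_act_xmon [OF block_perms_bij [OF \<sigma>]])
qed

lemma exists_inj_nat: "\<exists>r :: 'n::finite \<Rightarrow> nat. inj r"
  using finite_imp_inj_to_nat_seg [of "UNIV :: 'n set"] by auto

text \<open>An element of \<open>Semi d \<alpha> P\<close> is \<open>xmon \<alpha>\<close> times an antisymmetric polynomial in the \<open>d\<close>-th powers,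
  and the latter is a multiple of the Jacobian.\<close>

lemma Semi_structure:
  fixes P :: "'n::finite set set"
  assumes d: "d \<ge> 1" and \<alpha>: "multi_index d \<alpha>" and P: "alpha_partition \<alpha> P"
    and jacobian: "is_jacobian d P s"
  shows "Semi d \<alpha> P = {f * (s * xpow \<alpha>) | f. f \<in> inv_polys d P}"
    and "s * xpow \<alpha> \<in> Semi d \<alpha> P" and "s * xpow \<alpha> \<noteq> 0" and "\<exists>m. hom_deg m (s * xpow \<alpha>)"
proof -
  note part = alpha_partition_on [OF P]
  obtain t where t: "s = dpow d t" "\<And>\<sigma>. \<sigma> \<in> block_perms P \<Longrightarrow> perm_act \<sigma> t = sgn_poly \<sigma> * t"
    and hom: "\<exists>m. hom_deg m s"
    and div: "\<And>p. \<forall>\<sigma>\<in>block_perms P. perm_act \<sigma> p = sgn_poly \<sigma> * p \<Longrightarrow>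
      \<exists>q. p = q * t \<and> dpow d q \<in> inv_polys d P"
    by (rule is_jacobian_properties [OF d part jacobian]) blast
  have v: "s * xpow \<alpha> = xmon \<alpha> * dpow d t" by (simp add: t(1) xpow_eq_xmon mult.commute)
  show v_Semi: "s * xpow \<alpha> \<in> Semi d \<alpha> P"
    unfolding v
    by (auto simp: Semi_def residue_product [OF d \<alpha>] perm_act_mult perm_act_xmon_alpha [OF P] perm_act_dpow t(2)
        dpow_scale mult.left_commute)
  show "Semi d \<alpha> P = {f * (s * xpow \<alpha>) | f. f \<in> inv_polys d P}"
  proof (intro set_eqI iffI)
    fix p assume p: "p \<in> Semi d \<alpha> P"
    then obtain q where q: "p = xmon \<alpha> * dpow d q" using residue_factor [of p d \<alpha>] by (auto simp: Semi_def)
    have "perm_act \<sigma> q = sgn_poly \<sigma> * q" if \<sigma>: "\<sigma> \<in> block_perms P" for \<sigma>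
    proof -
      have "xmon \<alpha> * dpow d (perm_act \<sigma> q) = xmon \<alpha> * dpow d (sgn_poly \<sigma> * q)"
        using Semi_perm_act [OF p \<sigma>]
        by (simp add: q perm_act_mult perm_act_xmon_alpha [OF P \<sigma>] perm_act_dpow dpow_scale mult.left_commute)
      then show ?thesis using xmon_mult_cancel dpow_inj [OF d] by metis
    qed
    then obtain r where "q = r * t" "dpow d r \<in> inv_polys d P" using div by blast
    then show "p \<in> {f * (s * xpow \<alpha>) | f. f \<in> inv_polys d P}"
      by (intro CollectI exI [of _ "dpow d r"]) (simp add: q v dpow_mult mult_ac)
  next
    fix p assume "p \<in> {f * (s * xpow \<alpha>) | f. f \<in> inv_polys d P}"
    then show "p \<in> Semi d \<alpha> P"
      using op_submodule_op [OF Semi_submodule [OF d \<alpha>] inv_ops_mult [OF d] v_Semi] by blast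
  qed
  obtain r :: "'n \<Rightarrow> nat" where r: "inj r" using exists_inj_nat by blast
  obtain q where "alt P r = q * t" using div alt_antisym [OF part] by blast
  moreover have "cf (alt P r) r = 1" using cf_alt [OF part] r by (meson inj_on_subset subset_UNIV)
  ultimately have "t \<noteq> 0" by auto
  then have "dpow d t \<noteq> dpow d 0" using dpow_inj [OF d] by blast
  then have "xmon \<alpha> * dpow d t \<noteq> xmon \<alpha> * 0" using xmon_mult_cancel by (fastforce simp: dpow_def)
  then show "s * xpow \<alpha> \<noteq> 0" by (simp add: v)
  obtain m where "hom_deg m s" using hom by blast
  moreover have "hom_deg (wt \<alpha>) (xpow \<alpha>)" by (auto simp: xpow_eq_xmon supp_iff cf_xmon split: if_splits)
  ultimately show "\<exists>m. hom_deg m (s * xpow \<alpha>)" using hom_deg_mult by blast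
qed

lemma cyclic_structure:
  assumes d: "d \<ge> 1" and N: "N = {f * v | f. f \<in> inv_polys d P}" "op_submodule (inv_ops d P) N"
    and v: "v \<noteq> 0" "hom_deg m v"
  shows "{D v | D. D \<in> inv_ops d P} = N"
    and "block_perms P \<subseteq> block_perms Q \<Longrightarrow> op_simple (inv_ops d Q) {D v | D. D \<in> inv_ops d Q}"
    and "u \<in> N \<Longrightarrow> \<exists>c. hom_part m u = Cst c * v"
    and "u \<in> N \<Longrightarrow> w \<in> supp u \<Longrightarrow> m \<le> wt w"
proof -
  have "1 \<in> inv_polys d P" by (simp add: inv_polys_iff flip: Cst_1)
  then have vN: "v \<in> N" using N(1) by force
  show "{D v | D. D \<in> inv_ops d P} = N"
  proof
    show "{D v | D. D \<in> inv_ops d P} \<subseteq> N" using op_submodule_op [OF N(2) _ vN] by blast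
    show "N \<subseteq> {D v | D. D \<in> inv_ops d P}" using inv_ops_mult [OF d, of _ P] unfolding N(1) by force
  qed
  show line: "\<exists>c. hom_part m u = Cst c * v" if "u \<in> N" for u
    using that unfolding N(1) by (auto simp: hom_part_mult [OF v(2)] hom_part_degree_0)
  show "m \<le> wt w" if "u \<in> N" "w \<in> supp u"
  proof (rule ccontr)
    assume "\<not> m \<le> wt w"
    then have "hom_part (wt w) u = 0" using that(1) unfolding N(1) by (auto simp: hom_part_mult [OF v(2)])
    then have "cf u w = 0" by (metis cf_hom_part cf_zero)
    with that(2) show False by (simp add: supp_iff)
  qed
  show "op_simple (inv_ops d Q) {D v | D. D \<in> inv_ops d Q}" if "block_perms P \<subseteq> block_perms Q"
    by (rule cyclic_simple [OF d that N(2) vN v line])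
qed

section \<open>Modules over the invariants of the diagonal group\<close>

lemma supp_bound: "\<exists>N. \<forall>u\<in>supp p. \<forall>i. u i \<le> N"
proof -
  have fin: "finite (\<Union>u\<in>supp p. range u)" by simp
  have "u i \<le> Max (\<Union>u\<in>supp p. range u)" if "u \<in> supp p" for u i
    using that by (intro Max_ge [OF fin]) blast
  then show ?thesis by blast
qed

text \<open>The eigenvalues of the \<open>X i * pdiff i\<close> separate monomials.\<close>

lemma monomial_projection:
  assumes d: "d \<ge> 1"
  shows "\<exists>D\<in>inv_ops d singles. \<forall>p. (\<forall>u\<in>supp p. \<forall>i. u i \<le> N) \<longrightarrow> D p = Cst (cf p w) * xmon w"
proof -
  define q where "q = (\<lambda>u :: 'a \<Rightarrow> nat. \<Prod>i\<in>UNIV. lag N (w i) (of_nat (u i)))"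
  have "q \<in> polyfun" unfolding q_def by (intro polyfun_prod lag_polyfun polyfun.coord) simp
  then have "diag q \<in> inv_ops d singles"
    by (rule inv_ops_diag [OF d]) (simp add: block_perms_singles)
  moreover have "diag q p = Cst (cf p w) * xmon w" if N: "\<forall>u\<in>supp p. \<forall>i. u i \<le> N" for p
  proof (rule cf_eqI)
    fix u
    show "cf (diag q p) u = cf (Cst (cf p w) * xmon w) u"
    proof (cases "u \<in> supp p")
      case True
      then have "q u = (\<Prod>i\<in>UNIV. if u i = w i then 1 else 0)"
        using N by (simp add: q_def lag_eq)
      also have "\<dots> = (if u = w then 1 else 0)"
        by (auto simp: fun_eq_iff)
      finally show ?thesis by (simp add: cf_xmon)
    next
      case False
      then show ?thesis by (auto simp: cf_xmon supp_iff)
    qed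
  qed
  ultimately show ?thesis by blast
qed

lemma N_alpha_structure:
  assumes d: "d \<ge> 1" and \<alpha>: "multi_index d \<alpha>"
  shows "op_simple (inv_ops d singles) (N_alpha d \<alpha>)"
proof -
  have N: "N_alpha d \<alpha> = {f * xmon \<alpha> | f. f \<in> inv_polys d singles}"
    by (simp add: N_alpha_def A_mats_eq xpow_eq_xmon)
  have sub: "op_submodule (inv_ops d singles) (N_alpha d \<alpha>)"
    using Semi_submodule [OF d \<alpha>] by (simp only: N_alpha_eq_Semi [OF d \<alpha>])
  have hom: "hom_deg (wt \<alpha>) (xmon \<alpha>)" by (auto simp: supp_iff cf_xmon split: if_splits)
  note cyclic_structure [OF d N sub xmon_nonzero hom]
  from this(1) this(2) [OF order_refl] show ?thesis by (simp only:)
qed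

text \<open>A nonzero submodule contains a monomial, by projection, and so meets one of the \<open>N_alpha d \<alpha>\<close>.\<close>

lemma simple_modules_A:
  assumes d: "d \<ge> 1" and N: "op_simple (inv_ops d singles) N"
  shows "\<exists>\<alpha>. multi_index d \<alpha> \<and> N = N_alpha d \<alpha>"
proof -
  have sub: "op_submodule (inv_ops d singles) N" using N by (simp add: op_simple_def)
  obtain y where y: "y \<in> N" "y \<noteq> 0"
    using N op_submodule_0 [OF sub] unfolding op_simple_def by blast
  obtain w where w: "w \<in> supp y" using exists_supp [OF y(2)] by blast
  obtain k where "\<forall>u\<in>supp y. \<forall>i. u i \<le> k" using supp_bound by blast
  then obtain D where "D \<in> inv_ops d singles" "D y = Cst (cf y w) * xmon w"
    using monomial_projection [OF d] by blast
  then have "Cst (cf y w) * xmon w \<in> N" using op_submodule_op [OF sub _ y(1)] by metis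
  then have "Cst (1 / cf y w) * (Cst (cf y w) * xmon w) \<in> N" by (rule op_submodule_scale [OF d sub])
  then have wN: "xmon w \<in> N" using w by (simp add: Cst_inverse_cancel supp_iff)
  define \<alpha> where "\<alpha> = (\<lambda>i. w i mod d)"
  have \<alpha>: "multi_index d \<alpha>" using d by (simp add: multi_index_def \<alpha>_def)
  have "xmon w \<in> N_alpha d \<alpha>"
    unfolding N_alpha_eq_Semi [OF d \<alpha>]
    by (auto simp: Semi_def block_perms_singles sign_id supp_iff cf_xmon \<alpha>_def split: if_splits)
  moreover note N_alpha_structure [OF d \<alpha>]
  moreover from this have "op_submodule (inv_ops d singles) (N_alpha d \<alpha>)" by (simp add: op_simple_def)
  ultimately have "N = N_alpha d \<alpha>"
    using op_simple_eqI [OF N _ wN] op_simple_eqI [OF _ sub _ wN] xmon_nonzero by blast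
  with \<alpha> show ?thesis by blast
qed

text \<open>The projection to \<open>xmon \<beta>\<close> kills \<open>N_alpha d \<alpha>\<close> for \<open>\<alpha> \<noteq> \<beta>\<close>.\<close>

lemma N_alpha_iso:
  assumes d: "d \<ge> 1" and \<alpha>: "multi_index d \<alpha>" and \<beta>: "multi_index d \<beta>"
    and iso: "op_iso (inv_ops d singles) (N_alpha d \<beta>) (N_alpha d \<alpha>)"
  shows "\<alpha> = \<beta>"
proof (rule ccontr)
  assume ne: "\<alpha> \<noteq> \<beta>"
  obtain \<phi> where b: "bij_betw \<phi> (N_alpha d \<beta>) (N_alpha d \<alpha>)"
    and add: "\<forall>x\<in>N_alpha d \<beta>. \<forall>y\<in>N_alpha d \<beta>. \<phi> (x + y) = \<phi> x + \<phi> y"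
    and op: "\<forall>D\<in>inv_ops d singles. \<forall>x\<in>N_alpha d \<beta>. \<phi> (D x) = D (\<phi> x)"
    using iso unfolding op_iso_def by blast
  have x: "xmon \<beta> \<in> N_alpha d \<beta>" "0 \<in> N_alpha d \<beta>"
    unfolding N_alpha_eq_Semi [OF d \<beta>] using \<beta> op_submodule_0 [OF Semi_submodule [OF d \<beta>]]
    by (auto simp: Semi_def block_perms_singles sign_id supp_iff cf_xmon multi_index_def split: if_splits)
  define y where "y = \<phi> (xmon \<beta>)"
  have "y \<in> Semi d \<alpha> singles"
    using b x(1) unfolding y_def N_alpha_eq_Semi [OF d \<alpha>, symmetric] by (auto simp: bij_betw_def)
  then have "\<beta> \<notin> supp y" using Semi_residue [of y d \<alpha> singles \<beta>] \<beta> ne by (auto simp: multi_index_def)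
  obtain k where k: "\<forall>u\<in>supp y \<union> supp (xmon \<beta>). \<forall>i. u i \<le> k"
  proof -
    obtain k1 k2 where "\<forall>u\<in>supp y. \<forall>i. u i \<le> k1" "\<forall>u\<in>supp (xmon \<beta>). \<forall>i. u i \<le> k2"
      using supp_bound by metis
    then have "\<forall>u\<in>supp y \<union> supp (xmon \<beta>). \<forall>i. u i \<le> max k1 k2" by (auto simp: le_max_iff_disj)
    then show ?thesis using that by blast
  qed
  obtain D where D: "D \<in> inv_ops d singles"
      and Dp: "\<And>p. (\<forall>u\<in>supp p. \<forall>i. u i \<le> k) \<Longrightarrow> D p = Cst (cf p \<beta>) * xmon \<beta>"
    using monomial_projection [OF d] by blast
  have "D (xmon \<beta>) = xmon \<beta>" using Dp [of "xmon \<beta>"] k by (simp add: cf_xmon)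
  moreover have "D y = 0" using Dp [of y] k \<open>\<beta> \<notin> supp y\<close> by (simp add: supp_iff)
  ultimately have "y = 0" using op D x(1) by (metis y_def)
  moreover have "\<phi> 0 = 0" using add x(2) by fastforce
  ultimately have "xmon \<beta> = 0" using b x unfolding y_def bij_betw_def by (metis inj_onD)
  then show False by simp
qed

section \<open>Exchanging exponents\<close>

lemma cf_X_power_mult: "cf (X i ^ a * p) w = (if a \<le> w i then cf p (w(i := w i - a)) else 0)"
proof -
  have "(\<lambda>j. w j - (if j = i then a else 0)) = w(i := w i - a)" by auto
  then show ?thesis by (auto simp: xmon_X_power cf_xmon_mult)
qed

lemma cf_pdiff_power:
  "cf ((pdiff i ^^ b) p) w = pochhammer (of_nat (w i + 1)) b * cf p (w(i := w i + b))"
proof (induct b arbitrary: p w)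
  case (Suc b)
  have "cf ((pdiff i ^^ Suc b) p) w = of_nat (w i + 1) * cf ((pdiff i ^^ b) p) (w(i := w i + 1))"
    by (simp add: cf_pdiff)
  also have "\<dots> = pochhammer (of_nat (w i + 1)) (Suc b) * cf p (w(i := w i + Suc b))"
    unfolding Suc pochhammer_rec by (simp add: add.commute add.left_commute)
  finally show ?case .
qed simp

text \<open>Summed over the variables, the operators that replace the exponent \<open>b\<close> of one variable by \<open>a\<close>
  are realized, on polynomials with exponents up to \<open>N\<close>, by \<open>x\<^sub>i\<^sup>a \<partial>\<^sub>i\<^sup>b\<close> after a projection to
  the exponent \<open>b\<close>.  They preserve the characters of the diagonal group when \<open>a\<close> and \<open>b\<close> are
  congruent; for \<open>a = b\<close> they count the exponents equal to \<open>a\<close>.\<close>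

lemma exchange_op:
  assumes d: "d \<ge> 1" and ab: "a mod d = b mod d"
  shows "\<exists>E\<in>inv_ops d {}. \<forall>p :: 'n::finite cpoly. (\<forall>u\<in>supp p. \<forall>i. u i \<le> N) \<longrightarrow>
    (\<forall>w. cf (E p) w = (\<Sum>i | w i = a. cf p (w(i := b))))"
proof -
  define T where "T = (\<lambda>i :: 'n. (\<lambda>p. X i ^ a * p) \<circ> (pdiff i ^^ b) \<circ> diag (\<lambda>w. lag N b (of_nat (w i)) * (1 / fact b)))"
  define c where "c = (\<lambda>k. pochhammer (of_nat (k - a + 1)) b * (lag N b (of_nat (k - a + b)) * (1 / fact b)))"
  have T: "cf (T i p) w = (if a \<le> w i then c (w i) * cf p (w(i := w i - a + b)) else 0)" for i p w
    by (simp only: T_def c_def comp_apply cf_X_power_mult cf_pdiff_power cf_diag fun_upd_same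
        fun_upd_upd mult.assoc)
  have T_weyl: "T i \<in> weyl" for i
    unfolding T_def
    by (intro weyl.comp weyl_mult_op weyl_pow_op weyl.pdiff diag_weyl polyfun.mult polyfun.const
        lag_polyfun polyfun.coord)
  define E where "E = (\<lambda>p. \<Sum>i\<in>UNIV. T i p)"
  have "E \<in> weyl" unfolding E_def by (rule weyl_sum_op) (simp_all add: T_weyl)
  moreover have "E (diag_act z p) = diag_act z (E p)" if z: "z \<in> roots d" for z p
  proof (rule cf_eqI)
    fix w
    have "(\<Prod>j\<in>UNIV. z j ^ (w(i := w i - a + b)) j) = (\<Prod>j\<in>UNIV. z j ^ w j)" if "a \<le> w i" for i
    proof (rule prod.cong [OF refl])
      fix j
      have "(w i - a + b) mod d = (w i - a + a) mod d" using ab by (metis mod_add_right_eq)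
      then have "(w i - a + b) mod d = w i mod d" using that by simp
      then show "z j ^ (w(i := w i - a + b)) j = z j ^ w j"
        by (cases "j = i") (auto, metis root_power_mod [OF z])
    qed
    then show "cf (E (diag_act z p)) w = cf (diag_act z (E p)) w"
      unfolding E_def cf_diag_act cf_sum T sum_distrib_left by (intro sum.cong) auto
  qed
  moreover have "E (perm_act \<sigma> p) = perm_act \<sigma> (E p)" if \<sigma>: "\<sigma> \<in> block_perms {}" for \<sigma> p
  proof (rule cf_eqI)
    fix w :: "'n \<Rightarrow> nat"
    note b = block_perms_bij [OF \<sigma>]
    have upd: "w(\<sigma> i := k) \<circ> \<sigma> = (w \<circ> \<sigma>)(i := k)" for i k
      using b by (auto simp: fun_eq_iff bij_def inj_eq)
    have "cf (E (perm_act \<sigma> p)) w = (\<Sum>i\<in>UNIV. if a \<le> w i then c (w i) * cf p (w(i := w i - a + b) \<circ> \<sigma>) else 0)"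
      unfolding E_def cf_sum T cf_perm_act [OF b] ..
    also have "\<dots> = (\<Sum>i\<in>UNIV. if a \<le> w (\<sigma> i) then c (w (\<sigma> i)) * cf p (w(\<sigma> i := w (\<sigma> i) - a + b) \<circ> \<sigma>) else 0)"
      by (rule sum.reindex_bij_betw [OF b, symmetric])
    also have "\<dots> = cf (perm_act \<sigma> (E p)) w"
      unfolding upd E_def cf_perm_act [OF b] cf_sum T comp_apply ..
    finally show "cf (E (perm_act \<sigma> p)) w = cf (perm_act \<sigma> (E p)) w" .
  qed
  ultimately have E: "E \<in> inv_ops d {}" by (simp add: inv_ops_iff [OF d])
  have "cf (E p) w = (\<Sum>i | w i = a. cf p (w(i := b)))" if N: "\<forall>u\<in>supp p. \<forall>i. u i \<le> N" for p w
  proof -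
    have T_eq: "cf (T i p) w = (if w i = a then cf p (w(i := b)) else 0)" for i
    proof (cases "a \<le> w i \<and> w(i := w i - a + b) \<in> supp p")
      case True
      then have "(w(i := w i - a + b)) i \<le> N" using N by blast
      then have "lag N b (of_nat (w i - a + b)) = (if w i = a then 1 else 0)"
        using True by (subst lag_eq) auto
      then have "c (w i) = (if w i = a then 1 else 0)"
        unfolding c_def by (simp add: pochhammer_fact [symmetric] del: of_nat_add)
      then show ?thesis using True by (auto simp: T)
    next
      case False
      then show ?thesis by (auto simp: T supp_iff)
    qed
    have "cf (E p) w = (\<Sum>i\<in>UNIV. if w i = a then cf p (w(i := b)) else 0)"
      unfolding E_def cf_sum T_eq ..
    then show ?thesis using sum.inter_filter [of UNIV "\<lambda>i. cf p (w(i := b))" "\<lambda>i. w i = a"] by simp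
  qed
  with E show ?thesis by blast
qed

section \<open>Exponents in semi-invariants\<close>

abbreviation swap :: "'n \<Rightarrow> 'n \<Rightarrow> 'n \<Rightarrow> 'n" where
  "swap \<equiv> Transposition.transpose"

lemma transpose_block_perms:
  assumes P: "partition_on UNIV P" and \<Omega>: "\<Omega> \<in> P" "i \<in> \<Omega>" "j \<in> \<Omega>"
  shows "swap i j \<in> block_perms P"
proof -
  have "swap i j ` \<Omega>' = \<Omega>'" if "\<Omega>' \<in> P" for \<Omega>'
  proof -
    have "i \<in> \<Omega>' \<longleftrightarrow> j \<in> \<Omega>'" using block_unique [OF P \<Omega>(1) that] \<Omega>(2,3) by metis
    then show ?thesis by (rule transpose_image_eq)
  qed
  then show ?thesis by (simp add: block_perms_def permutes_swap_id)
qed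

lemma Semi_inj:
  assumes P: "partition_on UNIV P" and p: "p \<in> Semi d \<alpha> P" and w: "w \<in> supp p" and \<Omega>: "\<Omega> \<in> P"
  shows "inj_on w \<Omega>"
proof (rule inj_onI, rule ccontr)
  fix i j assume ij: "i \<in> \<Omega>" "j \<in> \<Omega>" "w i = w j" "i \<noteq> j"
  have "w \<circ> swap i j = w" using ij(3) by (auto simp: fun_eq_iff Transposition.transpose_def)
  then have "cf p w = - cf p w"
    using Semi_cf [OF p transpose_block_perms [OF P \<Omega> ij(1,2)], of w] ij(4) by (simp add: sign_swap_id)
  with w show False by (simp add: supp_iff)
qed

lemma div_mod_inj: "x mod d = y mod d \<Longrightarrow> x div d = y div d \<Longrightarrow> x = (y :: nat)"
  by (metis div_mult_mod_eq)

lemma Semi_div_inj: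
  assumes P: "alpha_partition \<alpha> P" and p: "p \<in> Semi d \<alpha> P" and w: "w \<in> supp p" and \<Omega>: "\<Omega> \<in> P"
  shows "inj_on (\<lambda>i. w i div d) \<Omega>"
proof (rule inj_onI)
  fix i j assume ij: "i \<in> \<Omega>" "j \<in> \<Omega>" "w i div d = w j div d"
  moreover have "w i mod d = w j mod d"
    using Semi_residue [OF p w] alpha_block [OF P \<Omega> ij(1,2)] by simp
  ultimately have "w i = w j" by (metis div_mod_inj)
  then show "i = j" using Semi_inj [OF alpha_partition_on [OF P] p w \<Omega>] ij by (meson inj_onD)
qed

text \<open>For exponents congruent to \<open>\<alpha>\<close>, this says that a block has the exponents
  \<open>\<alpha>, \<alpha> + d, \<dots>, \<alpha> + (m - 1) d\<close> in some order, where \<open>m\<close> is its size.  They are the exponents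
  of a Vandermonde determinant in the \<open>d\<close>-th powers, times \<open>xmon \<alpha>\<close>.\<close>

definition standard :: "nat \<Rightarrow> 'n set set \<Rightarrow> ('n \<Rightarrow> nat) \<Rightarrow> bool" where
  "standard d P w \<longleftrightarrow> (\<forall>\<Omega>\<in>P. (\<lambda>i. w i div d) ` \<Omega> = {..<card \<Omega>})"

lemma sum_nat_set_min:
  fixes S :: "nat set"
  assumes "finite S"
  shows "sum id {..<card S} \<le> sum id S" and "sum id S = sum id {..<card S} \<Longrightarrow> S = {..<card S}"
proof -
  let ?T = "{..<card S}"
  have c: "card (S - ?T) = card (?T - S)"
    using card_Diff_subset_Int [of S ?T] card_Diff_subset_Int [of ?T S] assms by (simp add: Int_commute)
  have S: "sum id S = sum id (S \<inter> ?T) + sum id (S - ?T)" using assms by (metis sum.Int_Diff)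
  have T: "sum id ?T = sum id (S \<inter> ?T) + sum id (?T - S)"
    by (metis finite_lessThan inf_commute sum.Int_Diff)
  have lo: "sum id (S - ?T) \<ge> card (S - ?T) * card S"
    using sum_bounded_below [of "S - ?T" "card S" id] by simp
  have hi: "sum id (?T - S) < card (?T - S) * card S" if "?T - S \<noteq> {}"
    using sum_bounded_above_strict [of "?T - S" id "card S"] that by (simp add: card_gt_0_iff)
  show "sum id ?T \<le> sum id S" using S T lo hi c by (cases "?T - S = {}") auto
  show "S = ?T" if "sum id S = sum id ?T"
  proof -
    have "?T - S = {}" using S T lo hi c that by fastforce
    with c assms show ?thesis by (metis Diff_eq_empty_iff card.empty card_0_eq finite_Diff subset_antisym)
  qed
qed

lemma sum_blocks:
  fixes P :: "'n::finite set set"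
  assumes P: "partition_on UNIV P"
  shows "(\<Sum>i\<in>UNIV. f i) = (\<Sum>\<Omega>\<in>P. \<Sum>i\<in>\<Omega>. f i)"
proof -
  have "sum f (\<Union>P) = sum (sum f) P"
    using sum.Union_disjoint [of P f] disjointD [OF partition_onD2 [OF P]] by (simp add: o_def)
  then show ?thesis by (simp only: partition_onD1 [OF P, symmetric])
qed

lemma wt_residue:
  assumes "\<And>i. w i mod d = \<alpha> i"
  shows "wt w = wt \<alpha> + d * (\<Sum>i\<in>UNIV. w i div d)"
proof -
  have "w i = \<alpha> i + d * (w i div d)" for i using assms [of i] mult_div_mod_eq [of d "w i"] by simp
  then have "wt w = (\<Sum>i\<in>UNIV. \<alpha> i + d * (w i div d))" unfolding wt_def by (intro sum.cong) auto
  then show ?thesis by (simp add: wt_def sum.distrib sum_distrib_left)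
qed

text \<open>Distinct exponents in each block force a minimal degree, and it is attained exactly by the
  standard exponents.\<close>

lemma standard_minimal:
  fixes P :: "'n::finite set set"
  assumes P: "partition_on UNIV P" and inj: "\<And>\<Omega>. \<Omega> \<in> P \<Longrightarrow> inj_on (\<lambda>i. w i div d) \<Omega>"
  shows "(\<Sum>\<Omega>\<in>P. sum id {..<card \<Omega>}) \<le> (\<Sum>i\<in>UNIV. w i div d)"
    and "(\<Sum>i\<in>UNIV. w i div d) = (\<Sum>\<Omega>\<in>P. sum id {..<card \<Omega>}) \<longleftrightarrow> standard d P w"
proof -
  let ?im = "\<lambda>\<Omega>. (\<lambda>i. w i div d) ` \<Omega>"
  have eq: "(\<Sum>i\<in>UNIV. w i div d) = (\<Sum>\<Omega>\<in>P. sum id (?im \<Omega>))"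
    unfolding sum_blocks [OF P] by (rule sum.cong) (simp_all add: sum.reindex inj)
  have card: "card (?im \<Omega>) = card \<Omega>" if "\<Omega> \<in> P" for \<Omega> by (rule card_image [OF inj [OF that]])
  have le: "sum id {..<card \<Omega>} \<le> sum id (?im \<Omega>)" if "\<Omega> \<in> P" for \<Omega>
    using sum_nat_set_min(1) [of "?im \<Omega>"] card [OF that] by simp
  show "(\<Sum>\<Omega>\<in>P. sum id {..<card \<Omega>}) \<le> (\<Sum>i\<in>UNIV. w i div d)"
    unfolding eq by (rule sum_mono [OF le])
  show "(\<Sum>i\<in>UNIV. w i div d) = (\<Sum>\<Omega>\<in>P. sum id {..<card \<Omega>}) \<longleftrightarrow> standard d P w"
  proof
    assume "(\<Sum>i\<in>UNIV. w i div d) = (\<Sum>\<Omega>\<in>P. sum id {..<card \<Omega>})"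
    then have e: "(\<Sum>\<Omega>\<in>P. sum id (?im \<Omega>)) = (\<Sum>\<Omega>\<in>P. sum id {..<card \<Omega>})" unfolding eq .
    have "sum id (?im \<Omega>) = sum id {..<card \<Omega>}" if "\<Omega> \<in> P" for \<Omega>
      by (rule sym, rule sum_mono_inv [OF e [symmetric] le that]) simp_all
    then have "?im \<Omega> = {..<card \<Omega>}" if "\<Omega> \<in> P" for \<Omega>
      using sum_nat_set_min(2) [of "?im \<Omega>"] card [OF that] that by simp
    then show "standard d P w" by (simp add: standard_def)
  next
    assume "standard d P w"
    then show "(\<Sum>i\<in>UNIV. w i div d) = (\<Sum>\<Omega>\<in>P. sum id {..<card \<Omega>})"
      unfolding eq standard_def by (intro sum.cong) auto
  qed
qed

definition block :: "'n set set \<Rightarrow> 'n \<Rightarrow> 'n set" where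
  "block P i = (THE \<Omega>. \<Omega> \<in> P \<and> i \<in> \<Omega>)"

lemma block_eq: "partition_on UNIV P \<Longrightarrow> \<Omega> \<in> P \<Longrightarrow> i \<in> \<Omega> \<Longrightarrow> block P i = \<Omega>"
  unfolding block_def by (rule the_equality) (auto dest: block_unique)

lemma block_in: "partition_on UNIV P \<Longrightarrow> block P i \<in> P"
  and in_block: "partition_on UNIV P \<Longrightarrow> i \<in> block P i"
proof -
  assume P: "partition_on UNIV P"
  obtain \<Omega> where "\<Omega> \<in> P" "i \<in> \<Omega>" using partition_onD1 [OF P] by blast
  then show "block P i \<in> P" "i \<in> block P i" using block_eq [OF P] by auto
qed

lemma exists_standard:
  fixes P :: "'n::finite set set"
  assumes P: "partition_on UNIV P"
  obtains r :: "'n \<Rightarrow> nat" where "\<And>\<Omega>. \<Omega> \<in> P \<Longrightarrow> bij_betw r \<Omega> {..<card \<Omega>}"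
proof -
  have "\<exists>h :: 'n \<Rightarrow> nat. bij_betw h \<Omega> {..<card \<Omega>}" for \<Omega>
    using ex_bij_betw_finite_nat [of \<Omega>] by (simp add: atLeast0LessThan)
  then obtain h :: "'n set \<Rightarrow> 'n \<Rightarrow> nat" where h: "\<And>\<Omega>. bij_betw (h \<Omega>) \<Omega> {..<card \<Omega>}" by metis
  have "bij_betw (\<lambda>i. h (block P i) i) \<Omega> {..<card \<Omega>}" if "\<Omega> \<in> P" for \<Omega>
    using h [of \<Omega>] block_eq [OF P that] by (subst bij_betw_cong [of _ _ "h \<Omega>"]) auto
  then show ?thesis using that by blast
qed

text \<open>The alternant with standard exponents is a multiple of the generator, so the degree of the latter
  is not larger than the minimum in \<open>standard_minimal\<close>.\<close>

lemma generator_standard: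
  fixes P :: "'n::finite set set"
  assumes d: "d \<ge> 1" and \<alpha>: "multi_index d \<alpha>" and P: "alpha_partition \<alpha> P"
    and jacobian: "is_jacobian d P s" and w: "w \<in> supp (s * xpow \<alpha>)"
  shows "standard d P w"
proof -
  note part = alpha_partition_on [OF P]
  note S = Semi_structure [OF d \<alpha> P jacobian]
  obtain m where m: "hom_deg m (s * xpow \<alpha>)" using S(4) by blast
  obtain r :: "'n \<Rightarrow> nat" where r: "\<And>\<Omega>. \<Omega> \<in> P \<Longrightarrow> bij_betw r \<Omega> {..<card \<Omega>}"
    using exists_standard [OF part] by blast
  define p where "p = xmon \<alpha> * dpow d (alt P r)"
  define u where "u = (\<lambda>i. \<alpha> i + d * r i)"
  have "p \<in> Semi d \<alpha> P"
    unfolding p_def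
    by (auto simp: Semi_def residue_product [OF d \<alpha>] perm_act_mult perm_act_xmon_alpha [OF P] perm_act_dpow
        alt_antisym [OF part] dpow_scale mult.left_commute)
  moreover have "cf p u = 1"
    using cf_alt [OF part, of r] r d by (simp add: p_def u_def cf_xmon_mult cf_dpow bij_betw_def)
  ultimately have "m \<le> wt u"
    using cyclic_structure(4) [OF d S(1) Semi_submodule [OF d \<alpha>] S(3) m, of p u] by (simp add: supp_iff)
  have u: "u i mod d = \<alpha> i" "u i div d = r i" for i
    using \<alpha> d by (simp_all add: u_def multi_index_def)
  have "standard d P u" using r by (simp add: standard_def u bij_betw_def)
  then have "wt u = wt \<alpha> + d * (\<Sum>\<Omega>\<in>P. sum id {..<card \<Omega>})"
    using wt_residue [of u d \<alpha>] u standard_minimal(2) [OF part, of u d] r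
    by (simp add: bij_betw_def)
  moreover have "wt w = wt \<alpha> + d * (\<Sum>i\<in>UNIV. w i div d)"
    by (rule wt_residue) (rule Semi_residue [OF S(2) w])
  moreover have "wt w = m" using m w by blast
  ultimately have "(\<Sum>i\<in>UNIV. w i div d) \<le> (\<Sum>\<Omega>\<in>P. sum id {..<card \<Omega>})"
    using \<open>m \<le> wt u\<close> d by simp
  then show ?thesis
    using standard_minimal [OF part Semi_div_inj [OF P S(2) w]] by (meson le_antisym)
qed

lemma standard_wt:
  assumes P: "alpha_partition \<alpha> P" and "p \<in> Semi d \<alpha> P" "q \<in> Semi d \<alpha> P"
    and "u \<in> supp p" "w \<in> supp q" "standard d P u" "standard d P w"
  shows "wt u = wt w"
  using wt_residue [of u d \<alpha>] wt_residue [of w d \<alpha>] Semi_residue [of p d \<alpha> P u] Semi_residue [of q d \<alpha> P w]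
    standard_minimal(2) [OF alpha_partition_on [OF P] Semi_div_inj [OF P, of p d u]]
    standard_minimal(2) [OF alpha_partition_on [OF P] Semi_div_inj [OF P, of q d w]] assms(2-)
  by simp

text \<open>The exponent \<open>i + d * k\<close> occurs once in each block at level \<open>i\<close> with more than \<open>k\<close> elements.\<close>

lemma standard_count:
  fixes P :: "'n::finite set set"
  assumes P: "alpha_partition \<alpha> P" and p: "p \<in> Semi d \<alpha> P" and w: "w \<in> supp p"
    and std: "standard d P w" and i: "i < d"
  shows "card {j. w j = i + d * k} = card {\<Omega> \<in> blocks_at \<alpha> P i. k < card \<Omega>}"
proof (rule bij_betw_same_card)
  note part = alpha_partition_on [OF P]
  have w_iff: "w j = i + d * k \<longleftrightarrow> \<alpha> j = i \<and> w j div d = k" for j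
  proof -
    have "w j = i + d * k \<Longrightarrow> w j mod d = i \<and> w j div d = k" using i by simp
    moreover have "w j = w j mod d + d * (w j div d)" by simp
    ultimately show ?thesis using Semi_residue [OF p w, of j] by metis
  qed
  show "bij_betw (block P) {j. w j = i + d * k} {\<Omega> \<in> blocks_at \<alpha> P i. k < card \<Omega>}"
    unfolding bij_betw_def
  proof (intro conjI set_eqI iffI inj_onI)
    fix j l assume "j \<in> {j. w j = i + d * k}" "l \<in> {j. w j = i + d * k}" and b: "block P j = block P l"
    then have "w j div d = w l div d" by (simp add: w_iff)
    then show "j = l"
      using Semi_div_inj [OF P p w block_in [OF part, of j]] in_block [OF part] b by (metis inj_onD)
  next
    fix \<Omega> assume "\<Omega> \<in> block P ` {j. w j = i + d * k}"
    then obtain j where j: "\<Omega> = block P j" "\<alpha> j = i" "w j div d = k" by (auto simp: w_iff)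
    have "\<Omega> \<in> P" "j \<in> \<Omega>" using block_in [OF part] in_block [OF part] by (simp_all add: j(1))
    moreover from this have "k \<in> {..<card \<Omega>}" using std j(3) unfolding standard_def by blast
    moreover have "\<Omega> \<subseteq> level \<alpha> i"
      using alpha_block [OF P \<open>\<Omega> \<in> P\<close> _ \<open>j \<in> \<Omega>\<close>] j(2) by (auto simp: level_def)
    ultimately show "\<Omega> \<in> {\<Omega> \<in> blocks_at \<alpha> P i. k < card \<Omega>}" by (simp add: blocks_at_def)
  next
    fix \<Omega> assume "\<Omega> \<in> {\<Omega> \<in> blocks_at \<alpha> P i. k < card \<Omega>}"
    then have \<Omega>: "\<Omega> \<in> P" "\<Omega> \<subseteq> level \<alpha> i" "k < card \<Omega>" by (auto simp: blocks_at_def)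
    then have "k \<in> (\<lambda>j. w j div d) ` \<Omega>" using std by (simp add: standard_def)
    then obtain j where "j \<in> \<Omega>" "w j div d = k" by blast
    then show "\<Omega> \<in> block P ` {j. w j = i + d * k}"
      using \<Omega> block_eq [OF part \<Omega>(1), of j] by (intro image_eqI [of _ _ j]) (auto simp: w_iff level_def)
  qed
qed

section \<open>Matching partitions of equal shapes\<close>

lemma fibrewise_bij:
  assumes "finite A" "finite B" and card: "\<And>c. card {a \<in> A. f a = c} = card {b \<in> B. g b = c}"
  shows "\<exists>h. bij_betw h A B \<and> (\<forall>a\<in>A. g (h a) = f a)"
proof -
  have "\<exists>h. bij_betw h {a \<in> A. f a = c} {b \<in> B. g b = c}" for c
    using assms by (intro finite_same_card_bij) auto
  then obtain h where h: "\<And>c. bij_betw (h c) {a \<in> A. f a = c} {b \<in> B. g b = c}" by metis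
  have mem: "h (f a) a \<in> B \<and> g (h (f a) a) = f a" if "a \<in> A" for a
    using bij_betwE [OF h [of "f a"]] that by blast
  have "bij_betw (\<lambda>a. h (f a) a) A B"
    unfolding bij_betw_def
  proof (intro conjI inj_onI set_eqI iffI)
    fix x y assume xy: "x \<in> A" "y \<in> A" "h (f x) x = h (f y) y"
    then have "f x = f y" using mem by metis
    with xy show "x = y" using bij_betw_imp_inj_on [OF h [of "f x"]] by (auto dest: inj_onD)
  next
    fix b assume "b \<in> B"
    then have "b \<in> h (g b) ` {a \<in> A. f a = g b}" using bij_betw_imp_surj_on [OF h [of "g b"]] by blast
    then show "b \<in> (\<lambda>a. h (f a) a) ` A" by force
  qed (use mem in blast)
  with mem show ?thesis by blast
qed

text \<open>The numbers of blocks with more than \<open>k\<close> elements are the parts of the conjugate partition.\<close>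

lemma shape_eqI:
  fixes P Q :: "'n::finite set set"
  assumes P: "alpha_partition \<alpha> P" and Q: "alpha_partition \<beta> Q"
    and card: "\<And>k. card {\<Omega> \<in> blocks_at \<alpha> P i. k < card \<Omega>} = card {\<Omega> \<in> blocks_at \<beta> Q i. k < card \<Omega>}"
  shows "shape \<alpha> P i = shape \<beta> Q i"
proof (rule multiset_eqI)
  fix x
  have c: "count (shape \<gamma> R i) x = card {\<Omega> \<in> blocks_at \<gamma> R i. card \<Omega> = x}" for \<gamma> and R :: "'n set set"
    unfolding shape_def by (subst count_image_mset_eq_card_vimage) auto
  show "count (shape \<alpha> P i) x = count (shape \<beta> Q i) x"
  proof (cases x)
    case 0
    have "{\<Omega> \<in> blocks_at \<gamma> R i. card \<Omega> = x} = {}" if "alpha_partition \<gamma> R" for \<gamma> and R :: "'n set set"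
      using partition_onD3 [OF alpha_partition_on [OF that]] by (auto simp: blocks_at_def 0)
    from this [OF P] this [OF Q] show ?thesis by (simp only: c)
  next
    case (Suc k)
    have "card {\<Omega> \<in> blocks_at \<gamma> R i. card \<Omega> = x} + card {\<Omega> \<in> blocks_at \<gamma> R i. x < card \<Omega>} =
        card {\<Omega> \<in> blocks_at \<gamma> R i. k < card \<Omega>}" for \<gamma> and R :: "'n set set"
      by (subst card_Un_disjoint [symmetric]) (auto simp: Suc intro!: arg_cong [where f = card])
    from this [of \<alpha> P] this [of \<beta> Q] show ?thesis using card [of k] card [of x] by (simp add: c)
  qed
qed

text \<open>Blocks are matched first, by level and size, and then elements inside the matched blocks.\<close>

lemma matching_permutation:
  fixes P Q :: "'n::finite set set"
  assumes \<alpha>: "multi_index d \<alpha>" and P: "alpha_partition \<alpha> P"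
    and \<beta>: "multi_index d \<beta>" and Q: "alpha_partition \<beta> Q"
    and shape: "\<And>i. i < d \<Longrightarrow> shape \<alpha> P i = shape \<beta> Q i"
  obtains \<sigma> where "\<sigma> permutes UNIV" "\<beta> = \<alpha> \<circ> inv \<sigma>" "(`) \<sigma> ` P = Q"
proof -
  note pP = alpha_partition_on [OF P] and pQ = alpha_partition_on [OF Q]
  define lev where "lev = (\<lambda>\<gamma> :: 'n \<Rightarrow> nat. \<lambda>\<Omega>. (\<gamma> (SOME j. j \<in> \<Omega>), card \<Omega>))"
  have lev_eq: "lev \<gamma> \<Omega> = (\<gamma> j, card \<Omega>)" if R: "alpha_partition \<gamma> R" "\<Omega> \<in> R" "j \<in> \<Omega>" for \<gamma> R \<Omega> j
    unfolding lev_def using alpha_block [OF R(1,2) someI [of "\<lambda>j. j \<in> \<Omega>", OF R(3)] R(3)] by simp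
  have fibre: "card {\<Omega> \<in> R. lev \<gamma> \<Omega> = (i, k)} = count (shape \<gamma> R i) k"
    if R: "alpha_partition \<gamma> R" for \<gamma> R i k
  proof -
    have "lev \<gamma> \<Omega> = (i, k) \<longleftrightarrow> \<Omega> \<subseteq> level \<gamma> i \<and> card \<Omega> = k" if "\<Omega> \<in> R" for \<Omega>
    proof -
      have "\<Omega> \<noteq> {}" using that partition_onD3 [OF alpha_partition_on [OF R]] by auto
      then obtain j where j: "j \<in> \<Omega>" by blast
      have "\<Omega> \<subseteq> level \<gamma> i \<longleftrightarrow> \<gamma> j = i"
      proof
        assume "\<gamma> j = i"
        then show "\<Omega> \<subseteq> level \<gamma> i" using alpha_block [OF R \<open>\<Omega> \<in> R\<close> _ j] unfolding level_def by blast
      qed (use j in \<open>auto simp: level_def\<close>)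
      then show ?thesis unfolding lev_eq [OF R that j] by simp
    qed
    then have "{\<Omega> \<in> R. lev \<gamma> \<Omega> = (i, k)} = {\<Omega> \<in> blocks_at \<gamma> R i. card \<Omega> = k}"
      by (auto simp: blocks_at_def)
    then show ?thesis
      unfolding shape_def by (subst count_image_mset_eq_card_vimage) auto
  qed
  have out: "shape \<gamma> R i = {#}" if "multi_index d \<gamma>" "alpha_partition \<gamma> R" "\<not> i < d" for \<gamma> R i
  proof -
    have "level \<gamma> i = {}" using that by (auto simp: level_def multi_index_def)
    then have "blocks_at \<gamma> R i = {}"
      using partition_onD3 [OF alpha_partition_on [OF that(2)]] by (auto simp: blocks_at_def)
    then show ?thesis by (simp add: shape_def)
  qed
  have "card {\<Omega> \<in> P. lev \<alpha> \<Omega> = c} = card {\<Omega> \<in> Q. lev \<beta> \<Omega> = c}" for c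
  proof (cases c)
    case (Pair i k)
    then show ?thesis
      using shape [of i] out [OF \<alpha> P, of i] out [OF \<beta> Q, of i] by (cases "i < d") (simp_all add: fibre P Q)
  qed
  from fibrewise_bij [OF _ _ this] obtain h
    where h: "bij_betw h P Q" "\<And>\<Omega>. \<Omega> \<in> P \<Longrightarrow> lev \<beta> (h \<Omega>) = lev \<alpha> \<Omega>" by auto
  have hQ: "h \<Omega> \<in> Q" if "\<Omega> \<in> P" for \<Omega> using h(1) that by (auto simp: bij_betw_def)
  have card_h: "card (h \<Omega>) = card \<Omega>" if "\<Omega> \<in> P" for \<Omega> using h(2) [OF that] by (simp add: lev_def)
  have fib_block: "{i. block R i = \<Omega>} = (if \<Omega> \<in> R then \<Omega> else {})" if "partition_on UNIV R" for R \<Omega>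
    using block_eq [OF that] block_in [OF that] in_block [OF that] by auto
  have "card {i \<in> UNIV. h (block P i) = \<Omega>} = card {i \<in> UNIV. block Q i = \<Omega>}" for \<Omega>
  proof (cases "\<Omega> \<in> Q")
    case True
    then obtain \<Omega>' where \<Omega>': "\<Omega>' \<in> P" "h \<Omega>' = \<Omega>" using h(1) by (auto simp: bij_betw_def)
    have "h (block P i) = \<Omega> \<longleftrightarrow> block P i = \<Omega>'" for i
      using \<Omega>' h(1) block_in [OF pP] by (metis bij_betw_imp_inj_on inj_onD)
    then show ?thesis using fib_block [OF pP, of \<Omega>'] fib_block [OF pQ, of \<Omega>] True \<Omega>' card_h by auto
  next
    case False
    then have "h (block P i) \<noteq> \<Omega>" for i using hQ block_in [OF pP] by blast
    then show ?thesis using fib_block [OF pQ, of \<Omega>] False by simp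
  qed
  from fibrewise_bij [OF _ _ this] obtain \<sigma>
    where \<sigma>: "bij \<sigma>" "\<And>i. block Q (\<sigma> i) = h (block P i)" by auto
  have perm: "\<sigma> permutes UNIV" using \<sigma>(1) by (simp add: permutes_def bij_iff)
  have "\<beta> (\<sigma> i) = \<alpha> i" for i
  proof -
    have "lev \<beta> (block Q (\<sigma> i)) = (\<beta> (\<sigma> i), card (block Q (\<sigma> i)))"
      by (rule lev_eq [OF Q block_in [OF pQ] in_block [OF pQ]])
    moreover have "lev \<alpha> (block P i) = (\<alpha> i, card (block P i))"
      by (rule lev_eq [OF P block_in [OF pP] in_block [OF pP]])
    ultimately show ?thesis using h(2) [OF block_in [OF pP, of i]] \<sigma>(2) [of i] by simp
  qed
  then have "\<beta> = \<alpha> \<circ> inv \<sigma>"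
    using \<sigma>(1) by (metis (no_types, lifting) bij_is_surj comp_apply ext surj_f_inv_f)
  moreover have img: "\<sigma> ` \<Omega> = h \<Omega>" if "\<Omega> \<in> P" for \<Omega>
  proof (rule card_subset_eq)
    show "\<sigma> ` \<Omega> \<subseteq> h \<Omega>"
    proof
      fix y assume "y \<in> \<sigma> ` \<Omega>"
      then obtain i where "i \<in> \<Omega>" "y = \<sigma> i" by blast
      then show "y \<in> h \<Omega>" using \<sigma>(2) [of i] in_block [OF pQ, of y] block_eq [OF pP that, of i] by simp
    qed
    show "card (\<sigma> ` \<Omega>) = card (h \<Omega>)"
      using card_h [OF that] card_image [of \<sigma> \<Omega>] \<sigma>(1) by (metis bij_is_inj inj_on_subset subset_UNIV)
  qed simp
  have "(`) \<sigma> ` P = h ` P" by (rule image_cong) (simp_all add: img)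
  then have "(`) \<sigma> ` P = Q" using h(1) by (simp add: bij_betw_def)
  ultimately show ?thesis using that perm by blast
qed

section \<open>Semi-invariants of minimal degree\<close>

text \<open>The exchange relations express that \<open>y\<close> cannot be antisymmetrized further, over a larger
  block, and the vanishing sums that \<open>y\<close> is killed by the operators that lower an exponent from \<open>b\<close>
  to \<open>a\<close>.  Take a largest block \<open>C\<close> where the claim fails, and the smallest \<open>k\<close> that is missing
  among the \<open>w i div d\<close> with \<open>i \<in> C\<close>, for some \<open>w\<close> in the support.  Each exponent of \<open>w\<close> in \<open>C\<close>
  with quotient above \<open>k\<close> gives one vanishing sum, by lowering it to the quotient \<open>k\<close>.  It consists
  of \<open>cf y w\<close> and of the terms that swap this exponent with one of quotient \<open>k\<close> in another block.
  The terms for blocks larger than \<open>C\<close> vanish, as nothing is missing there.  For a position in a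
  block not larger than \<open>C\<close>, the terms from all the vanishing sums together are the right hand side
  of an exchange relation, whose other terms are zero by the choice of \<open>k\<close>; so they add up to
  \<open>cf y w\<close>.  In total a positive multiple of \<open>cf y w\<close> is zero.\<close>

lemma highest_weight_standard:
  fixes P :: "'n::finite set set"
  assumes d: "d \<ge> 1" and P: "alpha_partition \<alpha> P" and y: "y \<in> Semi d \<alpha> P"
    and exchange: "\<And>C C' x w. C \<in> P \<Longrightarrow> C' \<in> P \<Longrightarrow> C \<noteq> C' \<Longrightarrow> x \<in> C' \<Longrightarrow> (\<And>c. c \<in> C \<Longrightarrow> \<alpha> c = \<alpha> x) \<Longrightarrow>
      card C' \<le> card C \<Longrightarrow> cf y w = (\<Sum>c\<in>C. cf y (w \<circ> swap c x))"
    and lower: "\<And>a b u. a < b \<Longrightarrow> a mod d = b mod d \<Longrightarrow> (\<Sum>i | u i = a. cf y (u(i := b))) = 0"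
    and w: "w \<in> supp y"
  shows "standard d P w"
proof (rule ccontr)
  note part = alpha_partition_on [OF P]
  assume "\<not> standard d P w"
  define bad where "bad = (\<lambda>\<Omega>. \<Omega> \<in> P \<and> (\<exists>w\<in>supp y. (\<lambda>i. w i div d) ` \<Omega> \<noteq> {..<card \<Omega>}))"
  obtain \<Omega>0 where "bad \<Omega>0" using \<open>\<not> standard d P w\<close> w unfolding bad_def standard_def by blast
  moreover have "card \<Omega> < Suc CARD('n)" for \<Omega> :: "'n set" by (simp add: card_mono less_Suc_eq_le)
  ultimately obtain C where C: "bad C" and C_max: "\<And>\<Omega>. bad \<Omega> \<Longrightarrow> card \<Omega> \<le> card C"
    using ex_has_greatest_nat [of bad \<Omega>0 card "Suc CARD('n)"] by blast
  have CP: "C \<in> P" using C by (simp add: bad_def)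
  define miss where "miss = (\<lambda>k. k < card C \<and> (\<exists>w\<in>supp y. k \<notin> (\<lambda>i. w i div d) ` C))"
  have "\<exists>k. miss k"
  proof (rule ccontr)
    assume "\<nexists>k. miss k"
    then have "{..<card C} \<subseteq> (\<lambda>i. w i div d) ` C" if "w \<in> supp y" for w
      using that unfolding miss_def by blast
    then have "(\<lambda>i. w i div d) ` C = {..<card C}" if "w \<in> supp y" for w
      using that card_image_le [of C "\<lambda>i. w i div d"] by (metis card_lessThan card_seteq finite finite_imageI)
    with C show False by (auto simp: bad_def)
  qed
  define k where "k = (LEAST k. miss k)"
  have "miss k" unfolding k_def using \<open>\<exists>k. miss k\<close> by (auto intro: LeastI)
  then obtain w where k: "k < card C" and w: "w \<in> supp y" and k_miss: "k \<notin> (\<lambda>i. w i div d) ` C"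
    unfolding miss_def by blast
  have below: "k' \<in> (\<lambda>i. u i div d) ` C" if "k' < k" "u \<in> supp y" for k' u
  proof -
    have "\<not> miss k'" using that(1) unfolding k_def by (rule not_less_Least)
    then show ?thesis using that k unfolding miss_def by (meson less_trans)
  qed
  have injw: "inj_on (\<lambda>i. w i div d) \<Omega>" if "\<Omega> \<in> P" for \<Omega> using Semi_div_inj [OF P y w that] .
  note res = Semi_residue [OF y w]
  have "C \<noteq> {}" using CP partition_onD3 [OF part] by auto
  then obtain c0 where c0: "c0 \<in> C" by blast
  have \<alpha>C: "\<alpha> c = \<alpha> c0" if "c \<in> C" for c using alpha_block [OF P CP that c0] .
  define a where "a = \<alpha> c0 + d * k"
  have "\<alpha> c0 < d" using res [of c0] d by (metis mod_less_divisor less_le_trans zero_less_one)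
  then have a: "a mod d = \<alpha> c0" "a div d = k" by (simp_all add: a_def)
  define H where "H = {x \<in> C. k < w x div d}"
  define L where "L = {x \<in> C. w x div d < k}"
  define I where "I = {i. w i = a}"
  have HL: "C = H \<union> L" "H \<inter> L = {}" using k_miss by (auto simp: H_def L_def)
  have "card L \<le> k"
  proof -
    have "card L = card ((\<lambda>i. w i div d) ` L)"
      by (rule card_image [symmetric]) (rule inj_on_subset [OF injw [OF CP]], auto simp: L_def)
    also have "\<dots> \<le> card {..<k}" by (rule card_mono) (auto simp: L_def)
    finally show ?thesis by simp
  qed
  then have "card H \<noteq> 0" using k HL by (metis card_eq_0_iff finite leD sup_bot_left)
  have rel: "cf y w + (\<Sum>i\<in>I. cf y (w \<circ> swap i x)) = 0" if x: "x \<in> H" for x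
  proof -
    have wx: "w x mod d = a mod d" "a < w x"
    proof -
      show "w x mod d = a mod d" using res [of x] \<alpha>C [of x] x by (simp add: a(1) H_def)
      show "a < w x"
      proof (rule ccontr)
        assume "\<not> a < w x"
        then have "w x div d \<le> a div d" by (intro div_le_mono) simp
        then show False using x by (simp add: a(2) H_def)
      qed
    qed
    let ?u = "w(x := a)"
    have set: "{i. ?u i = a} = insert x I" by (auto simp: I_def)
    have "x \<notin> I" using wx(2) by (simp add: I_def)
    have "?u(i := w x) = w \<circ> swap i x" if "i \<in> I" for i
      using that by (auto simp: I_def fun_eq_iff Transposition.transpose_def)
    then have "(\<Sum>i\<in>I. cf y (?u(i := w x))) = (\<Sum>i\<in>I. cf y (w \<circ> swap i x))" by simp
    moreover have "?u(x := w x) = w" by simp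
    ultimately have "(\<Sum>i | ?u i = a. cf y (?u(i := w x))) = cf y w + (\<Sum>i\<in>I. cf y (w \<circ> swap i x))"
      unfolding set using \<open>x \<notin> I\<close> by (simp del: fun_upd_upd)
    then show ?thesis using lower [of a "w x" ?u] wx by simp
  qed
  define I' where "I' = {i \<in> I. card (block P i) \<le> card C}"
  have inner: "(\<Sum>x\<in>H. cf y (w \<circ> swap i x)) = (if i \<in> I' then cf y w else 0)" if i: "i \<in> I" for i
  proof -
    define C' where "C' = block P i"
    have C': "C' \<in> P" "i \<in> C'" by (simp_all add: C'_def block_in [OF part] in_block [OF part])
    have wi: "w i = a" using i by (simp add: I_def)
    have "i \<notin> C" using k_miss wi a(2) by blast
    then have "C \<noteq> C'" using C' by blast
    then have disj: "C \<inter> C' = {}" using block_unique [OF part CP C'(1)] by blast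
    show ?thesis
    proof (cases "card C' \<le> card C")
      case True
      have "\<alpha> i = \<alpha> c0" using res [of i] wi a(1) by simp
      then have "cf y w = (\<Sum>c\<in>C. cf y (w \<circ> swap c i))"
        by (intro exchange [OF CP C'(1) \<open>C \<noteq> C'\<close> C'(2)] True) (simp add: \<alpha>C)
      also have "\<dots> = (\<Sum>c\<in>H. cf y (w \<circ> swap c i)) + (\<Sum>c\<in>L. cf y (w \<circ> swap c i))"
        unfolding HL(1) by (rule sum.union_disjoint) (simp_all add: HL(2))
      also have "(\<Sum>c\<in>L. cf y (w \<circ> swap c i)) = 0"
      proof (rule sum.neutral, rule ballI, rule ccontr)
        fix c assume c: "c \<in> L" and nz: "cf y (w \<circ> swap c i) \<noteq> 0"
        have "w c div d < k" "c \<in> C" using c by (simp_all add: L_def)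
        then obtain j where j: "j \<in> C" "w (swap c i j) div d = w c div d"
          using below [of "w c div d" "w \<circ> swap c i"] nz by (force simp: supp_iff)
        show False
        proof (cases "j = c")
          case True
          then show False using j(2) wi a(2) \<open>w c div d < k\<close> by simp
        next
          case False
          moreover have "j \<noteq> i" using j(1) \<open>i \<notin> C\<close> by blast
          ultimately have "w j div d = w c div d" using j(2) by (simp add: Transposition.transpose_def)
          then show False using False injw [OF CP] j(1) \<open>c \<in> C\<close> by (auto dest: inj_onD)
        qed
      qed
      finally show ?thesis
        using True i by (simp add: I'_def C'_def transpose_commute [of i] del: comp_apply)
    next
      case False
      then have good: "(\<lambda>j. u j div d) ` C' = {..<card C'}" if "u \<in> supp y" for u
        using C_max [of C'] C'(1) that unfolding bad_def by blast
      have "cf y (w \<circ> swap i x) = 0" if x: "x \<in> H" for x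
      proof (rule ccontr)
        assume "cf y (w \<circ> swap i x) \<noteq> 0"
        then have "k \<in> (\<lambda>j. (w \<circ> swap i x) j div d) ` C'"
          using good [of "w \<circ> swap i x"] k False by (simp add: supp_iff)
        then obtain j where j: "j \<in> C'" "w (swap i x j) div d = k" by auto
        have "x \<in> C" "k < w x div d" using x by (simp_all add: H_def)
        then have "j \<noteq> x" using disj j(1) by blast
        have "j \<noteq> i" using j(2) \<open>k < w x div d\<close> by auto
        then have "w j div d = w i div d" using j(2) \<open>j \<noteq> x\<close> wi a(2) by (simp add: Transposition.transpose_def)
        then show False using \<open>j \<noteq> i\<close> injw [OF C'(1)] j(1) C'(2) by (auto dest: inj_onD)
      qed
      then show ?thesis using False by (simp add: I'_def C'_def)
    qed
  qed
  have "0 = (\<Sum>x\<in>H. cf y w + (\<Sum>i\<in>I. cf y (w \<circ> swap i x)))" by (simp add: rel)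
  also have "\<dots> = of_nat (card H) * cf y w + (\<Sum>i\<in>I. \<Sum>x\<in>H. cf y (w \<circ> swap i x))"
    by (simp add: sum.distrib) (rule sum.swap)
  also have "(\<Sum>i\<in>I. \<Sum>x\<in>H. cf y (w \<circ> swap i x)) = (\<Sum>i\<in>I. if i \<in> I' then cf y w else 0)"
    by (rule sum.cong) (simp_all add: inner)
  also have "\<dots> = of_nat (card I') * cf y w"
  proof -
    have "I \<inter> I' = I'" by (auto simp: I'_def)
    then show ?thesis using sum.inter_restrict [of I "\<lambda>_. cf y w" I'] by simp
  qed
  finally have "of_nat (card H + card I') * cf y w = 0" by (simp add: distrib_right)
  then show False using \<open>card H \<noteq> 0\<close> w by (simp add: supp_iff del: of_nat_add)
qed

section \<open>Isomorphic modules\<close>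

definition content :: "('n::finite \<Rightarrow> nat) \<Rightarrow> nat multiset" where
  "content w = image_mset w (mset_set UNIV)"

lemma count_content: "count (content w) k = card {j. w j = k}"
  unfolding content_def by (subst count_image_mset_eq_card_vimage) auto

lemma content_wt: "content u = content w \<Longrightarrow> wt u = wt w"
  unfolding content_def wt_def sum_unfold_sum_mset by simp

lemma standard_content:
  fixes P :: "'n::finite set set"
  assumes d: "d \<ge> 1" and P: "alpha_partition \<alpha> P" and p: "p \<in> Semi d \<alpha> P" "u \<in> supp p" "standard d P u"
    and q: "q \<in> Semi d \<alpha> P" "w \<in> supp q" "standard d P w"
  shows "content u = content w"
proof (rule multiset_eqI)
  fix k
  have k: "k mod d < d" "k = k mod d + d * (k div d)" using d by simp_all
  have "card {j. u j = k mod d + d * (k div d)} = card {j. w j = k mod d + d * (k div d)}"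
    unfolding standard_count [OF P p k(1)] standard_count [OF P q k(1)] ..
  then show "count (content u) k = count (content w) k" unfolding count_content k(2) [symmetric] .
qed

definition adm :: "nat \<Rightarrow> ('n \<Rightarrow> nat) \<Rightarrow> 'n set set \<Rightarrow> bool" where
  "adm d \<alpha> P \<longleftrightarrow> multi_index d \<alpha> \<and> alpha_partition \<alpha> P"

definition gen :: "('n set set \<Rightarrow> 'n cpoly) \<Rightarrow> ('n::finite \<Rightarrow> nat) \<Rightarrow> 'n set set \<Rightarrow> 'n cpoly" where
  "gen s \<alpha> P = s P * xpow \<alpha>"

definition gen_deg :: "('n set set \<Rightarrow> 'n cpoly) \<Rightarrow> ('n::finite \<Rightarrow> nat) \<Rightarrow> 'n set set \<Rightarrow> nat" where
  "gen_deg s \<alpha> P = (SOME m. hom_deg m (gen s \<alpha> P))"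

definition gen_mod :: "nat \<Rightarrow> ('n set set \<Rightarrow> 'n cpoly) \<Rightarrow> ('n::finite \<Rightarrow> nat) \<Rightarrow> 'n set set \<Rightarrow> 'n cpoly set" where
  "gen_mod d s \<alpha> P = {D (gen s \<alpha> P) | D. D \<in> inv_ops d {}}"

text \<open>This is the projection to the semi-invariants of the diagonal group for the character \<open>\<alpha>\<close>.\<close>

definition residue_part :: "nat \<Rightarrow> ('n::finite \<Rightarrow> nat) \<Rightarrow> 'n oper" where
  "residue_part d \<alpha> = diag (\<lambda>w. if \<forall>i. w i mod d = \<alpha> i then 1 else 0)"

context
  fixes d :: nat and s :: "'n::finite set set \<Rightarrow> 'n cpoly"
  assumes d: "d \<ge> 1"
    and jacobian: "\<forall>\<alpha> P. multi_index d \<alpha> \<longrightarrow> alpha_partition \<alpha> P \<longrightarrow> is_jacobian d P (s P)"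
begin

lemma adm_partition: "adm d \<alpha> P \<Longrightarrow> alpha_partition \<alpha> P"
  by (simp add: adm_def)

lemma Semi_gen:
  assumes "adm d \<alpha> P"
  shows "Semi d \<alpha> P = {f * gen s \<alpha> P | f. f \<in> inv_polys d P}"
    and "gen s \<alpha> P \<in> Semi d \<alpha> P" and "gen s \<alpha> P \<noteq> 0" and "hom_deg (gen_deg s \<alpha> P) (gen s \<alpha> P)"
proof -
  have \<alpha>: "multi_index d \<alpha>" and P: "alpha_partition \<alpha> P" using assms by (simp_all add: adm_def)
  note S = Semi_structure [OF d \<alpha> P jacobian [rule_format, OF \<alpha> P], folded gen_def]
  show "Semi d \<alpha> P = {f * gen s \<alpha> P | f. f \<in> inv_polys d P}" "gen s \<alpha> P \<in> Semi d \<alpha> P" "gen s \<alpha> P \<noteq> 0"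
    by (rule S)+
  show "hom_deg (gen_deg s \<alpha> P) (gen s \<alpha> P)" unfolding gen_deg_def by (rule someI_ex [OF S(4)])
qed

lemma Semi_adm_submodule: "adm d \<alpha> P \<Longrightarrow> op_submodule (inv_ops d P) (Semi d \<alpha> P)"
  by (simp add: adm_def Semi_submodule [OF d])

lemma inv_ops_full: "D \<in> inv_ops d {} \<Longrightarrow> D \<in> inv_ops d P"
  using inv_ops_antimono [OF d block_perms_subset_empty] by blast

lemma image_of_simple:
  fixes \<phi> :: "'n oper"
  assumes M: "op_simple (inv_ops d {}) M"
    and add: "\<forall>x y. \<phi> (x + y) = \<phi> x + \<phi> y" and op: "\<forall>D\<in>inv_ops d {}. \<forall>x. \<phi> (D x) = D (\<phi> x)"
    and x: "x \<in> M" "\<phi> x \<noteq> 0"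
  shows "op_iso (inv_ops d {}) M (\<phi> ` M)" and "op_simple (inv_ops d {}) (\<phi> ` M)"
proof -
  have R0: "D 0 = 0" if "D \<in> inv_ops d {}" for D :: "'n oper" by (rule weyl_0 [OF inv_ops_weyl [OF that]])
  note im = op_simple_image [where R = "inv_ops d {}" and M = M and \<phi> = \<phi> and x = x]
  show "op_iso (inv_ops d {}) M (\<phi> ` M)"
    by (rule im(1)) (rule M, use add in blast, use op in blast, erule R0, (rule x)+)
  show "op_simple (inv_ops d {}) (\<phi> ` M)"
    by (rule im(2)) (rule M, use add in blast, use op in blast, erule R0, (rule x)+)
qed

lemmas adm_cyclic = cyclic_structure [OF d Semi_gen(1) Semi_adm_submodule Semi_gen(3) Semi_gen(4)]

lemma gen_mod_simple: "adm d \<alpha> P \<Longrightarrow> op_simple (inv_ops d {}) (gen_mod d s \<alpha> P)"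
  unfolding gen_mod_def by (rule adm_cyclic(2)) (simp_all add: block_perms_subset_empty)

lemma gen_mod_submodule: "op_submodule (inv_ops d {}) (gen_mod d s \<alpha> P)"
  unfolding gen_mod_def by (rule inv_ops_submodule [OF d])

lemma gen_mod_subset: "adm d \<alpha> P \<Longrightarrow> gen_mod d s \<alpha> P \<subseteq> Semi d \<alpha> P"
  unfolding gen_mod_def
  using op_submodule_op [OF Semi_adm_submodule _ Semi_gen(2)] inv_ops_full by blast

lemma gen_in_gen_mod: "gen s \<alpha> P \<in> gen_mod d s \<alpha> P"
  unfolding gen_mod_def using inv_ops_const [OF d, of 1] by force

lemma gen_multiple:
  assumes "adm d \<alpha> P" "u \<in> Semi d \<alpha> P" "u \<noteq> 0" "hom_deg (gen_deg s \<alpha> P) u"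
  shows "\<exists>c. c \<noteq> 0 \<and> u = Cst c * gen s \<alpha> P"
proof -
  obtain c where "hom_part (gen_deg s \<alpha> P) u = Cst c * gen s \<alpha> P"
    using adm_cyclic(3) [OF assms(1,1,1,1,2)] by blast
  then have "u = Cst c * gen s \<alpha> P" using hom_part_hom_deg [OF assms(4)] by simp
  with assms(3) show ?thesis by (intro exI [of _ c]) auto
qed

lemma gen_standard: "adm d \<alpha> P \<Longrightarrow> w \<in> supp (gen s \<alpha> P) \<Longrightarrow> standard d P w"
  unfolding adm_def gen_def using generator_standard [OF d] jacobian by blast

text \<open>Sums over the variables of operators counting the exponents equal to \<open>k\<close> are invariant, so an
  isomorphism preserves contents and degrees.\<close>

lemma iso_content:
  assumes P: "adm d \<alpha> P" and iso: "op_iso (inv_ops d {}) (gen_mod d s \<alpha> P) N" and w: "w \<in> supp (gen s \<alpha> P)"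
  obtains y where "y \<in> N" "y \<noteq> 0" "\<And>u. u \<in> supp y \<Longrightarrow> content u = content w"
proof -
  obtain \<phi> where b: "bij_betw \<phi> (gen_mod d s \<alpha> P) N"
    and add: "\<forall>x\<in>gen_mod d s \<alpha> P. \<forall>y\<in>gen_mod d s \<alpha> P. \<phi> (x + y) = \<phi> x + \<phi> y"
    and op: "\<forall>D\<in>inv_ops d {}. \<forall>x\<in>gen_mod d s \<alpha> P. \<phi> (D x) = D (\<phi> x)"
    using iso unfolding op_iso_def by blast
  define v where "v = gen s \<alpha> P"
  define y where "y = \<phi> v"
  have v: "v \<in> gen_mod d s \<alpha> P" "v \<noteq> 0" by (simp_all add: v_def gen_in_gen_mod Semi_gen(3) [OF P])
  have "y \<in> N" using b v(1) by (auto simp: y_def bij_betw_def)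
  moreover have "y \<noteq> 0"
  proof
    assume "y = 0"
    have 0: "0 \<in> gen_mod d s \<alpha> P" using op_submodule_0 [OF gen_mod_submodule] .
    then have "\<phi> 0 = 0" using add by fastforce
    with \<open>y = 0\<close> have "v = 0" using b v(1) 0 unfolding y_def bij_betw_def by (metis inj_onD)
    with v(2) show False ..
  qed
  moreover have "content u = content w" if u: "u \<in> supp y" for u
  proof (rule multiset_eqI)
    fix k
    obtain N1 N2 where "\<forall>u\<in>supp v. \<forall>i. u i \<le> N1" "\<forall>u\<in>supp y. \<forall>i. u i \<le> N2" using supp_bound by metis
    then have N: "\<forall>u\<in>supp v. \<forall>i. u i \<le> max N1 N2" "\<forall>u\<in>supp y. \<forall>i. u i \<le> max N1 N2"
      by (auto simp: le_max_iff_disj)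
    obtain E where E: "E \<in> inv_ops d {}"
      and Ep: "\<forall>p :: 'n cpoly. (\<forall>u\<in>supp p. \<forall>i. u i \<le> max N1 N2) \<longrightarrow>
        (\<forall>w. cf (E p) w = (\<Sum>i | w i = k. cf p (w(i := k))))"
      using exchange_op [OF d refl] by (rule bexE)
    have count: "cf (E p) w = of_nat (count (content w) k) * cf p w"
      if "\<forall>u\<in>supp p. \<forall>i. u i \<le> max N1 N2" for p w
    proof -
      have "(\<Sum>i | w i = k. cf p (w(i := k))) = (\<Sum>i | w i = k. cf p w)"
        by (rule sum.cong [OF refl]) (auto intro!: arg_cong [where f = "cf p"])
      moreover have "cf (E p) w = (\<Sum>i | w i = k. cf p (w(i := k)))" using Ep that by blast
      ultimately show ?thesis by (simp add: count_content)
    qed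
    define c :: complex where "c = of_nat (count (content w) k)"
    have "E v = Cst c * v"
    proof (rule cf_eqI)
      fix x
      have "content x = content w" if "x \<in> supp v"
        using that w gen_standard [OF P] unfolding v_def
        by (intro standard_content [OF d adm_partition [OF P] Semi_gen(2) [OF P] _ _ Semi_gen(2) [OF P]] P)
      then show "cf (E v) x = cf (Cst c * v) x"
        by (cases "x \<in> supp v") (auto simp: count [OF N(1)] c_def supp_iff)
    qed
    then have "E y = Cst c * y"
      using op E v(1) inv_ops_const [OF d] unfolding y_def by metis
    then have "cf (E y) u = c * cf y u" by simp
    then show "count (content u) k = count (content w) k"
      using u unfolding count [OF N(2)] c_def by (simp add: supp_iff)
  qed
  ultimately show ?thesis using that by blast
qed

text \<open>Let \<open>y\<close> be the image of the generator of the first module.  It has the degree of that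
  generator, and it is a semi-invariant for the second partition, so the degree of the second
  generator is not larger.  By symmetry the degrees are equal, hence \<open>y\<close> is a multiple of the
  second generator, and the contents of the generators agree.\<close>

lemma gen_mod_iso_imp:
  assumes P: "adm d \<alpha> P" and Q: "adm d \<beta> Q"
    and iso: "op_iso (inv_ops d {}) (gen_mod d s \<alpha> P) (gen_mod d s \<beta> Q)" and i: "i < d"
  shows "shape \<alpha> P i = shape \<beta> Q i"
proof -
  have deg: "gen_deg s \<beta>' Q' \<le> gen_deg s \<alpha>' P'"
    if h: "adm d \<alpha>' P'" "adm d \<beta>' Q'" "op_iso (inv_ops d {}) (gen_mod d s \<alpha>' P') (gen_mod d s \<beta>' Q')" for \<alpha>' \<beta>' P' Q'
  proof -
    obtain w where w: "w \<in> supp (gen s \<alpha>' P')" using exists_supp [OF Semi_gen(3) [OF h(1)]] by blast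
    obtain y where y: "y \<in> gen_mod d s \<beta>' Q'" "y \<noteq> 0" "\<And>u. u \<in> supp y \<Longrightarrow> content u = content w"
      using iso_content [OF h(1,3) w] by blast
    obtain u where u: "u \<in> supp y" using exists_supp [OF y(2)] by blast
    have "gen_deg s \<beta>' Q' \<le> wt u"
      using gen_mod_subset [OF h(2)] y(1) u by (intro adm_cyclic(4) [OF h(2,2,2,2)]) auto
    also have "wt u = gen_deg s \<alpha>' P'" using content_wt [OF y(3) [OF u]] Semi_gen(4) [OF h(1)] w by simp
    finally show ?thesis .
  qed
  have eq: "gen_deg s \<beta> Q = gen_deg s \<alpha> P"
    using deg [OF P Q iso] deg [OF Q P op_iso_sym [OF iso gen_mod_submodule]] by simp
  obtain w where w: "w \<in> supp (gen s \<alpha> P)" using exists_supp [OF Semi_gen(3) [OF P]] by blast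
  obtain y where y: "y \<in> gen_mod d s \<beta> Q" "y \<noteq> 0" "\<And>u. u \<in> supp y \<Longrightarrow> content u = content w"
    using iso_content [OF P iso w] by blast
  have "hom_deg (gen_deg s \<beta> Q) y"
    using content_wt [OF y(3)] Semi_gen(4) [OF P] w eq by metis
  then obtain c where "c \<noteq> 0" "y = Cst c * gen s \<beta> Q"
    using gen_multiple [OF Q _ y(2)] gen_mod_subset [OF Q] y(1) by blast
  then have supp: "supp y = supp (gen s \<beta> Q)" by (auto simp: supp_iff)
  obtain u where u: "u \<in> supp (gen s \<beta> Q)" using exists_supp [OF Semi_gen(3) [OF Q]] by blast
  have cont: "content u = content w" using y(3) u supp by blast
  show ?thesis
  proof (rule shape_eqI [OF adm_partition [OF P] adm_partition [OF Q]])
    fix k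
    have "card {j. w j = i + d * k} = card {j. u j = i + d * k}"
      using cont by (metis count_content)
    then show "card {\<Omega> \<in> blocks_at \<alpha> P i. k < card \<Omega>} = card {\<Omega> \<in> blocks_at \<beta> Q i. k < card \<Omega>}"
      using standard_count [OF adm_partition [OF P] Semi_gen(2) [OF P] w gen_standard [OF P w] i]
        standard_count [OF adm_partition [OF Q] Semi_gen(2) [OF Q] u gen_standard [OF Q u] i]
      by simp
  qed
qed

lemma perm_act_Semi:
  assumes \<sigma>: "\<sigma> permutes UNIV" and \<beta>: "\<beta> = \<alpha> \<circ> inv \<sigma>" and Q: "(`) \<sigma> ` P = Q" and p: "p \<in> Semi d \<alpha> P"
  shows "perm_act \<sigma> p \<in> Semi d \<beta> Q"
proof -
  have b: "bij \<sigma>" using \<sigma> by (rule permutes_bij)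
  have inv: "inv \<sigma> (\<sigma> i) = i" "\<sigma> (inv \<sigma> i) = i" for i
    using b by (simp_all add: bij_is_inj bij_is_surj surj_f_inv_f)
  have "w i mod d = \<beta> i" if "w \<in> supp (perm_act \<sigma> p)" for w i
  proof -
    have "w \<circ> \<sigma> \<in> supp p" using that by (simp add: supp_iff cf_perm_act [OF b])
    from Semi_residue [OF p this, of "inv \<sigma> i"] show ?thesis by (simp add: inv \<beta>)
  qed
  moreover have "perm_act \<tau> (perm_act \<sigma> p) = sgn_poly \<tau> * perm_act \<sigma> p" if \<tau>: "\<tau> \<in> block_perms Q" for \<tau>
  proof -
    define \<rho> where "\<rho> = inv \<sigma> \<circ> \<tau> \<circ> \<sigma>"
    have t: "\<tau> permutes UNIV" using \<tau> by (simp add: block_perms_def)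
    have "\<rho> permutes UNIV" unfolding \<rho>_def by (intro permutes_compose permutes_inv \<sigma> t)
    moreover have "\<rho> ` \<Omega> = \<Omega>" if "\<Omega> \<in> P" for \<Omega>
    proof -
      have "\<sigma> ` \<Omega> \<in> Q" using that Q by blast
      then have "\<tau> ` (\<sigma> ` \<Omega>) = \<sigma> ` \<Omega>" using \<tau> unfolding block_perms_def by blast
      then have "\<rho> ` \<Omega> = inv \<sigma> ` \<sigma> ` \<Omega>" by (simp add: \<rho>_def image_comp [symmetric] del: comp_apply)
      then show ?thesis by (simp add: image_image inv)
    qed
    ultimately have \<rho>: "\<rho> \<in> block_perms P" by (simp add: block_perms_def)
    have perm: "permutation \<sigma>" "permutation \<tau>" "permutation (inv \<sigma>)"
      using \<sigma> t by (auto simp: permutation_permutes intro: permutes_inv)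
    have "sign \<rho> = sign \<sigma> * sign \<tau> * sign \<sigma>"
      using perm by (simp add: \<rho>_def sign_compose permutation_compose sign_inverse)
    then have sgn: "sign \<rho> = sign \<tau>" using sign_idempotent [of \<sigma>] by (simp add: mult.commute mult.left_commute)
    have "\<tau> \<circ> \<sigma> = \<sigma> \<circ> \<rho>" by (auto simp: \<rho>_def fun_eq_iff inv)
    then have "perm_act \<tau> (perm_act \<sigma> p) = perm_act \<sigma> (perm_act \<rho> p)" by (simp add: perm_act_comp)
    then show ?thesis by (simp add: Semi_perm_act [OF p \<rho>] perm_act_mult sgn)
  qed
  ultimately show ?thesis by (simp add: Semi_def)
qed

lemma hom_deg_perm_act: "bij \<sigma> \<Longrightarrow> hom_deg m p \<Longrightarrow> hom_deg m (perm_act \<sigma> p)"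
proof
  fix w assume b: "bij \<sigma>" and p: "hom_deg m p" and "w \<in> supp (perm_act \<sigma> p)"
  then have "w \<circ> \<sigma> \<in> supp p" by (simp add: supp_iff cf_perm_act)
  then show "wt w = m" using p wt_comp [OF b, of w] by metis
qed

lemma perm_act_eq_0: "bij \<sigma> \<Longrightarrow> perm_act \<sigma> p = 0 \<Longrightarrow> p = 0"
  by (metis perm_act_0 perm_act_inverse(2))

text \<open>The permutation maps a generator to a semi-invariant for the other partition.  Applied to the
  permutation and to its inverse this shows that the degrees are equal, so it maps generator to
  generator up to a constant.\<close>

lemma gen_mod_iso_perm:
  assumes P: "adm d \<alpha> P" and Q: "adm d \<beta> Q"
    and \<sigma>: "\<sigma> permutes UNIV" and \<beta>: "\<beta> = \<alpha> \<circ> inv \<sigma>" and PQ: "(`) \<sigma> ` P = Q"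
  shows "op_iso (inv_ops d {}) (gen_mod d s \<alpha> P) (gen_mod d s \<beta> Q)"
proof -
  have b: "bij \<sigma>" using \<sigma> by (rule permutes_bij)
  have deg: "gen_deg s \<beta>' Q' \<le> gen_deg s \<alpha>' P'"
    if h: "adm d \<alpha>' P'" "adm d \<beta>' Q'" "\<tau> permutes UNIV" "\<beta>' = \<alpha>' \<circ> inv \<tau>" "(`) \<tau> ` P' = Q'" for \<alpha>' \<beta>' P' Q' \<tau>
  proof -
    have bt: "bij \<tau>" using h(3) by (rule permutes_bij)
    have "perm_act \<tau> (gen s \<alpha>' P') \<noteq> 0" using perm_act_eq_0 [OF bt] Semi_gen(3) [OF h(1)] by blast
    then obtain w where w: "w \<in> supp (perm_act \<tau> (gen s \<alpha>' P'))" using exists_supp by blast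
    have "gen_deg s \<beta>' Q' \<le> wt w"
      by (rule adm_cyclic(4) [OF h(2,2,2,2) perm_act_Semi [OF h(3,4,5) Semi_gen(2) [OF h(1)]] w])
    also have "wt w = gen_deg s \<alpha>' P'" using hom_deg_perm_act [OF bt Semi_gen(4) [OF h(1)]] w by blast
    finally show ?thesis .
  qed
  have "\<alpha> = \<beta> \<circ> inv (inv \<sigma>)"
    using b by (simp add: \<beta> inv_inv_eq comp_assoc inv_o_cancel bij_is_inj)
  moreover have "(`) (inv \<sigma>) ` Q = P"
  proof -
    have "inv \<sigma> ` \<sigma> ` \<Omega> = \<Omega>" for \<Omega> using b by (simp add: image_inv_f_f bij_is_inj)
    then show ?thesis unfolding PQ [symmetric] image_image by simp
  qed
  ultimately have "gen_deg s \<alpha> P \<le> gen_deg s \<beta> Q" by (intro deg [OF Q P permutes_inv [OF \<sigma>]])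
  then have eq: "gen_deg s \<alpha> P = gen_deg s \<beta> Q" using deg [OF P Q \<sigma> \<beta> PQ] by simp
  have nz: "perm_act \<sigma> (gen s \<alpha> P) \<noteq> 0" using perm_act_eq_0 [OF b] Semi_gen(3) [OF P] by blast
  have "hom_deg (gen_deg s \<beta> Q) (perm_act \<sigma> (gen s \<alpha> P))" using hom_deg_perm_act [OF b Semi_gen(4) [OF P]] eq by simp
  then obtain c where c: "c \<noteq> 0" "perm_act \<sigma> (gen s \<alpha> P) = Cst c * gen s \<beta> Q"
    using gen_multiple [OF Q perm_act_Semi [OF \<sigma> \<beta> PQ Semi_gen(2) [OF P]] nz] by blast
  have sg: "\<sigma> \<in> block_perms {}" using \<sigma> by (simp add: block_perms_def)
  have comm: "perm_act \<sigma> (D x) = D (perm_act \<sigma> x)" if "D \<in> inv_ops d {}" for D x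
    using that sg by (simp add: inv_ops_iff [OF d])
  have im: "op_iso (inv_ops d {}) (gen_mod d s \<alpha> P) (perm_act \<sigma> ` gen_mod d s \<alpha> P)"
    "op_simple (inv_ops d {}) (perm_act \<sigma> ` gen_mod d s \<alpha> P)"
    using image_of_simple [of _ "perm_act \<sigma>", OF gen_mod_simple [OF P] _ _ gen_in_gen_mod nz] perm_act_add comm
    by blast+
  have "perm_act \<sigma> (gen s \<alpha> P) \<in> perm_act \<sigma> ` gen_mod d s \<alpha> P" by (rule imageI [OF gen_in_gen_mod])
  moreover have "perm_act \<sigma> (gen s \<alpha> P) \<in> gen_mod d s \<beta> Q"
    unfolding c(2) by (rule op_submodule_scale [OF d gen_mod_submodule gen_in_gen_mod])
  ultimately have "perm_act \<sigma> ` gen_mod d s \<alpha> P = gen_mod d s \<beta> Q"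
    using op_simple_eqI [OF im(2) gen_mod_submodule] op_simple_eqI [OF gen_mod_simple [OF Q]] im(2) nz
    unfolding op_simple_def by blast
  with im(1) show ?thesis by simp
qed

section \<open>Every simple submodule\<close>

lemma residue_part_Semi:
  "multi_index d \<alpha> \<Longrightarrow> residue_part d \<alpha> p \<in> Semi d \<alpha> singles"
  by (auto simp: Semi_def block_perms_singles sign_id supp_iff residue_part_def split: if_splits)

lemma residue_part_add: "residue_part d \<alpha> (p + q) = residue_part d \<alpha> p + residue_part d \<alpha> q"
  by (rule cf_eqI) (simp add: residue_part_def algebra_simps)

text \<open>An operator that commutes with the diagonal group preserves the decomposition of the polynomial
  ring by residues of exponents.\<close>

lemma residue_part_commute:
  fixes \<alpha> :: "'n \<Rightarrow> nat"
  assumes D: "D \<in> inv_ops d {}" and \<alpha>: "multi_index d \<alpha>"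
  shows "residue_part d \<alpha> (D p) = D (residue_part d \<alpha> p)"
proof -
  define B where "B = insert \<alpha> ((\<lambda>w i. w i mod d) ` supp p)"
  have B: "finite B" "\<And>\<beta>. \<beta> \<in> B \<Longrightarrow> multi_index d \<beta>" using d \<alpha> by (auto simp: B_def multi_index_def)
  have part: "residue_part d \<alpha> q = (if \<beta> = \<alpha> then q else 0)" if q: "q \<in> Semi d \<beta> singles" for \<beta> q
  proof (rule cf_eqI)
    fix w
    show "cf (residue_part d \<alpha> q) w = cf (if \<beta> = \<alpha> then q else 0) w"
    proof (cases "w \<in> supp q")
      case True
      then have "(\<forall>i. w i mod d = \<alpha> i) \<longleftrightarrow> \<beta> = \<alpha>" using Semi_residue [OF q True] by auto
      then show ?thesis by (simp add: residue_part_def)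
    qed (simp add: residue_part_def supp_iff)
  qed
  have exp: "p = (\<Sum>\<beta>\<in>B. residue_part d \<beta> p)"
  proof (rule cf_eqI)
    fix w
    have "cf (\<Sum>\<beta>\<in>B. residue_part d \<beta> p) w = (\<Sum>\<beta>\<in>B. if \<beta> = (\<lambda>i. w i mod d) then cf p w else 0)"
      by (simp add: residue_part_def fun_eq_iff if_distrib [of "\<lambda>x. x * _"] eq_commute cong: if_cong)
    also have "\<dots> = cf p w" by (auto simp: B(1)) (auto simp: B_def supp_iff)
    finally show "cf p w = cf (\<Sum>\<beta>\<in>B. residue_part d \<beta> p) w" by simp
  qed
  have mem: "D (residue_part d \<beta> p) \<in> Semi d \<beta> singles" if "\<beta> \<in> B" for \<beta>
    by (rule op_submodule_op [OF Semi_submodule [OF d B(2) [OF that]] inv_ops_full [OF D]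
          residue_part_Semi [OF B(2) [OF that]]])
  have part_sum: "residue_part d \<alpha> (sum f S) = (\<Sum>x\<in>S. residue_part d \<alpha> (f x))" for f and S :: "('n \<Rightarrow> nat) set"
  proof (induct S rule: infinite_finite_induct)
    case empty
    show ?case by (rule cf_eqI) (simp add: residue_part_def)
  next
    case (infinite S)
    then show ?case by (intro cf_eqI) (simp add: residue_part_def)
  qed (simp add: residue_part_add)
  have "residue_part d \<alpha> (D p) = residue_part d \<alpha> (\<Sum>\<beta>\<in>B. D (residue_part d \<beta> p))"
    by (subst exp) (simp only: weyl_sum [OF inv_ops_weyl [OF D]])
  also have "\<dots> = (\<Sum>\<beta>\<in>B. if \<beta> = \<alpha> then D (residue_part d \<beta> p) else 0)"
    by (simp only: part_sum) (rule sum.cong [OF refl part [OF mem]])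
  also have "\<dots> = D (residue_part d \<alpha> p)" using B(1) by (simp add: B_def)
  finally show ?thesis .
qed

lemma singles_adm: "multi_index d \<alpha> \<Longrightarrow> adm d \<alpha> singles"
  unfolding adm_def by (intro conjI alpha_partitionI) (auto simp: partition_on_def disjoint_def)

lemma simple_in_Semi:
  fixes M :: "'n cpoly set"
  assumes M: "op_simple (inv_ops d {}) M"
  shows "\<exists>\<alpha> M'. adm d \<alpha> singles \<and> op_simple (inv_ops d {}) M' \<and> op_iso (inv_ops d {}) M M' \<and> M' \<subseteq> Semi d \<alpha> singles"
proof -
  have "0 \<in> M" using M op_submodule_0 by (auto simp: op_simple_def)
  then obtain x where x: "x \<in> M" "x \<noteq> 0" using M unfolding op_simple_def by blast
  obtain w where w: "w \<in> supp x" using exists_supp [OF x(2)] by blast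
  define \<alpha> where "\<alpha> = (\<lambda>i. w i mod d)"
  have \<alpha>: "multi_index d \<alpha>" using d by (simp add: multi_index_def \<alpha>_def)
  have "cf (residue_part d \<alpha> x) w = cf x w" by (simp add: residue_part_def \<alpha>_def)
  then have nz: "residue_part d \<alpha> x \<noteq> 0" using w by (auto simp: supp_iff)
  have "op_iso (inv_ops d {}) M (residue_part d \<alpha> ` M)" "op_simple (inv_ops d {}) (residue_part d \<alpha> ` M)"
    using image_of_simple [of _ "residue_part d \<alpha>", OF M _ _ x(1) nz] residue_part_add
      residue_part_commute [OF _ \<alpha>]
    by blast+
  moreover have "residue_part d \<alpha> ` M \<subseteq> Semi d \<alpha> singles" using residue_part_Semi [OF \<alpha>] by blast
  ultimately show ?thesis using singles_adm [OF \<alpha>] by blast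
qed

text \<open>The element \<open>x\<close> leaves \<open>C'\<close> for \<open>C\<close>; no empty block may remain when \<open>C' = {x}\<close>.\<close>

definition move :: "'n set set \<Rightarrow> 'n set \<Rightarrow> 'n set \<Rightarrow> 'n \<Rightarrow> 'n set set" where
  "move P C C' x = insert (insert x C) ((P - {C, C'}) \<union> ({C' - {x}} - {{}}))"

lemma move_adm:
  assumes P: "adm d \<alpha> P" and C: "C \<in> P" "C' \<in> P" "C \<noteq> C'" "x \<in> C'" and \<alpha>: "\<And>c. c \<in> C \<Longrightarrow> \<alpha> c = \<alpha> x"
  shows "adm d \<alpha> (move P C C' x)"
proof -
  have ap: "alpha_partition \<alpha> P" and part: "partition_on UNIV P"
    using P alpha_partition_on by (auto simp: adm_def)
  note disj = block_unique [OF part]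
  have "partition_on UNIV (move P C C' x)"
  proof (rule partition_onI)
    have "z \<in> \<Union>(move P C C' x)" for z
    proof -
      obtain \<Omega> where "\<Omega> \<in> P" "z \<in> \<Omega>" using partition_onD1 [OF part] by blast
      then show ?thesis by (cases "\<Omega> = C"; cases "\<Omega> = C'"; cases "z = x") (auto simp: move_def)
    qed
    then show "\<Union>(move P C C' x) = UNIV" by blast
    show "{} \<notin> move P C C' x" using partition_onD3 [OF part] by (auto simp: move_def)
    fix p q assume p: "p \<in> move P C C' x" and q: "q \<in> move P C C' x" and ne: "p \<noteq> q"
    define g where "g = (\<lambda>\<Omega>. if \<Omega> = C then insert x C else if \<Omega> = C' then C' - {x} else \<Omega>)"
    have eq: "r = (if z = x then insert x C else g (block P z))" if r: "r \<in> move P C C' x" "z \<in> r" for r z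
    proof -
      consider "r = insert x C" | "r \<in> P" "r \<noteq> C" "r \<noteq> C'" | "r = C' - {x}"
        using r(1) unfolding move_def by blast
      then show ?thesis
      proof cases
        case 1
        then show ?thesis using r(2) block_eq [OF part C(1), of z] by (auto simp: g_def)
      next
        case 2
        then have "block P z = r" "z \<noteq> x" using block_eq [OF part 2(1) r(2)] disj C r(2) by blast+
        then show ?thesis using 2 by (simp add: g_def)
      next
        case 3
        then have "block P z = C'" "z \<noteq> x" using block_eq [OF part C(2), of z] r(2) by auto
        then show ?thesis using 3 C(3) by (simp add: g_def)
      qed
    qed
    have False if "z \<in> p" "z \<in> q" for z
      using eq [OF p that(1)] eq [OF q that(2)] ne by simp
    then show "disjnt p q" unfolding disjnt_def by blast
  qed
  moreover have "\<alpha> i = \<alpha> j" if \<Omega>: "\<Omega> \<in> move P C C' x" and ij: "i \<in> \<Omega>" "j \<in> \<Omega>" for \<Omega> i j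
  proof -
    consider "\<Omega> = insert x C" | "\<Omega> \<in> P" | "\<Omega> = C' - {x}" using \<Omega> unfolding move_def by blast
    then show ?thesis
    proof cases
      case 1
      then have "\<alpha> i = \<alpha> x" "\<alpha> j = \<alpha> x" using ij \<alpha> by blast+
      then show ?thesis by simp
    next
      case 2
      then show ?thesis by (rule alpha_block [OF ap _ ij])
    next
      case 3
      then show ?thesis using alpha_block [OF ap C(2)] ij by blast
    qed
  qed
  ultimately show ?thesis using P unfolding adm_def by (blast intro: alpha_partitionI)
qed

definition square_sum :: "'n set set \<Rightarrow> nat" where
  "square_sum P = (\<Sum>\<Omega>\<in>P. (card \<Omega>)\<^sup>2)"

text \<open>The sum of the squares grows by \<open>2 (a - b) + 2\<close> if \<open>a \<ge> b\<close> are the sizes of the blocks.\<close>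

lemma square_sum_move:
  assumes P: "partition_on UNIV P" and C: "C \<in> P" "C' \<in> P" "C \<noteq> C'" "x \<in> C'" and le: "card C' \<le> card C"
  shows "square_sum P < square_sum (move P C C' x)"
proof -
  note disj = block_unique [OF P]
  define R where "R = P - {C, C'}"
  have "x \<notin> C" using disj C by blast
  have 1: "square_sum P = square_sum R + (card C)\<^sup>2 + (card C')\<^sup>2"
  proof -
    have "P = insert C (insert C' R)" "C \<notin> insert C' R" "C' \<notin> R" using C by (auto simp: R_def)
    then show ?thesis unfolding square_sum_def by simp
  qed
  have 2: "square_sum (move P C C' x) = square_sum R + (card C + 1)\<^sup>2 + (card C' - 1)\<^sup>2"
  proof -
    have new: "insert x C \<notin> R \<union> ({C' - {x}} - {{}})" using disj C by (auto simp: R_def)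
    have "C' - {x} \<notin> R"
    proof
      assume "C' - {x} \<in> R"
      moreover from this have "C' - {x} \<noteq> {}" using partition_onD3 [OF P] unfolding R_def by (metis DiffD1)
      then obtain z where "z \<in> C' - {x}" by blast
      ultimately show False using disj [of "C' - {x}" C' z] C by (auto simp: R_def)
    qed
    then have "square_sum (R \<union> ({C' - {x}} - {{}})) = square_sum R + (card (C' - {x}))\<^sup>2"
      unfolding square_sum_def by (cases "C' - {x} = {}") (simp_all add: Un_insert_right)
    then show ?thesis
      using new \<open>x \<notin> C\<close> C(4) unfolding move_def R_def [symmetric] by (simp add: square_sum_def)
  qed
  have "card C' > 0" using C(4) by (auto simp: card_gt_0_iff)
  then obtain k where "card C' = Suc k" using gr0_conv_Suc by blast
  then show ?thesis using le unfolding 1 2 by (simp add: power2_eq_square algebra_simps)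
qed

text \<open>The identity and the swaps of \<open>x\<close> with the elements of \<open>C\<close> represent the cosets of the
  permutations of \<open>insert x C\<close> modulo those of \<open>C\<close>, on which \<open>y\<close> is antisymmetric already.\<close>

lemma antisymmetrize_move:
  assumes P: "adm d \<alpha> P" and C: "C \<in> P" "C' \<in> P" "C \<noteq> C'" "x \<in> C'" and \<alpha>: "\<And>c. c \<in> C \<Longrightarrow> \<alpha> c = \<alpha> x"
    and y: "y \<in> Semi d \<alpha> P"
  shows "y - (\<Sum>c\<in>C. perm_act (swap c x) y) \<in> Semi d \<alpha> (move P C C' x)"
proof -
  have part: "partition_on UNIV P" using alpha_partition_on [OF adm_partition [OF P]] .
  note disj = block_unique [OF part]
  have "x \<notin> C" using disj C by blast
  define D where "D = insert x C"
  define z where "z = y - (\<Sum>c\<in>C. perm_act (swap c x) y)"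
  have z: "z = (\<Sum>c\<in>D. sgn_poly (swap c x) * perm_act (swap c x) y)"
  proof -
    have "sgn_poly (swap c x) * perm_act (swap c x) y = - perm_act (swap c x) y"
      if "c \<in> C" for c
      using that \<open>x \<notin> C\<close> by (intro cf_eqI) (auto simp: sign_swap_id)
    then have "(\<Sum>c\<in>C. sgn_poly (swap c x) * perm_act (swap c x) y) =
        - (\<Sum>c\<in>C. perm_act (swap c x) y)"
      by (simp add: sum_negf)
    then show ?thesis using \<open>x \<notin> C\<close> by (simp add: z_def D_def sign_id)
  qed
  have "w i mod d = \<alpha> i" if w: "w \<in> supp z" for w i
  proof -
    have "\<exists>c\<in>D. cf (perm_act (swap c x) y) w \<noteq> 0"
    proof (rule ccontr)
      assume "\<not> ?thesis"
      then have "cf z w = 0" by (simp add: z)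
      with w show False by (simp add: supp_iff)
    qed
    then obtain c where c: "c \<in> D" "w \<circ> swap c x \<in> supp y"
      by (auto simp: supp_iff cf_perm_act)
    have "\<alpha> c = \<alpha> x" using c(1) \<alpha> by (auto simp: D_def)
    have "w i mod d = (w \<circ> swap c x) (swap c x i) mod d" by simp
    also have "\<dots> = \<alpha> (swap c x i)" by (rule Semi_residue [OF y c(2)])
    also have "\<dots> = \<alpha> i" using \<open>\<alpha> c = \<alpha> x\<close> by (simp add: Transposition.transpose_def)
    finally show ?thesis .
  qed
  moreover have "perm_act \<sigma> z = sgn_poly \<sigma> * z" if \<sigma>: "\<sigma> \<in> block_perms (move P C C' x)" for \<sigma>
  proof -
    have perm: "\<sigma> permutes UNIV" and fix_block: "\<And>\<Omega>. \<Omega> \<in> move P C C' x \<Longrightarrow> \<sigma> ` \<Omega> = \<Omega>"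
      using \<sigma> by (auto simp: block_perms_def)
    have \<sigma>D: "\<sigma> ` D = D" by (rule fix_block) (simp add: move_def D_def)
    have bD: "bij_betw \<sigma> D D" using perm \<sigma>D by (metis bij_betw_def inj_on_subset permutes_inj subset_UNIV)
    have summand: "perm_act \<sigma> (sgn_poly (swap c x) * perm_act (swap c x) y) =
        sgn_poly \<sigma> * (sgn_poly (swap (\<sigma> c) x) * perm_act (swap (\<sigma> c) x) y)"
      if c: "c \<in> D" for c
    proof -
      \<comment> \<open>The element \<open>\<tau>\<close> fixes \<open>x\<close>, so it preserves the blocks of \<open>P\<close>.\<close>
      define \<tau> where "\<tau> = swap (\<sigma> c) x \<circ> \<sigma> \<circ> swap c x"
      have "\<sigma> c \<in> D" using c \<sigma>D by blast
      have \<tau>perm: "\<tau> permutes UNIV" unfolding \<tau>_def by (intro permutes_compose permutes_swap_id perm UNIV_I)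
      have im: "\<tau> ` S = swap (\<sigma> c) x ` \<sigma> ` swap c x ` S" for S
        by (simp add: \<tau>_def image_comp [symmetric] del: comp_apply)
      have \<tau>x: "\<tau> x = x" by (simp add: \<tau>_def)
      have outside: "\<tau> ` S = S" if "S \<inter> D = {}" "\<sigma> ` S = S" for S
      proof -
        have "c \<notin> S" "\<sigma> c \<notin> S" "x \<notin> S" using that(1) c \<open>\<sigma> c \<in> D\<close> by (auto simp: D_def)
        then show ?thesis unfolding im by (simp add: that(2))
      qed
      have "\<tau> ` \<Omega> = \<Omega>" if \<Omega>: "\<Omega> \<in> P" for \<Omega>
      proof -
        consider "\<Omega> = C" | "\<Omega> = C'" | "\<Omega> \<noteq> C" "\<Omega> \<noteq> C'" by blast
        then show ?thesis
        proof cases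
          case 1
          have "swap c x ` D = D" "swap (\<sigma> c) x ` D = D"
            using c \<open>\<sigma> c \<in> D\<close> by (intro transpose_image_eq; simp add: D_def)+
          then have "\<tau> ` D = D" unfolding im by (simp only: \<sigma>D)
          moreover have "\<tau> ` (D - {x}) = \<tau> ` D - \<tau> ` {x}"
            by (rule image_set_diff) (rule permutes_inj [OF \<tau>perm])
          moreover have "D - {x} = C" using \<open>x \<notin> C\<close> by (auto simp: D_def)
          ultimately show ?thesis by (simp add: 1 \<tau>x)
        next
          case 2
          have "\<tau> ` (C' - {x}) = C' - {x}"
          proof (rule outside)
            show "(C' - {x}) \<inter> D = {}" using disj C by (auto simp: D_def)
            show "\<sigma> ` (C' - {x}) = C' - {x}"
            proof (cases "C' - {x} = {}")
              case True
              then show ?thesis by (simp only: image_empty)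
            next
              case False
              then show ?thesis by (intro fix_block) (simp add: move_def)
            qed
          qed
          moreover have "C' = insert x (C' - {x})" using C(4) by blast
          ultimately show ?thesis using \<tau>x 2 by (metis image_insert)
        next
          case 3
          show ?thesis
          proof (rule outside)
            show "\<Omega> \<inter> D = {}" using disj C \<Omega> 3 by (auto simp: D_def)
            show "\<sigma> ` \<Omega> = \<Omega>" by (rule fix_block) (simp add: move_def \<Omega> 3)
          qed
        qed
      qed
      then have \<tau>: "\<tau> \<in> block_perms P" using \<tau>perm by (simp add: block_perms_def)
      have "\<sigma> \<circ> swap c x = swap (\<sigma> c) x \<circ> \<tau>" by (auto simp: \<tau>_def fun_eq_iff)
      then have eq: "perm_act \<sigma> (perm_act (swap c x) y) = perm_act (swap (\<sigma> c) x) (perm_act \<tau> y)"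
        by (simp only: perm_act_comp)
      have "permutation \<sigma>" using perm by (auto simp: permutation_permutes)
      then have "sign \<tau> = sign (swap (\<sigma> c) x) * sign \<sigma> * sign (swap c x)"
        by (simp add: \<tau>_def sign_compose permutation_compose permutation_swap_id)
      then have "sign (swap c x) * sign \<tau> = sign \<sigma> * sign (swap (\<sigma> c) x)"
        using sign_idempotent [of "swap c x"] by (simp add: mult_ac)
      then have "sgn_poly (swap c x) * sgn_poly \<tau> =
          (sgn_poly \<sigma> * sgn_poly (swap (\<sigma> c) x) :: 'n cpoly)"
        by (metis Cst_mult of_int_mult)
      then show ?thesis
        unfolding perm_act_mult perm_act_Cst eq Semi_perm_act [OF y \<tau>] mult.assoc [symmetric] by simp
    qed
    have "perm_act \<sigma> z = (\<Sum>c\<in>D. sgn_poly \<sigma> *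
        (sgn_poly (swap (\<sigma> c) x) * perm_act (swap (\<sigma> c) x) y))"
      unfolding z perm_act_sum by (rule sum.cong [OF refl summand])
    also have "\<dots> = sgn_poly \<sigma> * z"
      unfolding sum_distrib_left [symmetric] z
      by (subst sum.reindex_bij_betw [OF bD, where g = "\<lambda>c. sgn_poly (swap c x) * perm_act (swap c x) y"]) simp
    finally show ?thesis .
  qed
  ultimately show ?thesis unfolding z_def [symmetric] Semi_def by blast
qed

text \<open>Among the modules isomorphic to \<open>M\<close> take one, \<open>M'\<close>, that consists of semi-invariants for a
  partition \<open>P\<close> with the largest sum of squares of block sizes.  By this choice the
  antisymmetrization over a block enlarged by one element of a block that is not larger vanishes on
  \<open>M'\<close>, being a homomorphism into semi-invariants for a partition with a larger sum of squares.  Elements of \<open>M'\<close> of lowest degree are killed by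
  operators of negative degree, so their exponents are standard, and they are multiples of the
  generator.\<close>

lemma simple_module_iso_gen_mod:
  fixes M :: "'n cpoly set"
  assumes M: "op_simple (inv_ops d {}) M"
  shows "\<exists>\<alpha> P. adm d \<alpha> P \<and> op_iso (inv_ops d {}) M (gen_mod d s \<alpha> P)"
proof -
  define ok where "ok = (\<lambda>P. \<exists>\<alpha> M'. adm d \<alpha> P \<and> op_simple (inv_ops d {}) M' \<and>
    op_iso (inv_ops d {}) M M' \<and> M' \<subseteq> Semi d \<alpha> P)"
  have "ok singles" using simple_in_Semi [OF M] by (simp add: ok_def)
  moreover have "square_sum P < Suc (square_sum UNIV)" for P
    unfolding square_sum_def less_Suc_eq_le by (rule sum_mono2) auto
  ultimately obtain P where "ok P" and P_max: "\<And>P'. ok P' \<Longrightarrow> square_sum P' \<le> square_sum P"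
    using ex_has_greatest_nat [of ok singles square_sum "Suc (square_sum UNIV)"] by blast
  then obtain \<alpha> M' where P: "adm d \<alpha> P" and M': "op_simple (inv_ops d {}) M'"
    and iso: "op_iso (inv_ops d {}) M M'" and sub: "M' \<subseteq> Semi d \<alpha> P"
    unfolding ok_def by blast
  have M'_sub: "op_submodule (inv_ops d {}) M'" using M' by (simp add: op_simple_def)
  have exchange: "cf y w = (\<Sum>c\<in>C. cf y (w \<circ> swap c x))"
    if y: "y \<in> M'" and C: "C \<in> P" "C' \<in> P" "C \<noteq> C'" "x \<in> C'" and \<alpha>: "\<And>c. c \<in> C \<Longrightarrow> \<alpha> c = \<alpha> x"
      and le: "card C' \<le> card C" for y C C' x w
  proof -
    define \<phi> where "\<phi> = (\<lambda>p. p - (\<Sum>c\<in>C. perm_act (swap c x) p))"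
    have "\<phi> y = 0"
    proof (rule ccontr)
      assume nz: "\<phi> y \<noteq> 0"
      have add: "\<phi> (p + q) = \<phi> p + \<phi> q" for p q
        by (simp add: \<phi>_def perm_act_add sum.distrib)
      have tr: "swap c x \<in> block_perms {}" for c by (simp add: block_perms_def permutes_swap_id)
      have comm: "\<phi> (D p) = D (\<phi> p)" if D: "D \<in> inv_ops d {}" for D p
      proof -
        have "perm_act (swap c x) (D p) = D (perm_act (swap c x) p)" for c
          using D tr by (simp add: inv_ops_iff [OF d])
        then show ?thesis
          unfolding \<phi>_def by (simp add: weyl_minus [OF inv_ops_weyl [OF D]] weyl_sum [OF inv_ops_weyl [OF D]])
      qed
      have "op_iso (inv_ops d {}) M' (\<phi> ` M')" "op_simple (inv_ops d {}) (\<phi> ` M')"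
        using image_of_simple [of _ \<phi>, OF M' _ _ y nz] add comm by blast+
      moreover have "\<phi> ` M' \<subseteq> Semi d \<alpha> (move P C C' x)"
        using antisymmetrize_move [OF P C \<alpha>] sub unfolding \<phi>_def by blast
      ultimately have "ok (move P C C' x)"
        unfolding ok_def using move_adm [OF P C \<alpha>] op_iso_trans [OF iso] by blast
      then show False
        using P_max square_sum_move [OF alpha_partition_on [OF adm_partition [OF P]] C le] by (meson not_le)
    qed
    then have "cf (\<phi> y) w = 0" by simp
    then show ?thesis by (simp add: \<phi>_def cf_perm_act del: comp_apply)
  qed
  obtain x where x: "x \<in> M'" "x \<noteq> 0" using M' op_submodule_0 [OF M'_sub] unfolding op_simple_def by blast
  define low where "low = (\<lambda>m. \<exists>p\<in>M'. hom_part m p \<noteq> 0)"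
  define m where "m = (LEAST m. low m)"
  have "\<exists>m. low m" using hom_part_nonzero [OF x(2)] x(1) by (auto simp: low_def)
  then have "low m" unfolding m_def by (auto intro: LeastI)
  then obtain p where p: "p \<in> M'" "hom_part m p \<noteq> 0" by (auto simp: low_def)
  define y where "y = hom_part m p"
  have y: "y \<in> M'" "y \<noteq> 0" "hom_deg m y"
    using op_submodule_hom_part [OF d M'_sub p(1)] p(2) hom_deg_hom_part by (auto simp: y_def)
  have ySemi: "y \<in> Semi d \<alpha> P" using y(1) sub by blast
  have lower: "(\<Sum>i | u i = a. cf y (u(i := b))) = 0" if ab: "a < b" "a mod d = b mod d" for a b u
  proof (rule ccontr)
    assume nz: "(\<Sum>i | u i = a. cf y (u(i := b))) \<noteq> 0"
    obtain N where "\<forall>u\<in>supp y. \<forall>i. u i \<le> N" using supp_bound by blast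
    then obtain E where E: "E \<in> inv_ops d {}" "\<And>w. cf (E y) w = (\<Sum>i | w i = a. cf y (w(i := b)))"
      using exchange_op [OF d ab(2)] by blast
    obtain i where "u i = a" "cf y (u(i := b)) \<noteq> 0" using nz by (metis (mono_tags, lifting) mem_Collect_eq sum.neutral)
    then have "wt (u(i := b)) = m" using y(3) by (auto simp: supp_iff)
    then have "wt u < m" using wt_upd [of u i b] \<open>u i = a\<close> ab(1) by simp
    moreover have "cf (hom_part (wt u) (E y)) u \<noteq> 0" using nz by (simp add: cf_hom_part E(2))
    then have "hom_part (wt u) (E y) \<noteq> 0" by auto
    then have "low (wt u)" using op_submodule_op [OF M'_sub E(1) y(1)] by (auto simp: low_def)
    then have "m \<le> wt u" unfolding m_def by (rule Least_le)
    ultimately show False by simp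
  qed
  have std: "standard d P w" if "w \<in> supp y" for w
    by (rule highest_weight_standard [OF d adm_partition [OF P] ySemi exchange [OF y(1)] lower that])
  obtain u where u: "u \<in> supp (gen s \<alpha> P)" using exists_supp [OF Semi_gen(3) [OF P]] by blast
  have "wt w = gen_deg s \<alpha> P" if "w \<in> supp y" for w
    using standard_wt [OF adm_partition [OF P] ySemi Semi_gen(2) [OF P] that u std [OF that] gen_standard [OF P u]]
      Semi_gen(4) [OF P] u by simp
  then obtain c where c: "c \<noteq> 0" "y = Cst c * gen s \<alpha> P" using gen_multiple [OF P ySemi y(2)] by blast
  have "y \<in> gen_mod d s \<alpha> P"
    unfolding c(2) by (rule op_submodule_scale [OF d gen_mod_submodule gen_in_gen_mod])
  then have "M' = gen_mod d s \<alpha> P"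
    using op_simple_eqI [OF M' gen_mod_submodule y(1)] op_simple_eqI [OF gen_mod_simple [OF P] M'_sub _ y(1)] y(2)
    by blast
  with iso P show ?thesis by blast
qed

lemma N_P_gen:
  assumes "adm d \<alpha> P"
  shows "N_P d \<alpha> P (s P) = Semi d \<alpha> P" and "op_simple (inv_ops d P) (N_P d \<alpha> P (s P))"
proof -
  have "N_P d \<alpha> P (s P) = {D (gen s \<alpha> P) | D. D \<in> inv_ops d P}"
    unfolding N_P_def gen_def by (rule op_gen_single [OF d])
  then show "N_P d \<alpha> P (s P) = Semi d \<alpha> P" "op_simple (inv_ops d P) (N_P d \<alpha> P (s P))"
    using adm_cyclic(1) [OF assms assms assms assms] adm_cyclic(2) [OF assms assms assms assms order_refl]
    by simp_all
qed

lemma M_P_gen: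
  assumes "adm d \<alpha> P"
  shows "M_P d \<alpha> P (s P) = gen_mod d s \<alpha> P"
proof -
  have "{y \<in> Semi d \<alpha> P. \<forall>D\<in>weyl_inv_neg (GP_mats d P). D y = 0} = {Cst c * gen s \<alpha> P | c. True}"
    by (rule killed_by_negative [OF d Semi_gen(1) [OF assms] Semi_adm_submodule [OF assms] Semi_gen(4) [OF assms]])
  then show ?thesis
    unfolding M_P_def J_def N_P_gen(1) [OF assms] G_mats_eq gen_mod_def by (simp only: op_gen_line [OF d])
qed

end

section \<open>The classification\<close>

theorem proposition4p6:
  fixes d :: nat and s :: "'n::finite set set \<Rightarrow> 'n cpoly"
  assumes d: "d \<ge> 1"
    and jacobian: "\<And>\<alpha> P. multi_index d \<alpha> \<Longrightarrow> alpha_partition \<alpha> P \<Longrightarrow> is_jacobian d P (s P)"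
  shows
    "(\<forall>N :: 'n cpoly set. op_simple (weyl_inv (A_mats d)) N \<longleftrightarrow>
        (\<exists>\<alpha>. multi_index d \<alpha> \<and> N = N_alpha d \<alpha>)) \<and>
     (\<forall>\<alpha> \<beta> :: 'n \<Rightarrow> nat. multi_index d \<alpha> \<longrightarrow> multi_index d \<beta> \<longrightarrow>
        (op_iso (weyl_inv (A_mats d)) (N_alpha d \<beta>) (N_alpha d \<alpha>) \<longleftrightarrow> \<alpha> = \<beta>)) \<and>
     (\<forall>\<alpha> P. multi_index d \<alpha> \<longrightarrow> alpha_partition \<alpha> P \<longrightarrow>
        N_P d \<alpha> P (s P) = {f * (s P * xpow \<alpha>) | f. f \<in> poly_inv (GP_mats d P)} \<and>
        op_simple (weyl_inv (GP_mats d P)) (N_P d \<alpha> P (s P))) \<and>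
     (\<forall>\<alpha> P. multi_index d \<alpha> \<longrightarrow> alpha_partition \<alpha> P \<longrightarrow>
        M_P d \<alpha> P (s P) = op_gen (weyl_inv (G_mats d)) {s P * xpow \<alpha>} \<and>
        op_simple (weyl_inv (G_mats d)) (M_P d \<alpha> P (s P))) \<and>
     (\<forall>\<alpha> \<beta> P Q. multi_index d \<alpha> \<longrightarrow> alpha_partition \<alpha> P \<longrightarrow>
        multi_index d \<beta> \<longrightarrow> alpha_partition \<beta> Q \<longrightarrow>
        (op_iso (weyl_inv (G_mats d)) (M_P d \<alpha> P (s P)) (M_P d \<beta> Q (s Q)) \<longleftrightarrow>
          (\<forall>i<d. shape \<alpha> P i = shape \<beta> Q i) \<and>
          (\<exists>\<sigma>. \<sigma> permutes UNIV \<and> \<beta> = \<alpha> \<circ> inv \<sigma>))) \<and>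
     (\<forall>M. op_simple (weyl_inv (G_mats d)) M \<longrightarrow>
        (\<exists>\<alpha> P. multi_index d \<alpha> \<and> alpha_partition \<alpha> P \<and>
          op_iso (weyl_inv (G_mats d)) M (M_P d \<alpha> P (s P))))"
proof -
  have jacobian: "\<forall>\<alpha> P. multi_index d \<alpha> \<longrightarrow> alpha_partition \<alpha> P \<longrightarrow> is_jacobian d P (s P)"
    using jacobian by blast
  have 1: "op_simple (inv_ops d singles) N \<longleftrightarrow> (\<exists>\<alpha>. multi_index d \<alpha> \<and> N = N_alpha d \<alpha>)"
    for N :: "'n cpoly set"
    using N_alpha_structure [OF d] simple_modules_A [OF d] by blast
  have 2: "op_iso (inv_ops d singles) (N_alpha d \<beta>) (N_alpha d \<alpha>) \<longleftrightarrow> \<alpha> = \<beta>"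
    if "multi_index d \<alpha>" "multi_index d \<beta>" for \<alpha> \<beta> :: "'n \<Rightarrow> nat"
    using N_alpha_iso [OF d that] op_iso_refl by blast
  have 3: "N_P d \<alpha> P (s P) = {f * (s P * xpow \<alpha>) | f. f \<in> inv_polys d P} \<and>
      op_simple (inv_ops d P) (N_P d \<alpha> P (s P))" if "multi_index d \<alpha>" "alpha_partition \<alpha> P" for \<alpha> P
  proof -
    have "adm d \<alpha> P" using that by (simp add: adm_def)
    then show ?thesis
      using N_P_gen [OF d jacobian] Semi_gen(1) [OF d jacobian] by (simp add: gen_def)
  qed
  have 4: "M_P d \<alpha> P (s P) = op_gen (inv_ops d {}) {s P * xpow \<alpha>} \<and>
      op_simple (inv_ops d {}) (M_P d \<alpha> P (s P))" if "multi_index d \<alpha>" "alpha_partition \<alpha> P" for \<alpha> P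
  proof -
    have "adm d \<alpha> P" using that by (simp add: adm_def)
    then show ?thesis
      using M_P_gen [OF d jacobian] gen_mod_simple [OF d jacobian]
      by (simp add: gen_mod_def gen_def op_gen_single [OF d])
  qed
  have 5: "op_iso (inv_ops d {}) (M_P d \<alpha> P (s P)) (M_P d \<beta> Q (s Q)) \<longleftrightarrow>
      (\<forall>i<d. shape \<alpha> P i = shape \<beta> Q i) \<and> (\<exists>\<sigma>. \<sigma> permutes UNIV \<and> \<beta> = \<alpha> \<circ> inv \<sigma>)"
    if h: "multi_index d \<alpha>" "alpha_partition \<alpha> P" "multi_index d \<beta>" "alpha_partition \<beta> Q" for \<alpha> \<beta> P Q
  proof -
    have P: "adm d \<alpha> P" and Q: "adm d \<beta> Q" using h by (simp_all add: adm_def)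
    have M: "M_P d \<alpha> P (s P) = gen_mod d s \<alpha> P" "M_P d \<beta> Q (s Q) = gen_mod d s \<beta> Q"
      using M_P_gen [OF d jacobian] P Q by simp_all
    show ?thesis
      unfolding M
    proof
      assume "op_iso (inv_ops d {}) (gen_mod d s \<alpha> P) (gen_mod d s \<beta> Q)"
      then have "\<forall>i<d. shape \<alpha> P i = shape \<beta> Q i" using gen_mod_iso_imp [OF d jacobian P Q] by blast
      moreover from this obtain \<sigma> where "\<sigma> permutes UNIV" "\<beta> = \<alpha> \<circ> inv \<sigma>"
        using matching_permutation [OF h] by metis
      ultimately show "(\<forall>i<d. shape \<alpha> P i = shape \<beta> Q i) \<and> (\<exists>\<sigma>. \<sigma> permutes UNIV \<and> \<beta> = \<alpha> \<circ> inv \<sigma>)"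
        by blast
    next
      assume "(\<forall>i<d. shape \<alpha> P i = shape \<beta> Q i) \<and> (\<exists>\<sigma>. \<sigma> permutes UNIV \<and> \<beta> = \<alpha> \<circ> inv \<sigma>)"
      then obtain \<sigma> where "\<sigma> permutes UNIV" "\<beta> = \<alpha> \<circ> inv \<sigma>" "(`) \<sigma> ` P = Q"
        using matching_permutation [OF h] by metis
      then show "op_iso (inv_ops d {}) (gen_mod d s \<alpha> P) (gen_mod d s \<beta> Q)"
        by (rule gen_mod_iso_perm [OF d jacobian P Q])
    qed
  qed
  have 6: "\<exists>\<alpha> P. multi_index d \<alpha> \<and> alpha_partition \<alpha> P \<and> op_iso (inv_ops d {}) M (M_P d \<alpha> P (s P))"
    if "op_simple (inv_ops d {}) M" for M
    using simple_module_iso_gen_mod [OF d jacobian that] M_P_gen [OF d jacobian] by (metis adm_def)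
  show ?thesis
    unfolding A_mats_eq G_mats_eq
    by (intro conjI allI impI, rule 1, (rule 2; assumption), (rule 3 [THEN conjunct1]; assumption),
        (rule 3 [THEN conjunct2]; assumption), (rule 4 [THEN conjunct1]; assumption),
        (rule 4 [THEN conjunct2]; assumption), (rule 5; assumption), rule 6)
qed

end
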